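(* Let $f:\mathbb{R}^n\to\mathbb{R}$ be a Borel measurable function with bounded Chebyshev degree $d_f$ and associated constant $A_f$. Let $0\le s\le1$ and let $\mu$ be an $s$-concave probability measure on $\mathbb{R}^n$. Denote by $M_f$ the $\mu$-median of $|f|^{1/d_f}$ and let $c_s:=(1-2^{-s})/s$ for $s>0$ and $c_0=\ln2$. Then for every $t>1$ $$\mu(\{|f|^{1/d_f}\ge A_fM_ft\})\le(1-sc_st)_+^{1/s}\le e^{-c_st}\le e^{-t/2},$$ and for every $p>0$ $$\bigl\||f|^{1/d_f}\bigr\|_{L^p(\mu)}\le A_fM_f\left(1+\frac{p\,B(p,1+\frac1s)}{(sc_s)^p}\right)^{1/p}\le A_fM_f\left(1+2^p\,\Gamma(p+1)\right)^{1/p}.$$ For $s=0$ the expressions are interpreted as limits as $s\to0^+$: $(1-sc_st)_+^{1/s}$ becomes $2^{-t}$ and $\frac{pB(p,1+1/s)}{(sc_s)^p}$ becomes $\frac{\Gamma(p+1)}{(\ln2)^p}$.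
   Context: A Borel function $f:\mathbb{R}^n\to\mathbb{R}$ has bounded Chebyshev degree if there exist $A>0$ and $d>0$ such that for every interval $I$ in $\mathbb{R}^n$ and every Borel subset $J$ of $I$ (with $|J|>0$) $$\sup_I|f|\le\left(\frac{A|I|}{|J|}\right)^{d}\sup_J|f|.$$ The smallest such power $d$ is called the Chebyshev degree of $f$, denoted $d_f$, and the best (smallest) constant $A$ corresponding to this power is denoted $A_f$. An interval in $\mathbb{R}^n$ is an interval (segment) contained in an affine line, and $|\cdot|$ is one-dimensional Lebesgue measure. $a_+=\max(a,0)$; $B$ and $\Gamma$ are the Euler Beta and Gamma functions; $\|g\|_{L^p(\mu)}=\left(\int|g|^p\,d\mu\right)^{1/p}$ for every $p>0$. A median $M$ of a function $g$ satisfies $\mu(g\ge M)\ge\frac12$ and $\mu(g\le M)\ge\frac12$. For $s\in[0,1]$, a (Borel) measure $\mu$ on $\mathbb{R}^n$ is $s$-concave if $$\mu(\alpha A+(1-\alpha)B)\ge[\alpha\mu(A)^s+(1-\alpha)\mu(B)^s]^{1/s}$$ for all compact $A,B\subset\mathbb{R}^n$ with $\mu(A)\mu(B)>0$ and all $\alpha\in[0,1]$, where $\alpha A+(1-\alpha)B=\{\alpha x+(1-\alpha)y: x\in A,\ y\in B\}$; for $s=0$ the right-hand side is interpreted as $\mu(A)^\alpha\mu(B)^{1-\alpha}$.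
   Formalization: The first tail inequality is stated only when f is not μ-almost everywhere zero; otherwise M_f = 0 and it fails (e.g. f(x) = x on the real line with μ the Dirac mass at 0: left side 1, right side below 1). *)

theory Defs
  imports "HOL-Probability.Probability"
begin

text \<open>One-dimensional Lebesgue measure of a subset \<open>S\<close> of the affine line
  \<open>{x + t u | t \<in> \<real>}\<close>; intended for \<open>norm u = 1\<close>, so that the parametrisation is an isometry.\<close>

definition line_measure :: "'a::euclidean_space \<Rightarrow> 'a \<Rightarrow> 'a set \<Rightarrow> real" where
  "line_measure x u S = measure lborel {t::real. x + t *\<^sub>R u \<in> S}"

text \<open>Intervals are the bounded convex subsets of affine lines. The suprema are taken in
  \<^typ>\<open>ennreal\<close>, because \<open>f\<close> is not assumed to be bounded on intervals.\<close>

definition chebyshev_ineq :: "('a::euclidean_space \<Rightarrow> real) \<Rightarrow> real \<Rightarrow> real \<Rightarrow> bool" where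
  "chebyshev_ineq f A d \<longleftrightarrow>
     (\<forall>x u I J. norm u = 1 \<and> I \<subseteq> range (\<lambda>t::real. x + t *\<^sub>R u) \<and> convex I \<and> bounded I
        \<and> J \<in> sets borel \<and> J \<subseteq> I \<and> line_measure x u J > 0 \<longrightarrow>
        (SUP y\<in>I. ennreal \<bar>f y\<bar>) \<le>
          ennreal ((A * line_measure x u I / line_measure x u J) powr d) *
            (SUP y\<in>J. ennreal \<bar>f y\<bar>))"

definition chebyshev_exponent :: "('a::euclidean_space \<Rightarrow> real) \<Rightarrow> real \<Rightarrow> bool" where
  "chebyshev_exponent f d \<longleftrightarrow> d > 0 \<and> (\<exists>A>0. chebyshev_ineq f A d)"

definition bounded_chebyshev_degree :: "('a::euclidean_space \<Rightarrow> real) \<Rightarrow> bool" where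
  "bounded_chebyshev_degree f \<longleftrightarrow> (\<exists>d. chebyshev_exponent f d)"

text \<open>The smallest exponent need not exist (nonzero constants admit every \<open>d > 0\<close>), so the degree
  and its constant are given as predicates: \<open>d\<close> is a least admissible exponent, and
  \<open>A\<close> a least constant for the exponent \<open>d\<close>.\<close>

definition is_chebyshev_degree :: "('a::euclidean_space \<Rightarrow> real) \<Rightarrow> real \<Rightarrow> bool" where
  "is_chebyshev_degree f d \<longleftrightarrow>
     chebyshev_exponent f d \<and> (\<forall>d'. chebyshev_exponent f d' \<longrightarrow> d \<le> d')"

definition is_chebyshev_const :: "('a::euclidean_space \<Rightarrow> real) \<Rightarrow> real \<Rightarrow> real \<Rightarrow> bool" where
  "is_chebyshev_const f d A \<longleftrightarrow>
     A > 0 \<and> chebyshev_ineq f A d \<and> (\<forall>A'>0. chebyshev_ineq f A' d \<longrightarrow> A \<le> A')"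

definition is_median :: "'a measure \<Rightarrow> ('a \<Rightarrow> real) \<Rightarrow> real \<Rightarrow> bool" where
  "is_median \<mu> g M \<longleftrightarrow>
     measure \<mu> {x \<in> space \<mu>. g x \<ge> M} \<ge> 1/2 \<and> measure \<mu> {x \<in> space \<mu>. g x \<le> M} \<ge> 1/2"

text \<open>Stated with the real-valued \<^const>\<open>measure\<close>, hence meant for finite Borel measures.\<close>

definition s_concave :: "real \<Rightarrow> 'a::euclidean_space measure \<Rightarrow> bool" where
  "s_concave s \<mu> \<longleftrightarrow>
     (\<forall>A B \<alpha>. compact A \<and> compact B \<and> measure \<mu> A * measure \<mu> B > 0 \<and> 0 \<le> \<alpha> \<and> \<alpha> \<le> 1 \<longrightarrow>
        measure \<mu> {\<alpha> *\<^sub>R x + (1 - \<alpha>) *\<^sub>R y | x y. x \<in> A \<and> y \<in> B} \<ge>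
          (if s = 0 then measure \<mu> A powr \<alpha> * measure \<mu> B powr (1 - \<alpha>)
           else (\<alpha> * measure \<mu> A powr s + (1 - \<alpha>) * measure \<mu> B powr s) powr (1 / s)))"

text \<open>A Bochner integral, hence \<open>0\<close> if \<open>\<bar>g\<bar>\<^sup>p\<close> is not integrable: bounds on this
  quantity have to be accompanied by integrability.\<close>

definition Lp_norm :: "real \<Rightarrow> 'a measure \<Rightarrow> ('a \<Rightarrow> real) \<Rightarrow> real" where
  "Lp_norm p \<mu> g = (LINT x|\<mu>. \<bar>g x\<bar> powr p) powr (1 / p)"

definition conc_const :: "real \<Rightarrow> real" where
  "conc_const s = (if s = 0 then ln 2 else (1 - 2 powr (- s)) / s)"

text \<open>In the next two definitions the value at \<open>s = 0\<close> is the limit as \<open>s\<close> tends to \<open>0\<close> from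
  above.\<close>

definition conc_tail :: "real \<Rightarrow> real \<Rightarrow> real" where
  "conc_tail s t =
     (if s = 0 then 2 powr (- t) else (max (1 - s * conc_const s * t) 0) powr (1 / s))"

definition conc_moment :: "real \<Rightarrow> real \<Rightarrow> real" where
  "conc_moment s p =
     (if s = 0 then Gamma (p + 1) / (ln 2) powr p
      else p * Beta p (1 + 1 / s) / (s * conc_const s) powr p)"

end

theory Submission imports Defs begin

text \<open>
  Let \<open>K\<close> and \<open>F\<close> be the sets where \<open>\<bar>f\<bar>\<^sup>1\<^sup>/\<^sup>d\<close> is at least \<open>A M t\<close> and at most \<open>M\<close>. The Chebyshev inequality,
  applied to a segment issuing from a point of \<open>K\<close>, says that \<open>F\<close> occupies at most the fraction
  \<open>\<theta> = 1/t\<close> of that segment. The tail bound then comes from the dilation inequality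
  \<open>\<mu>(-F) \<ge> (\<theta> \<mu>(K)\<^sup>s + 1 - \<theta>)\<^sup>1\<^sup>/\<^sup>s\<close>, and integrating the tail gives the moments.

  If the dilation inequality fails for compact \<open>K\<close>, \<open>F\<close>, it fails on ever smaller convex
  bodies: a hyperplane through a codimension-two subspace can be rotated until it divides
  a body into halves with the same proportion of \<open>K\<close>, and by homogeneity one half violates the
  inequality again. Enough such cuts shrink the bodies to a segment, so that it suffices to treat
  \<open>s\<close>-concave measures on the line, where sections of \<open>K\<close> and \<open>F\<close> are replaced by small neighbourhoods.

  On the line let \<open>w\<close> be the mode of the density. Away from the component \<open>J\<close> of \<open>- K\<close> containing
  \<open>w\<close>, the density is monotone on each component, towards the side where a point of \<open>K\<close> controls \<open>F\<close>,
  and \<open>F\<close> fills at most the fraction \<open>\<theta>\<close> of its mass. In \<open>J\<close> the worst \<open>F\<close> is an interval around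
  \<open>w\<close>, for which the dilation inequality is the concavity of \<open>\<mu>\<close> for two intervals.
\<close>

section \<open>Power means of two numbers\<close>

text \<open>The constant \<open>conc_const s\<close> comes from the last step: as \<open>F\<close>
  has mass at least 1/2, the dilation inequality with \<theta> = 1/t puts the mean of \<mu>(K) and 1
  at or below 1/2, and solving for the s-th power of \<mu>(K) leaves 1 - t (1 - 2 powr (-s)). The
  mean is homogeneous of degree one. So on all bodies C with the same proportion of K the inequality
  reads c \<mu>(C) \<le> \<mu>(C - F) with a single c; both sides are additive over two halves, and
  one half inherits a violation. The obstacle is the limit segment, which may have mass 0 and
  carries no obvious measure. None is built: the cutting stops at a body of positive mass close to a
  line, and \<mu> restricted to this body is projected to the line. This keeps s-concavity but moves
  points, so the sections of K and F must be enlarged, which spoils the density condition by a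
  little. The strictness of the assumed violation pays for it with a slightly larger
  \<theta>.\<close>

definition pmean :: "real \<Rightarrow> real \<Rightarrow> real \<Rightarrow> real \<Rightarrow> real" where
  "pmean s \<theta> u m =
     (if s = 0 then u powr \<theta> * m powr (1 - \<theta>)
      else (\<theta> * u powr s + (1 - \<theta>) * m powr s) powr (1 / s))"

lemma s_concaveD:
  assumes "s_concave s \<mu>" "compact A" "compact B" "measure \<mu> A > 0" "measure \<mu> B > 0" "0 \<le> \<alpha>" "\<alpha> \<le> 1"
  shows "pmean s \<alpha> (measure \<mu> A) (measure \<mu> B)
           \<le> measure \<mu> {\<alpha> *\<^sub>R x + (1 - \<alpha>) *\<^sub>R y | x y. x \<in> A \<and> y \<in> B}"
  using assms unfolding s_concave_def pmean_def by (simp add: mult_pos_pos)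

lemma pmean_nonneg [simp]: "0 \<le> pmean s \<theta> u m"
  by (simp add: pmean_def)

context
  fixes s \<theta> :: real
  assumes s: "0 \<le> s" "s \<le> 1" and th: "0 \<le> \<theta>" "\<theta> \<le> 1"
begin

lemma pmean_same: assumes "0 \<le> u" shows "pmean s \<theta> u u = u"
proof (cases "u = 0")
  case True
  then show ?thesis by (simp add: pmean_def)
next
  case False
  then have "u > 0" using assms by simp
  then show ?thesis
    using s by (auto simp: pmean_def powr_add[symmetric] powr_powr algebra_simps)
qed

lemma pmean_mono:
  assumes "0 \<le> u" "u \<le> u'" "0 \<le> m" "m \<le> m'"
  shows "pmean s \<theta> u m \<le> pmean s \<theta> u' m'"
  using assms s th unfolding pmean_def
  by (auto intro!: mult_mono powr_mono2 add_mono mult_left_mono)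

lemma pmean_scale:
  assumes "0 \<le> c" "0 \<le> u" "0 \<le> m"
  shows "pmean s \<theta> (c * u) (c * m) = c * pmean s \<theta> u m"
proof (cases "c = 0")
  case True
  then show ?thesis by (simp add: pmean_def)
next
  case False
  then have c: "c > 0" using assms by simp
  show ?thesis
  proof (cases "s = 0")
    case True
    have "c powr \<theta> * c powr (1 - \<theta>) = c" using c by (simp add: powr_add[symmetric])
    then show ?thesis using True assms c
      by (simp add: pmean_def powr_mult algebra_simps)
  next
    case False
    have "\<theta> * (c * u) powr s + (1 - \<theta>) * (c * m) powr s
        = c powr s * (\<theta> * u powr s + (1 - \<theta>) * m powr s)"
      using assms by (simp add: powr_mult algebra_simps)
    then show ?thesis using False c s th
      by (simp add: pmean_def powr_mult powr_powr)
  qed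
qed

lemma pmean_le_right: assumes "0 \<le> u" "u \<le> m" shows "pmean s \<theta> u m \<le> m"
  using pmean_mono[of u m m m] pmean_same[of m] assms by simp

lemma pmean_ge_min: assumes "0 \<le> u" "0 \<le> m" shows "min u m \<le> pmean s \<theta> u m"
  using pmean_mono[of "min u m" u "min u m" m] pmean_same[of "min u m"] assms by simp

text \<open>In the second argument x the mean has derivative (1 - \<theta>) (mean / x) powr (1 - s).
  For u \<le> x the mean is at most x, so with s \<le> 1 the derivative is at most 1 -
  \<theta>.\<close>

lemma pmean_add_right:
  assumes u: "0 < u" "u \<le> m" and g: "0 \<le> g"
  shows "pmean s \<theta> u (m + g) \<le> pmean s \<theta> u m + (1 - \<theta>) * g"
proof -
  have m: "m > 0" using u by simp
  have der: "\<exists>D. ((\<lambda>x. pmean s \<theta> u x) has_real_derivative D) (at x) \<and> D \<le> 1 - \<theta>" if x: "m \<le> x" for x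
  proof -
    have x0: "x > 0" and ux: "u \<le> x" using m x u by auto
    show ?thesis
    proof (cases "s = 0")
      case True
      have "((\<lambda>x. u powr \<theta> * x powr (1 - \<theta>)) has_real_derivative
              u powr \<theta> * ((1 - \<theta>) * x powr (1 - \<theta> - 1))) (at x)"
        using x0 by (auto intro!: derivative_eq_intros)
      moreover have "u powr \<theta> * ((1 - \<theta>) * x powr (1 - \<theta> - 1)) \<le> 1 - \<theta>"
      proof -
        have "u powr \<theta> * x powr (- \<theta>) \<le> x powr \<theta> * x powr (- \<theta>)"
          using u ux th by (intro mult_right_mono powr_mono2) auto
        also have "\<dots> = 1" using x0 by (simp add: powr_add[symmetric])
        finally show ?thesis using th
          by (simp add: mult_left_le mult.left_commute)
      qed
      ultimately show ?thesis using True by (auto simp: pmean_def)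
    next
      case False
      then have s0: "s > 0" using s by simp
      define q where "q = \<theta> * u powr s + (1 - \<theta>) * x powr s"
      have "min (u powr s) (x powr s) \<le> q"
        unfolding q_def using convex_bound_le[of "- (u powr s)" "- min (u powr s) (x powr s)" "- (x powr s)" \<theta> "1 - \<theta>"] th
        by auto
      moreover have "u powr s > 0" "x powr s > 0" using u x0 by auto
      ultimately have q0: "q > 0" by linarith
      have qx: "q \<le> x powr s"
        unfolding q_def using convex_bound_le[of "u powr s" "x powr s" "x powr s" \<theta> "1 - \<theta>"] th
          powr_mono2[of s u x] u ux s by auto
      have "((\<lambda>x. (\<theta> * u powr s + (1 - \<theta>) * x powr s) powr (1/s)) has_real_derivative
              (1/s) * q powr (1/s - 1) * ((1 - \<theta>) * (s * x powr (s - 1)))) (at x)"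
        using x0 q0 s0 unfolding q_def by (auto intro!: derivative_eq_intros)
      moreover have "(1/s) * q powr (1/s - 1) * ((1 - \<theta>) * (s * x powr (s - 1))) \<le> 1 - \<theta>"
      proof -
        have "q powr (1/s - 1) * x powr (s - 1) \<le> (x powr s) powr (1/s - 1) * x powr (s - 1)"
          using qx q0 s s0 by (intro mult_right_mono powr_mono2) (auto simp: field_simps)
        also have "\<dots> = x powr (s * (1/s - 1) + (s - 1))"
          by (simp add: powr_powr powr_add)
        also have "s * (1/s - 1) + (s - 1) = 0" using s0 by (simp add: field_simps)
        finally have "q powr (1/s - 1) * x powr (s - 1) \<le> 1" using x0 by simp
        then have "(1 - \<theta>) * (q powr (1/s - 1) * x powr (s - 1)) \<le> (1 - \<theta>) * 1"
          using th by (intro mult_left_mono) auto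
        then show ?thesis using s0 by (simp add: mult_ac)
      qed
      ultimately show ?thesis using False by (auto simp: pmean_def)
    qed
  qed
  have "pmean s \<theta> u (m + g) - (1 - \<theta>) * (m + g) \<le> pmean s \<theta> u m - (1 - \<theta>) * m"
  proof (rule DERIV_nonpos_imp_nonincreasing[where f = "\<lambda>x. pmean s \<theta> u x - (1 - \<theta>) * x"])
    show "m \<le> m + g" using g by simp
    fix x assume "m \<le> x" "x \<le> m + g"
    then obtain D where "((\<lambda>x. pmean s \<theta> u x) has_real_derivative D) (at x)" "D \<le> 1 - \<theta>"
      using der by blast
    then show "\<exists>y. ((\<lambda>x. pmean s \<theta> u x - (1 - \<theta>) * x) has_real_derivative y) (at x) \<and> y \<le> 0"
      by (intro exI[of _ "D - (1 - \<theta>)"]) (auto intro!: derivative_eq_intros)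
  qed
  then show ?thesis by (simp add: algebra_simps)
qed

lemma pmean_le_arith:
  assumes "0 < u" "u \<le> m"
  shows "pmean s \<theta> u m \<le> \<theta> * u + (1 - \<theta>) * m"
  using pmean_add_right[of u u "m - u"] pmean_same[of u] assms by (simp add: algebra_simps)

text \<open>\<open>u\<close> is the mass of \<open>K\<close> and \<open>m\<close> the total mass of a piece of the space: a piece poorer in \<open>K\<close> may be
  split off if it satisfies the stronger arithmetic inequality.\<close>

lemma pmean_peel:
  assumes u1: "0 < u1" "u1 \<le> m1" and u2: "0 \<le> u2" "u2 \<le> m2"
    and rich: "u2 * m1 \<le> u1 * m2"
  shows "pmean s \<theta> (u1 + u2) (m1 + m2) \<le> pmean s \<theta> u1 m1 + \<theta> * u2 + (1 - \<theta>) * m2"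
proof -
  \<comment> \<open>The second piece is split into a copy of the first scaled by k, handled by
    homogeneity, and a surplus g without K, which costs only (1 - \<theta>) g. The assumption
    \<open>rich\<close> makes g nonnegative.\<close>
  define k where "k = u2 / u1"
  have k: "k \<ge> 0" "u2 = k * u1" using u1 u2 by (auto simp: k_def)
  have km: "k * m1 \<le> m2" using rich u1 unfolding k_def by (simp add: field_simps)
  define g where "g = m2 - k * m1"
  have g: "g \<ge> 0" "m2 = k * m1 + g" using km by (auto simp: g_def)
  have "pmean s \<theta> (u1 + u2) (m1 + m2) = pmean s \<theta> ((1 + k) * u1) ((1 + k) * m1 + g)"
    using k g by (simp add: algebra_simps)
  also have "\<dots> \<le> pmean s \<theta> ((1 + k) * u1) ((1 + k) * m1) + (1 - \<theta>) * g"
    using u1 k g by (intro pmean_add_right) (auto intro!: mult_left_mono)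
  also have "pmean s \<theta> ((1 + k) * u1) ((1 + k) * m1) = (1 + k) * pmean s \<theta> u1 m1"
    using u1 k by (intro pmean_scale) auto
  also have "\<dots> \<le> pmean s \<theta> u1 m1 + k * (\<theta> * u1 + (1 - \<theta>) * m1)"
    using pmean_le_arith[of u1 m1] u1 k by (simp add: distrib_right mult_left_mono)
  finally show ?thesis using k g by (simp add: algebra_simps)
qed

text \<open>Both pairs lie on one ray through the origin, and the mean is linear along rays. It
  serves at a cut that gives both parts the same proportion of K.\<close>

lemma pmean_add_proportional:
  assumes u1: "0 < u1" "u1 \<le> m1" and u2: "0 \<le> u2" "u2 \<le> m2"
    and eq: "u2 * m1 = u1 * m2"
  shows "pmean s \<theta> (u1 + u2) (m1 + m2) = pmean s \<theta> u1 m1 + pmean s \<theta> u2 m2"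
proof -
  define k where "k = u2 / u1"
  have k: "k \<ge> 0" "u2 = k * u1" using u1 u2 by (auto simp: k_def)
  have km: "m2 = k * m1" using eq u1 unfolding k_def by (simp add: field_simps)
  have "pmean s \<theta> (u1 + u2) (m1 + m2) = pmean s \<theta> ((1 + k) * u1) ((1 + k) * m1)"
    using k km by (simp add: algebra_simps)
  also have "\<dots> = pmean s \<theta> u1 m1 + k * pmean s \<theta> u1 m1"
    using u1 k by (subst pmean_scale) (auto simp: algebra_simps)
  also have "k * pmean s \<theta> u1 m1 = pmean s \<theta> u2 m2"
    using u1 k km by (subst pmean_scale[symmetric]) auto
  finally show ?thesis .
qed

end

text \<open>All three arguments may move: the uses are \<theta> increased a little, a mass
  approximated, and \<theta> tending to 0. Positive limits u and m keep \<open>powr\<close>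
  continuous.\<close>

lemma tendsto_pmean:
  assumes "0 \<le> s" "(t \<longlongrightarrow> \<theta>) F" "(f \<longlongrightarrow> u) F" "(g \<longlongrightarrow> m) F" "u > 0" "m > 0" "0 \<le> \<theta>" "\<theta> \<le> 1"
  shows "((\<lambda>x. pmean s (t x) (f x) (g x)) \<longlongrightarrow> pmean s \<theta> u m) F"
proof (cases "s = 0")
  case True
  then show ?thesis unfolding pmean_def using assms by (auto intro!: tendsto_intros)
next
  case False
  have "\<theta> * u powr s + (1 - \<theta>) * m powr s > 0"
    using assms by (cases "\<theta> = 0") (auto intro!: add_pos_nonneg)
  then show ?thesis unfolding pmean_def using assms False by (auto intro!: tendsto_intros)
qed

section \<open>Unimodal densities on the line\<close>

text \<open>A nonnegative nondecreasing D is a mixture of indicators of intervals {q..b}, and on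
  each of these \<open>indicator F - \<theta>\<close> has nonpositive integral by
  \<open>dens\<close>. The second mean value theorem replaces the decomposition of D.\<close>

lemma second_mean_value_set_bound:
  fixes D :: "real \<Rightarrow> real"
  assumes ab: "a \<le> b" and F: "F \<in> sets borel"
    and D: "continuous_on {a..b} D" "\<And>x y. a \<le> x \<Longrightarrow> x \<le> y \<Longrightarrow> y \<le> b \<Longrightarrow> D x \<le> D y" "0 \<le> D a"
    and dens: "\<And>q. a \<le> q \<Longrightarrow> q \<le> b \<Longrightarrow> measure lborel (F \<inter> {q..b}) \<le> \<theta> * (b - q)"
  shows "(LINT x:F \<inter> {a..b}|lborel. D x) \<le> \<theta> * (LINT x:{a..b}|lborel. D x)"
proof -
  define f :: "real \<Rightarrow> real" where "f = (\<lambda>x. indicator F x - \<theta>)"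
  have ind: "set_integrable lborel {q..r} (indicator F :: real \<Rightarrow> real)" for q r
  proof -
    have "emeasure lborel (F \<inter> {q..r}) < \<infinity>"
      by (intro emeasure_bounded_finite bounded_Int) auto
    then have "integrable lborel (indicat_real (F \<inter> {q..r}))"
      using F by (intro integrable_real_indicator) auto
    then show ?thesis
      by (simp add: set_integrable_def indicator_inter_arith[symmetric] Int_commute)
  qed
  have fi: "set_integrable lborel {q..r} f" for q r
    unfolding f_def by (intro set_integral_diff ind borel_integrable_atLeastAtMost' continuous_on_const)
  have fint: "integral {q..b} f \<le> 0" if "a \<le> q" "q \<le> b" for q
  proof -
    have "integral {q..b} f = (LINT x:{q..b}|lborel. f x)"
      by (rule set_borel_integral_eq_integral(2)[symmetric, OF fi])
    also have "\<dots> = (LINT x:{q..b}|lborel. indicator F x) - (LINT x:{q..b}|lborel. \<theta>)"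
      unfolding f_def by (intro set_integral_diff ind borel_integrable_atLeastAtMost' continuous_on_const)
    also have "(LINT x:{q..b}|lborel. indicator F x) = measure lborel (F \<inter> {q..b})"
      using F by (simp add: set_lebesgue_integral_def indicator_inter_arith[symmetric] Int_commute)
    also have "(LINT x:{q..b}|lborel. \<theta>) = \<theta> * (b - q)"
      using that by (simp add: set_lebesgue_integral_def mult.commute)
    finally show ?thesis using dens[OF that] by simp
  qed
  have Di: "set_integrable lborel {a..b} D" by (rule borel_integrable_atLeastAtMost'[OF D(1)])
  have DFi: "set_integrable lborel (F \<inter> {a..b}) D"
    by (rule set_integrable_subset[OF Di]) (use F in auto)
  have int_eq: "integral {a..b} (\<lambda>x. D x * f x) = (LINT x:F \<inter> {a..b}|lborel. D x) - \<theta> * (LINT x:{a..b}|lborel. D x)"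
  proof -
    have eq: "indicator {a..b} x *\<^sub>R (D x * f x) =
        indicator (F \<inter> {a..b}) x *\<^sub>R D x - \<theta> * (indicator {a..b} x *\<^sub>R D x)" for x
      by (auto simp: f_def indicator_def algebra_simps)
    have "set_integrable lborel {a..b} (\<lambda>x. D x * f x)"
      unfolding set_integrable_def eq using Di DFi unfolding set_integrable_def by auto
    from set_borel_integral_eq_integral(2)[OF this]
    have "integral {a..b} (\<lambda>x. D x * f x) = (LINT x:{a..b}|lborel. D x * f x)" by simp
    also have "\<dots> = (LINT x:F \<inter> {a..b}|lborel. D x) - \<theta> * (LINT x:{a..b}|lborel. D x)"
      unfolding set_lebesgue_integral_def eq using Di DFi unfolding set_integrable_def by simp
    finally show ?thesis .
  qed
  have fab: "f integrable_on {a..b}" by (rule set_borel_integral_eq_integral(1)[OF fi])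
  obtain c where c: "c \<in> {a..b}"
    "integral {a..b} (\<lambda>x. D x * f x) = D a * integral {a..c} f + D b * integral {c..b} f"
    using second_mean_value_theorem[OF fab ab, of D] D(2) by blast
  have "integral {a..b} f = integral {a..c} f + integral {c..b} f"
    using c fab by (intro Henstock_Kurzweil_Integration.integral_combine[symmetric]) auto
  \<comment> \<open>Regrouped so that only intervals ending at b occur, with the nonnegative weights
    D a and D b - D a.\<close>
  then have "D a * integral {a..c} f + D b * integral {c..b} f
      = D a * integral {a..b} f + (D b - D a) * integral {c..b} f"
    by (simp add: algebra_simps)
  also have "\<dots> \<le> 0"
    using fint[of a] fint[of c] c ab D(2)[of a b] D(3)
    by (intro add_nonpos_nonpos mult_nonneg_nonpos) auto
  finally show ?thesis using c int_eq by simp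
qed

lemma Collect_uminus_eq_image: "{x::real. - x \<in> S} = uminus ` S"
  by force

lemma measure_lborel_reflect:
  assumes "E \<in> sets (borel :: real measure)"
  shows "measure lborel {x. - x \<in> E} = measure lborel E"
proof -
  have "measure lborel E = measure (distr lborel borel uminus) E" by (simp add: lborel_distr_uminus)
  also have "\<dots> = measure lborel {x. - x \<in> E}"
    using assms by (subst measure_distr) (auto simp: vimage_def)
  finally show ?thesis by simp
qed

lemma second_mean_value_set_bound_decr:
  fixes D :: "real \<Rightarrow> real"
  assumes ab: "a \<le> b" and F: "F \<in> sets borel"
    and D: "continuous_on {a..b} D" "\<And>x y. a \<le> x \<Longrightarrow> x \<le> y \<Longrightarrow> y \<le> b \<Longrightarrow> D y \<le> D x" "0 \<le> D b"
    and dens: "\<And>q. a \<le> q \<Longrightarrow> q \<le> b \<Longrightarrow> measure lborel (F \<inter> {a..q}) \<le> \<theta> * (q - a)"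
  shows "(LINT x:F \<inter> {a..b}|lborel. D x) \<le> \<theta> * (LINT x:{a..b}|lborel. D x)"
proof -
  define F' where "F' = {x. - x \<in> F}"
  have F': "F' \<in> sets borel"
  proof -
    have "F' = uminus -` F \<inter> space borel" by (auto simp: F'_def)
    also have "\<dots> \<in> sets borel" by (rule measurable_sets[OF _ F]) auto
    finally show ?thesis .
  qed
  have "(LINT x:F' \<inter> {-b..-a}|lborel. D (- x)) \<le> \<theta> * (LINT x:{-b..-a}|lborel. D (- x))"
  proof (rule second_mean_value_set_bound[OF _ F'])
    show "continuous_on {-b..-a} (\<lambda>x. D (- x))"
      by (intro continuous_on_compose2[OF D(1)] continuous_intros) auto
    fix q assume q: "- b \<le> q" "q \<le> - a"
    have "F' \<inter> {q..-a} = {x. - x \<in> F \<inter> {a..-q}}" by (auto simp: F'_def)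
    then have "measure lborel (F' \<inter> {q..-a}) = measure lborel (F \<inter> {a..-q})"
      using measure_lborel_reflect[of "F \<inter> {a..-q}"] F by (metis sets.Int borel_closed closed_atLeastAtMost)
    then show "measure lborel (F' \<inter> {q..-a}) \<le> \<theta> * (- a - q)"
      using dens[of "-q"] q by (simp add: algebra_simps)
  qed (use ab D in auto)
  moreover have "{x. - x \<in> F \<inter> {a..b}} = F' \<inter> {-b..-a}" "{x. - x \<in> {a..b}} = {-b..-a}"
    by (auto simp: F'_def)
  ultimately show ?thesis
    by (simp only: set_integral_reflect[of "F \<inter> {a..b}"] set_integral_reflect[of "{a..b}"])
qed


text \<open>The mode w is a parameter because the estimates on its two sides are mirror images.
  Continuity of the density lets points be found by the intermediate value theorem.\<close>

locale unimodal_density =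
  fixes \<rho> :: "real \<Rightarrow> real" and w :: real
  assumes cont: "continuous_on UNIV \<rho>"
    and nonneg: "0 \<le> \<rho> x"
    and integ: "integrable lborel \<rho>"
    and incr: "x \<le> y \<Longrightarrow> y \<le> w \<Longrightarrow> \<rho> x \<le> \<rho> y"
    and decr: "w \<le> x \<Longrightarrow> x \<le> y \<Longrightarrow> \<rho> y \<le> \<rho> x"
begin

definition nu :: "real measure" where "nu = density lborel (\<lambda>x. ennreal (\<rho> x))"

abbreviation mass :: "real set \<Rightarrow> real" where "mass \<equiv> measure nu"

lemma sets_nu [simp, measurable_cong]: "sets nu = sets borel" and space_nu [simp]: "space nu = UNIV"
  by (simp_all add: nu_def)

lemma measurable_rho [measurable]: "\<rho> \<in> borel_measurable borel"
  using cont by (rule borel_measurable_continuous_onI)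

lemma set_integrable_rho: "E \<in> sets borel \<Longrightarrow> set_integrable lborel E \<rho>"
  using integ unfolding set_integrable_def by (intro integrable_mult_indicator) auto

lemma emeasure_nu: "E \<in> sets borel \<Longrightarrow> emeasure nu E = ennreal (LINT x:E|lborel. \<rho> x)"
proof -
  assume E: "E \<in> sets borel"
  have "emeasure nu E = (\<integral>\<^sup>+x. ennreal (\<rho> x) * indicator E x \<partial>lborel)"
    unfolding nu_def using E by (subst emeasure_density) auto
  also have "\<dots> = (\<integral>\<^sup>+x. ennreal (indicator E x *\<^sub>R \<rho> x) \<partial>lborel)"
    by (intro nn_integral_cong) (auto simp: indicator_def)
  also have "\<dots> = ennreal (LINT x:E|lborel. \<rho> x)"
    unfolding set_lebesgue_integral_def
    using set_integrable_rho[OF E] nonneg unfolding set_integrable_def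
    by (intro nn_integral_eq_integral) auto
  finally show ?thesis .
qed

lemma measure_nu: "E \<in> sets borel \<Longrightarrow> mass E = (LINT x:E|lborel. \<rho> x)"
  unfolding measure_def using nonneg
  by (subst emeasure_nu) (auto simp: set_lebesgue_integral_def intro!: integral_nonneg_AE)

sublocale nu: finite_measure nu
  by standard (use emeasure_nu[of UNIV] in auto)

lemma measure_nu_singleton [simp]: "mass {x} = 0"
  by (subst measure_nu) (auto simp: set_lebesgue_integral_def intro!: integral_eq_zero_AE AE_I'[of "{x}"] simp: indicator_eq_0_iff)

lemma nu_split:
  assumes "E \<in> sets borel" "G \<in> sets borel"
  shows "mass E = mass (E \<inter> G) + mass (E - G)"
  using nu.finite_measure_Union[of "E \<inter> G" "E - G"] assms
  by (metis Diff_Int_distrib2 Int_Diff_Un Int_Diff_disjoint sets_nu sets.Diff sets.Int)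

lemma nu_le: "A \<subseteq> B \<Longrightarrow> B \<in> sets borel \<Longrightarrow> mass A \<le> mass B"
  by (rule nu.finite_measure_mono) auto

lemma nu_Icc_add:
  assumes "a \<le> b" "b \<le> c"
  shows "mass {a..c} = mass {a..b} + mass {b..c}"
proof -
  have "mass {b..c} = mass ({b..c} \<inter> {b}) + mass ({b..c} - {b})"
    by (rule nu_split) auto
  moreover have "{b..c} \<inter> {b} = {b}" using assms by auto
  moreover have "{b..c} - {b} = {b<..c}" by auto
  moreover have "mass {a..c} = mass ({a..c} \<inter> {..b}) + mass ({a..c} - {..b})"
    by (rule nu_split) auto
  moreover have "{a..c} \<inter> {..b} = {a..b}" "{a..c} - {..b} = {b<..c}" using assms by auto
  ultimately show ?thesis by (simp del: Int_atLeastAtMost Int_atMost Int_atLeastAtMostL1 Int_atLeastAtMostL2)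
qed

lemma nu_Int_Icc_le:
  assumes "E \<in> sets borel"
  shows "mass (E \<inter> {a..c}) \<le> mass (E \<inter> {a..b}) + mass (E \<inter> {b..c})"
  by (rule order_trans[OF nu_le[of _ "(E \<inter> {a..b}) \<union> (E \<inter> {b..c})"] measure_Un_le])
     (use assms in auto)

lemma nu_le_const:
  assumes "E \<in> sets borel" "emeasure lborel E \<noteq> \<infinity>" "\<And>x. x \<in> E \<Longrightarrow> \<rho> x \<le> h"
  shows "mass E \<le> h * measure lborel E"
proof -
  have "(LINT x:E|lborel. \<rho> x) \<le> (LINT x:E|lborel. h)"
    using assms by (intro set_integral_mono set_integrable_rho) (auto simp: set_integrable_def less_top)
  then show ?thesis using assms by (simp add: measure_nu set_lebesgue_integral_def mult.commute)
qed

lemma nu_ge_const: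
  assumes "E \<in> sets borel" "emeasure lborel E \<noteq> \<infinity>" "\<And>x. x \<in> E \<Longrightarrow> h \<le> \<rho> x"
  shows "h * measure lborel E \<le> mass E"
proof -
  have "(LINT x:E|lborel. h) \<le> (LINT x:E|lborel. \<rho> x)"
    using assms by (intro set_integral_mono set_integrable_rho) (auto simp: set_integrable_def less_top)
  then show ?thesis using assms by (simp add: measure_nu set_lebesgue_integral_def mult.commute)
qed

text \<open>Exchanges the two sides of the mode, so that \<open>right_of_mode\<close> and
  \<open>central_gap_right\<close> follow from their left-hand counterparts.\<close>

lemma reflect: "unimodal_density (\<lambda>x. \<rho> (- x)) (- w)"
proof
  show "continuous_on UNIV (\<lambda>x. \<rho> (- x))"
    using cont by (intro continuous_on_compose2[OF cont]) (auto intro: continuous_intros)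
  show "integrable lborel (\<lambda>x. \<rho> (- x))"
    using lborel_integrable_real_affine[OF integ, of "-1" 0] by simp
qed (auto intro: nonneg incr decr)

lemma measure_nu_reflect:
  assumes "E \<in> sets borel"
  shows "measure (unimodal_density.nu (\<lambda>x. \<rho> (- x))) E = mass {x. - x \<in> E}"
proof -
  interpret R: unimodal_density "\<lambda>x. \<rho> (- x)" "- w" by (rule reflect)
  have "{x. - x \<in> E} = uminus -` E \<inter> space borel" by auto
  also have "\<dots> \<in> sets borel" by (rule measurable_sets[OF _ assms]) auto
  finally have "{x. - x \<in> E} \<in> sets borel" .
  then show ?thesis using assms
    by (subst R.measure_nu, simp, subst measure_nu, simp, subst set_integral_reflect) simp
qed

section \<open>Mass of F in the gaps of K\<close>

lemma nu_density_bound_left: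
  assumes ab: "a \<le> b" "b \<le> w" and F: "F \<in> sets borel"
    and dens: "\<And>q. a \<le> q \<Longrightarrow> q \<le> b \<Longrightarrow> measure lborel (F \<inter> {q..b}) \<le> \<theta> * (b - q)"
  shows "mass (F \<inter> {a..b}) \<le> \<theta> * mass {a..b}"
  using second_mean_value_set_bound[OF ab(1) F _ _ _ dens, of \<rho>] cont nonneg incr ab F
  by (simp add: measure_nu continuous_on_subset)

text \<open>Left of the mode the density grows towards the right end of each gap of K, and this end
  lies in K, so \<open>nu_density_bound_left\<close> applies gap by gap. K may have infinitely many
  gaps, but an interval of length d/2 after each point of K misses F, and skipping it makes the walk
  finite.\<close>

lemma nu_gaps_left_bound:
  fixes K F :: "real set"
  assumes K: "compact K" and F: "compact F" and disj: "K \<inter> F = {}"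
    and P: "\<And>x y. x \<in> K \<Longrightarrow> y \<le> x \<Longrightarrow> measure lborel (F \<inter> {y..x}) \<le> \<theta> * (x - y)"
    and x0: "x0 \<in> K" "x0 \<le> w" and "0 \<le> \<theta>" and "y \<le> x0"
  shows "mass (F \<inter> {y..x0}) \<le> \<theta> * mass ({y..x0} - K)"
proof -
  have Kb [measurable]: "K \<in> sets borel" and Fb [measurable]: "F \<in> sets borel"
    using K F by (auto intro: borel_closed compact_imp_closed)
  obtain d where d: "d > 0" "\<And>x y. x \<in> K \<Longrightarrow> y \<in> F \<Longrightarrow> d \<le> dist x y"
    using separate_compact_closed[OF K compact_imp_closed[OF F] disj] by blast
  have "y \<le> x0 \<Longrightarrow> x0 - y \<le> real n * (d/2) \<Longrightarrow>
      mass (F \<inter> {y..x0}) \<le> \<theta> * mass ({y..x0} - K)" for n y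
  proof (induction n arbitrary: y)
    case 0
    then have "y = x0" by simp
    moreover have "F \<inter> {x0..x0} = {}" using x0 disj by auto
    ultimately show ?case using \<open>0 \<le> \<theta>\<close> by simp
  next
    case (Suc n)
    \<comment> \<open>The first point of K from y on: K meets {y..y'} in y' only, a null
      set.\<close>
    define y' where "y' = Inf (K \<inter> {y..x0})"
    have ne: "K \<inter> {y..x0} \<noteq> {}" using x0 Suc.prems by auto
    have "compact (K \<inter> {y..x0})" using K by (intro compact_Int) auto
    then have y': "y' \<in> K" "y \<le> y'" "y' \<le> x0"
      unfolding y'_def using closed_contains_Inf[OF ne] by (auto simp: compact_imp_closed compact_imp_bounded bounded_imp_bdd_below)
    have less: "x \<notin> K" if "y \<le> x" "x < y'" for x
    proof
      assume "x \<in> K"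
      then have "y' \<le> x" unfolding y'_def using that y'
        by (intro cInf_lower) auto
      then show False using that by simp
    qed
    have 1: "mass (F \<inter> {y..y'}) \<le> \<theta> * mass {y..y'}"
      using y' x0 P by (intro nu_density_bound_left) auto
    have KI: "mass {y..y'} = mass ({y..y'} - K)"
    proof -
      have "{y..y'} \<inter> K \<subseteq> {y'}" using less by force
      then have "mass ({y..y'} \<inter> K) \<le> mass {y'}" by (intro nu_le) auto
      then show ?thesis using nu_split[of "{y..y'}" K] measure_nonneg[of nu "{y..y'} \<inter> K"] by simp
    qed
    \<comment> \<open>Half the distance between K and F is skipped, so one step of the induction
      covers at least d/2 unless x0 is reached.\<close>
    define y2 where "y2 = min (y' + d/2) x0"
    have y2: "y' \<le> y2" "y2 \<le> x0" using y' d by (auto simp: y2_def)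
    have "F \<inter> {y'..y2} = {}"
    proof (rule ccontr)
      assume "F \<inter> {y'..y2} \<noteq> {}"
      then obtain z where "z \<in> F" "y' \<le> z" "z \<le> y2" by auto
      then have "dist y' z \<le> d/2" by (auto simp: y2_def dist_real_def)
      with d(2)[OF y'(1) \<open>z \<in> F\<close>] d(1) show False by simp
    qed
    then have "mass (F \<inter> {y'..x0}) \<le> mass (F \<inter> {y2..x0})"
      using nu_Int_Icc_le[OF Fb, of y' x0 y2] by simp
    also have "\<dots> \<le> \<theta> * mass ({y2..x0} - K)"
    proof (cases "y2 = x0")
      case True
      moreover have "F \<inter> {x0..x0} = {}" using x0 disj by auto
      ultimately show ?thesis using \<open>0 \<le> \<theta>\<close> by simp
    next
      case False
      then have "y2 = y' + d/2" by (auto simp: y2_def)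
      then show ?thesis using y2 y' Suc.prems by (intro Suc.IH) (auto simp: algebra_simps)
    qed
    finally have 2: "mass (F \<inter> {y'..x0}) \<le> \<theta> * mass ({y2..x0} - K)" .
    have "mass ({y..y'} - K) + mass ({y2..x0} - K) \<le> mass ({y..x0} - K)"
    proof -
      have "mass ({y..x0} - K) = mass (({y..x0} - K) \<inter> {..y'}) + mass (({y..x0} - K) - {..y'})"
        by (rule nu_split) auto
      moreover have "({y..x0} - K) \<inter> {..y'} = {y..y'} - K" using y' by auto
      moreover have "mass ({y2..x0} - K) \<le> mass (({y..x0} - K) - {..y'})"
        using y' y2 by (intro nu_le) (auto, metis order_antisym order_trans)
      ultimately show ?thesis by simp
    qed
    then have "\<theta> * mass ({y..y'} - K) + \<theta> * mass ({y2..x0} - K) \<le> \<theta> * mass ({y..x0} - K)"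
      using \<open>0 \<le> \<theta>\<close> by (metis distrib_left mult_left_mono)
    then show ?case using nu_Int_Icc_le[OF Fb, of y x0 y'] 1 2 KI by simp
  qed
  moreover obtain n :: nat where "(x0 - y) / (d/2) \<le> real n" using real_arch_simple by blast
  then have "x0 - y \<le> real n * (d/2)" using d by (simp add: field_simps)
  ultimately show ?thesis using \<open>y \<le> x0\<close> by blast
qed

text \<open>The point \<open>e\<close> solves \<open>\<rho> (\<theta> xm + (1 - \<theta>) e) = \<rho> e\<close> (or is \<open>xp\<close>): the set \<open>F\<close> of largest mass is then
  the interval \<open>{\<theta> xm + (1 - \<theta>) e..e}\<close>, followed by a set of constant density \<open>\<theta>\<close>. The last bound is
  linear programming duality with the nonincreasing multiplier \<open>\<lambda>x. \<rho> (max x e)\<close>.\<close>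

lemma central_gap_left:
  assumes th: "0 < \<theta>" "\<theta> < 1" and m: "xm \<le> w" "w \<le> xp" and F: "F \<in> sets borel"
    and P: "\<And>y. xm \<le> y \<Longrightarrow> y \<le> xp \<Longrightarrow> measure lborel (F \<inter> {xm..y}) \<le> \<theta> * (y - xm)"
  obtains e where "w \<le> e" "e \<le> xp"
    "\<And>z. xm \<le> z \<Longrightarrow> z \<le> e \<Longrightarrow> mass (F \<inter> {xm..z}) \<le> mass {\<theta> * xm + (1 - \<theta>) * z..z}"
    "mass (F \<inter> {xm..xp}) \<le> mass {\<theta> * xm + (1 - \<theta>) * e..e} + \<theta> * mass {e..xp}"
proof -
  note [measurable] = F
  define c where "c = (\<lambda>z. \<theta> * xm + (1 - \<theta>) * z)"
  have cz: "xm \<le> c z \<and> c z \<le> z \<and> z - c z = \<theta> * (z - xm)" if "xm \<le> z" for z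
  proof -
    have "c z - xm = (1 - \<theta>) * (z - xm)" "z - c z = \<theta> * (z - xm)" by (auto simp: c_def algebra_simps)
    moreover have "0 \<le> (1 - \<theta>) * (z - xm)" "0 \<le> \<theta> * (z - xm)" using that th by auto
    ultimately show ?thesis by linarith
  qed
  have cmono: "c z \<le> c z'" if "z \<le> z'" for z z' using that th by (simp add: c_def mult_left_mono)
  have ccont: "continuous_on A (\<lambda>z. \<rho> (c z))" for A
    by (rule continuous_on_compose2[OF cont]) (auto simp: c_def intro!: continuous_intros)
  define zw where "zw = (w - \<theta> * xm) / (1 - \<theta>)"
  have czw: "c zw = w" using th by (simp add: c_def zw_def)
  have wzw: "w \<le> zw" using cz[of w] czw m th cmono[of zw w]
    by (cases "w \<le> zw") (auto simp: c_def zw_def field_simps)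
  \<comment> \<open>Intermediate value theorem for \<open>\<rho> z - \<rho> (c z)\<close>: it is
    nonnegative at w, since c w \<le> w, and nonpositive at zw, where c zw is the mode. If xp is at
    most zw and the difference is still nonnegative there, e = xp. Staying at or below zw keeps c e
    left of the mode.\<close>
  have key: "\<exists>e. w \<le> e \<and> e \<le> xp \<and> c e \<le> w \<and> \<rho> (c e) \<le> \<rho> e \<and> (e = xp \<or> \<rho> (c e) = \<rho> e)"
  proof (cases "xp \<le> zw \<and> \<rho> (c xp) \<le> \<rho> xp")
    case True
    then show ?thesis using m cmono[of xp zw] czw by (intro exI[of _ xp]) auto
  next
    case False
    define zm where "zm = min xp zw"
    have zm: "w \<le> zm" "zm \<le> xp" "zm \<le> zw" using m wzw by (auto simp: zm_def)
    have "\<rho> zm - \<rho> (c zm) \<le> 0"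
    proof (cases "xp \<le> zw")
      case True
      then show ?thesis using False by (auto simp: zm_def)
    next
      case False
      then have "zm = zw" by (auto simp: zm_def)
      then show ?thesis using czw decr[of w zw] wzw by simp
    qed
    moreover have "0 \<le> \<rho> w - \<rho> (c w)" using incr[of "c w" w] cz[of w] m by simp
    ultimately obtain e where e: "w \<le> e" "e \<le> zm" "\<rho> e - \<rho> (c e) = 0"
      using IVT2'[of "\<lambda>z. \<rho> z - \<rho> (c z)" zm 0 w] zm
      by (metis continuous_on_diff continuous_on_subset ccont cont subset_UNIV)
    moreover have "c e \<le> w" using cmono[of e zw] czw e zm by simp
    ultimately show ?thesis using zm by (intro exI[of _ e]) auto
  qed
  then obtain e where e: "w \<le> e" "e \<le> xp" "c e \<le> w" "\<rho> (c e) \<le> \<rho> e" "e = xp \<or> \<rho> (c e) = \<rho> e"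
    by blast
  have inside: "\<rho> (c z) \<le> \<rho> x" if "xm \<le> z" "z \<le> e" "c z \<le> x" "x \<le> z" for z x
  proof (cases "x \<le> w")
    case True
    then show ?thesis using that incr by auto
  next
    case False
    then have "\<rho> e \<le> \<rho> x" using that e decr[of x e] by auto
    moreover have "\<rho> (c z) \<le> \<rho> (c e)" using that e cmono[of z e] incr by auto
    ultimately show ?thesis using e by auto
  qed
  \<comment> \<open>Exchange argument: the part of F left of c z, where the density is at most
    \<rho> (c z), is compared with the part of {c z..z} that F leaves free, where it is at least
    \<rho> (c z). The free part is long enough because F has length at most \<theta> (z - xm) = z -
    c z.\<close>
  have good: "mass (F \<inter> {xm..z}) \<le> mass {c z..z}" if z: "xm \<le> z" "z \<le> e" for z
  proof -
    let ?A = "F \<inter> {xm..<c z}" and ?B = "F \<inter> {c z..z}" and ?C = "{c z..z} - F"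
    have fin: "emeasure lborel E \<noteq> \<infinity>" if "E \<subseteq> {xm..z}" for E
      using emeasure_bounded_finite[OF bounded_subset[OF bounded_closed_interval that]] by (simp add: less_top)
    have finA: "emeasure lborel ?A \<noteq> \<infinity>" "emeasure lborel ?B \<noteq> \<infinity>" "emeasure lborel ?C \<noteq> \<infinity>"
      using cz[OF z(1)] by (intro fin; fastforce)+
    have "measure lborel ?A + measure lborel ?B = measure lborel (?A \<union> ?B)"
      using finA by (intro measure_Union[symmetric]) auto
    also have "?A \<union> ?B = F \<inter> {xm..z}" using cz[OF z(1)] by auto
    also have "measure lborel (F \<inter> {xm..z}) \<le> z - c z" using P[of z] z e cz by auto
    finally have 1: "measure lborel ?A + measure lborel ?B \<le> z - c z" .
    have "measure lborel ?C + measure lborel ?B = measure lborel (?C \<union> ?B)"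
      using finA by (intro measure_Union[symmetric]) auto
    also have "?C \<union> ?B = {c z..z}" by auto
    also have "measure lborel {c z..z} = z - c z" using cz[OF z(1)] by simp
    finally have AC: "measure lborel ?A \<le> measure lborel ?C" using 1 by simp
    have "mass ?A \<le> \<rho> (c z) * measure lborel ?A"
      by (rule nu_le_const) (use finA incr cmono[of z e] z e in auto)
    also have "\<dots> \<le> \<rho> (c z) * measure lborel ?C"
      using AC nonneg by (intro mult_left_mono) auto
    also have "\<dots> \<le> mass ?C"
      by (rule nu_ge_const) (use finA inside z in auto)
    finally have "mass ?A \<le> mass ?C" .
    moreover have "mass {c z..z} = mass ({c z..z} \<inter> F) + mass ?C"
      by (rule nu_split) auto
    moreover have "mass (F \<inter> {xm..z}) = mass ((F \<inter> {xm..z}) \<inter> {c z..}) + mass (F \<inter> {xm..z} - {c z..})"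
      by (rule nu_split) auto
    moreover have "(F \<inter> {xm..z}) \<inter> {c z..} = ?B" "{c z..z} \<inter> F = ?B" "F \<inter> {xm..z} - {c z..} = ?A"
      using cz[OF z(1)] by auto
    ultimately show ?thesis by simp
  qed
  have "mass (F \<inter> {xm..xp}) \<le> mass {c e..e} + \<theta> * mass {e..xp}"
  proof (cases "e = xp")
    case True
    then show ?thesis using good[of e] m e by simp
  next
    case False
    define h where "h = \<rho> e"
    have h: "\<rho> (c e) = h" "h \<ge> 0" using False e nonneg by (auto simp: h_def)
    define D where "D = (\<lambda>x. \<rho> (max x e))"
    have Dc: "continuous_on A D" for A unfolding D_def
      by (rule continuous_on_compose2[OF cont]) (auto intro!: continuous_intros)
    let ?F0 = "F \<inter> {xm..xp}"
    have Di: "set_integrable lborel E D" if "E \<in> sets borel" "E \<subseteq> {xm..xp}" for E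
      by (rule set_integrable_subset[OF borel_integrable_atLeastAtMost'[OF Dc]]) (use that in auto)
    have ri: "set_integrable lborel E (\<lambda>x. \<rho> x - h)" if "E \<in> sets borel" "E \<subseteq> {xm..xp}" for E
      by (rule set_integrable_subset[OF borel_integrable_atLeastAtMost'[of xm xp]])
         (use that in \<open>auto intro!: continuous_intros continuous_on_subset[OF cont]\<close>)
    have ce: "xm \<le> c e" "c e \<le> e" "e - c e = \<theta> * (e - xm)" using cz[of e] m e by auto
    have "mass ?F0 = (LINT x:?F0|lborel. \<rho> x)" by (rule measure_nu) auto
    also have "\<dots> = (LINT x|lborel. indicator ?F0 x *\<^sub>R \<rho> x)" by (simp add: set_lebesgue_integral_def)
    \<comment> \<open>Between c e and e the multiplier D equals h \<le> \<rho>; elsewhere it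
      dominates \<rho>. The second summand therefore covers the excess of \<rho> over D, whether x
      is in F or not. In the end h (e - c e) = \<theta> h (e - xm) cancels the contribution of D
      left of e.\<close>
    also have "\<dots> \<le> (LINT x|lborel. indicator ?F0 x *\<^sub>R D x + indicator {c e..e} x *\<^sub>R (\<rho> x - h))"
    proof (rule integral_mono)
      show "integrable lborel (\<lambda>x. indicat_real ?F0 x *\<^sub>R \<rho> x)"
        using set_integrable_rho[of ?F0] by (simp add: set_integrable_def)
      show "integrable lborel (\<lambda>x. indicat_real ?F0 x *\<^sub>R D x + indicat_real {c e..e} x *\<^sub>R (\<rho> x - h))"
        using Di[of ?F0] ri[of "{c e..e}"] ce e by (simp add: set_integrable_def)
      fix x
      have "\<rho> x \<le> D x" if "x < c e" using that e incr[of x "c e"] h ce by (simp add: D_def max_def h_def)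
      moreover have "\<rho> x \<le> D x" if "e \<le> x" using that by (simp add: D_def max_def)
      moreover have "h \<le> \<rho> x" "D x = h" if "c e \<le> x" "x \<le> e"
        using that inside[of e x] e m h by (auto simp: D_def h_def max_def)
      moreover have "0 \<le> D x" using nonneg by (simp add: D_def)
      ultimately show "indicat_real ?F0 x *\<^sub>R \<rho> x \<le> indicat_real ?F0 x *\<^sub>R D x + indicat_real {c e..e} x *\<^sub>R (\<rho> x - h)"
        by (cases "x < c e"; cases "x \<le> e") (auto simp: indicator_def)
    qed
    also have "\<dots> = (LINT x:?F0|lborel. D x) + (LINT x:{c e..e}|lborel. \<rho> x - h)"
      using Di[of ?F0] ri[of "{c e..e}"] ce e unfolding set_lebesgue_integral_def set_integrable_def
      by (intro Bochner_Integration.integral_add) auto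
    also have "(LINT x:{c e..e}|lborel. \<rho> x - h) = mass {c e..e} - h * (e - c e)"
    proof -
      have "(LINT x:{c e..e}|lborel. \<rho> x - h) = (LINT x:{c e..e}|lborel. \<rho> x) - (LINT x:{c e..e}|lborel. h)"
        by (intro set_integral_diff set_integrable_rho borel_integrable_atLeastAtMost' continuous_on_const) auto
      then show ?thesis using ce by (simp add: measure_nu set_lebesgue_integral_def mult.commute)
    qed
    also have "(LINT x:?F0|lborel. D x) \<le> \<theta> * (LINT x:{xm..xp}|lborel. D x)"
      by (rule second_mean_value_set_bound_decr)
         (use m P Dc e(1) in \<open>auto simp: D_def nonneg max_def intro!: decr\<close>)
    also have "(LINT x:{xm..xp}|lborel. D x) = (LINT x:{xm..<e} \<union> {e..xp}|lborel. D x)"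
      using ce e by (intro arg_cong2[where f="\<lambda>A f. set_lebesgue_integral lborel A f"]) auto
    also have "\<dots> = (LINT x:{xm..<e}|lborel. D x) + (LINT x:{e..xp}|lborel. D x)"
      using ce e by (intro set_integral_Un Di) auto
    also have "(LINT x:{xm..<e}|lborel. D x) = (LINT x:{xm..<e}|lborel. h)"
      by (rule set_lebesgue_integral_cong) (auto simp: D_def h_def max_def)
    also have "\<dots> = h * (e - xm)" using ce by (simp add: set_lebesgue_integral_def mult.commute)
    also have "(LINT x:{e..xp}|lborel. D x) = (LINT x:{e..xp}|lborel. \<rho> x)"
      by (rule set_lebesgue_integral_cong) (auto simp: D_def max_def)
    also have "\<dots> = mass {e..xp}" by (simp add: measure_nu)
    finally show ?thesis using ce by (simp add: algebra_simps)
  qed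
  then show ?thesis using that[of e] good e by (auto simp: c_def)
qed

end

section \<open>The dilation inequality for a unimodal density\<close>

context unimodal_density begin

sublocale nu: finite_borel_measure nu
  by standard simp

lemma continuous_nu_atMost: "continuous_on A (\<lambda>x. mass {..x})"
  using nu.isCont_cdf by (intro continuous_at_imp_continuous_on) (simp add: cdf_def)

lemma nu_Icc_eq:
  assumes "a \<le> b"
  shows "mass {a..b} = mass {..b} - mass {..a}"
proof -
  have "mass {..b} = mass ({..b} \<inter> {..<a}) + mass ({..b} - {..<a})"
    by (rule nu_split) auto
  moreover have "mass {..a} = mass ({..a} \<inter> {a}) + mass ({..a} - {a})"
    by (rule nu_split) auto
  moreover have "{..b} \<inter> {..<a} = {..<a}" "{..b} - {..<a} = {a..b}" "{..a} \<inter> {a} = {a}" "{..a} - {a} = {..<a}"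
    using assms by auto
  ultimately show ?thesis by simp
qed

lemma nu_total:
  assumes "a \<le> b"
  shows "mass UNIV = mass {..a} + mass {a..b} + mass {b..}"
proof -
  have "mass UNIV = mass (UNIV \<inter> {..b}) + mass (UNIV - {..b})"
    by (rule nu_split) auto
  moreover have "mass {b..} = mass ({b..} \<inter> {b}) + mass ({b..} - {b})"
    by (rule nu_split) auto
  moreover have "{b..} \<inter> {b} = {b}" "{b..} - {b} = UNIV - {..b}" by auto
  ultimately show ?thesis using nu_Icc_eq[OF assms] by simp
qed

text \<open>The witness is the last point of K before the mode, so all gaps to its left are of the
  kind treated by \<open>nu_gaps_left_bound\<close>. The last conclusion trades
  \<open>K \<inter> {..w}\<close> for an interval of equal mass ending at xm, because concavity will
  be used for intervals only.\<close>

lemma left_of_mode: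
  fixes K F :: "real set"
  assumes K: "compact K" and F: "compact F" and disj: "K \<inter> F = {}"
    and P: "\<And>x y. x \<in> K \<Longrightarrow> y \<le> x \<Longrightarrow> measure lborel (F \<inter> {y..x}) \<le> \<theta> * (x - y)"
    and th: "0 \<le> \<theta>"
  obtains xm where "xm \<le> w" "K \<inter> {..w} \<noteq> {} \<Longrightarrow> xm \<in> K"
    "mass (F \<inter> {..xm}) \<le> \<theta> * (mass {..xm} - mass (K \<inter> {..w}))"
    "\<exists>y\<le>xm. mass {y..xm} = mass (K \<inter> {..w})"
proof -
  have [measurable]: "K \<in> sets borel" "F \<in> sets borel"
    using K F by (auto intro: borel_closed compact_imp_closed)
  have "bounded (K \<union> F)" using K F by (simp add: compact_imp_bounded)
  then obtain B where B: "\<And>x. x \<in> K \<union> F \<Longrightarrow> \<bar>x\<bar> \<le> B" by (auto simp: bounded_real)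
  show ?thesis
  proof (cases "K \<inter> {..w} = {}")
    case True
    \<comment> \<open>Without K on this side, any point to the left of the whole of F
      serves.\<close>
    define xm where "xm = min w (- B - 1)"
    have "F \<inter> {..xm} = {}" using B unfolding xm_def by force
    moreover have "\<exists>y\<le>xm. mass {y..xm} = mass (K \<inter> {..w})"
      using True by (intro exI[of _ xm]) simp
    ultimately show ?thesis using True th by (intro that[of xm]) (auto simp: xm_def)
  next
    case False
    define xm where "xm = Sup (K \<inter> {..w})"
    have cK: "compact (K \<inter> {..w})" using K by (intro compact_Int_closed) auto
    have xm: "xm \<in> K" "xm \<le> w"
      using closed_contains_Sup[OF False] cK
      unfolding xm_def by (auto simp: compact_imp_closed compact_imp_bounded bounded_imp_bdd_above)
    have ub: "x \<le> xm" if "x \<in> K" "x \<le> w" for x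
      unfolding xm_def using that cK
      by (intro cSup_upper) (auto simp: compact_imp_bounded bounded_imp_bdd_above)
    define y where "y = min xm (- B)"
    have y: "y \<le> xm" by (simp add: y_def)
    have yB: "y \<le> x" if "x \<in> K \<union> F" for x using B[OF that] by (auto simp: y_def)
    have KI: "K \<inter> {..w} \<subseteq> {y..xm}" using ub yB by auto
    have FI: "F \<inter> {..xm} = F \<inter> {y..xm}" using yB by auto
    have "mass (F \<inter> {..xm}) \<le> \<theta> * mass ({y..xm} - K)"
      unfolding FI using assms xm y by (intro nu_gaps_left_bound) auto
    also have "\<dots> \<le> \<theta> * (mass {..xm} - mass (K \<inter> {..w}))"
    proof -
      have "mass {y..xm} = mass ({y..xm} \<inter> K) + mass ({y..xm} - K)"
        by (rule nu_split) auto
      moreover have "{y..xm} \<inter> K = K \<inter> {..w}" using KI xm by auto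
      moreover have "mass {y..xm} \<le> mass {..xm}" by (rule nu_le) auto
      ultimately show ?thesis using th by (intro mult_left_mono) auto
    qed
    finally have 1: "mass (F \<inter> {..xm}) \<le> \<theta> * (mass {..xm} - mass (K \<inter> {..w}))" .
    \<comment> \<open>The interval {y..xm} contains \<open>K \<inter> {..w}\<close> and is heavy
      enough; by continuity of the distribution function it can be shortened to the exact
      mass.\<close>
    have "\<exists>z\<ge>y. z \<le> xm \<and> mass {..z} = mass {..xm} - mass (K \<inter> {..w})"
    proof (rule IVT')
      have "mass (K \<inter> {..w}) \<le> mass {y..xm}" by (rule nu_le) (use KI in auto)
      then show "mass {..y} \<le> mass {..xm} - mass (K \<inter> {..w})"
        using nu_Icc_eq[OF y] by simp
    qed (auto intro: y continuous_nu_atMost)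
    then obtain z where "z \<le> xm" "mass {z..xm} = mass (K \<inter> {..w})"
      using nu_Icc_eq by force
    then show ?thesis using xm 1 by (intro that[of xm]) auto
  qed
qed

lemma right_of_mode:
  fixes K F :: "real set"
  assumes K: "compact K" and F: "compact F" and disj: "K \<inter> F = {}"
    and P: "\<And>x y. x \<in> K \<Longrightarrow> x \<le> y \<Longrightarrow> measure lborel (F \<inter> {x..y}) \<le> \<theta> * (y - x)"
    and th: "0 \<le> \<theta>"
  obtains xp where "w \<le> xp" "K \<inter> {w..} \<noteq> {} \<Longrightarrow> xp \<in> K"
    "mass (F \<inter> {xp..}) \<le> \<theta> * (mass {xp..} - mass (K \<inter> {w..}))"
    "\<exists>y\<ge>xp. mass {xp..y} = mass (K \<inter> {w..})"
proof -
  interpret R: unimodal_density "\<lambda>x. \<rho> (- x)" "- w" by (rule reflect)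
  have Kb: "K \<in> sets borel" and Fb: "F \<in> sets borel"
    using K F by (auto intro: borel_closed compact_imp_closed)
  define K' where "K' = {x. - x \<in> K}"
  define F' where "F' = {x. - x \<in> F}"
  have cK: "compact K'" and cF: "compact F'"
    unfolding K'_def F'_def Collect_uminus_eq_image using compact_negations[OF K] compact_negations[OF F] by auto
  have Kb': "K' \<in> sets borel" and Fb': "F' \<in> sets borel"
    using cK cF by (auto intro: borel_closed compact_imp_closed)
  have "K' \<inter> F' = {}" using disj by (auto simp: K'_def F'_def)
  moreover have "measure lborel (F' \<inter> {y..x}) \<le> \<theta> * (x - y)" if "x \<in> K'" "y \<le> x" for x y
  proof -
    have "F' \<inter> {y..x} = {z. - z \<in> F \<inter> {-x..-y}}" by (auto simp: F'_def)
    then have "measure lborel (F' \<inter> {y..x}) = measure lborel (F \<inter> {-x..-y})"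
      using measure_lborel_reflect[of "F \<inter> {-x..-y}"] Fb by (metis sets.Int borel_closed closed_atLeastAtMost)
    then show ?thesis using P[of "-x" "-y"] that by (simp add: K'_def)
  qed
  ultimately obtain xm where xm: "xm \<le> - w" "K' \<inter> {..-w} \<noteq> {} \<Longrightarrow> xm \<in> K'"
    "measure R.nu (F' \<inter> {..xm}) \<le> \<theta> * (measure R.nu {..xm} - measure R.nu (K' \<inter> {..-w}))"
    "\<exists>y\<le>xm. measure R.nu {y..xm} = measure R.nu (K' \<inter> {..-w})"
    using R.left_of_mode[OF cK cF _ _ th] by metis
  have "measure R.nu (F' \<inter> {..xm}) = mass (F \<inter> {-xm..})"
    by (subst measure_nu_reflect) (use Fb' in \<open>auto simp: F'_def intro!: arg_cong[of _ _ "mass"]\<close>)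
  moreover have "measure R.nu {..xm} = mass {-xm..}"
    by (subst measure_nu_reflect) (auto intro!: arg_cong[of _ _ "mass"])
  moreover have KK: "measure R.nu (K' \<inter> {..-w}) = mass (K \<inter> {w..})"
    by (subst measure_nu_reflect) (use Kb' in \<open>auto simp: K'_def intro!: arg_cong[of _ _ "mass"]\<close>)
  moreover have "\<exists>y\<ge>-xm. mass {-xm..y} = mass (K \<inter> {w..})"
  proof -
    obtain y where y: "y \<le> xm" "measure R.nu {y..xm} = measure R.nu (K' \<inter> {..-w})" using xm(4) by auto
    have "measure R.nu {y..xm} = mass {-xm..-y}"
      by (subst measure_nu_reflect) (auto intro!: arg_cong[of _ _ "mass"])
    then show ?thesis using y KK by (intro exI[of _ "-y"]) auto
  qed
  moreover have "- xm \<in> K" if ne: "K \<inter> {w..} \<noteq> {}"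
  proof -
    obtain k where "k \<in> K" "w \<le> k" using ne by blast
    then have "- k \<in> K' \<inter> {..-w}" by (auto simp: K'_def)
    then have "K' \<inter> {..-w} \<noteq> {}" by blast
    then show ?thesis using xm(2) by (simp add: K'_def)
  qed
  ultimately show ?thesis using xm by (intro that[of "-xm"]) auto
qed

lemma central_gap_right:
  assumes th: "0 < \<theta>" "\<theta> < 1" and m: "xm \<le> w" "w \<le> xp" and F: "F \<in> sets borel"
    and P: "\<And>y. xm \<le> y \<Longrightarrow> y \<le> xp \<Longrightarrow> measure lborel (F \<inter> {y..xp}) \<le> \<theta> * (xp - y)"
  obtains e where "xm \<le> e" "e \<le> w"
    "\<And>z. e \<le> z \<Longrightarrow> z \<le> xp \<Longrightarrow> mass (F \<inter> {z..xp}) \<le> mass {z..\<theta> * xp + (1 - \<theta>) * z}"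
    "mass (F \<inter> {xm..xp}) \<le> mass {e..\<theta> * xp + (1 - \<theta>) * e} + \<theta> * mass {xm..e}"
proof -
  interpret R: unimodal_density "\<lambda>x. \<rho> (- x)" "- w" by (rule reflect)
  define F' where "F' = {x. - x \<in> F}"
  have Fb': "F' \<in> sets borel"
  proof -
    have "F' = uminus -` F \<inter> space borel" by (auto simp: F'_def)
    also have "\<dots> \<in> sets borel" by (rule measurable_sets[OF _ F]) auto
    finally show ?thesis .
  qed
  have "measure lborel (F' \<inter> {-xp..y}) \<le> \<theta> * (y - (-xp))" if "- xp \<le> y" "y \<le> - xm" for y
  proof -
    have "F' \<inter> {-xp..y} = {z. - z \<in> F \<inter> {-y..xp}}" by (auto simp: F'_def)
    then have "measure lborel (F' \<inter> {-xp..y}) = measure lborel (F \<inter> {-y..xp})"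
      using measure_lborel_reflect[of "F \<inter> {-y..xp}"] F by (metis sets.Int borel_closed closed_atLeastAtMost)
    then show ?thesis using P[of "-y"] that by (simp add: algebra_simps)
  qed
  then obtain e where e: "- w \<le> e" "e \<le> - xm"
    and g: "\<And>z. - xp \<le> z \<Longrightarrow> z \<le> e \<Longrightarrow> measure R.nu (F' \<inter> {-xp..z}) \<le> measure R.nu {\<theta> * (-xp) + (1 - \<theta>) * z..z}"
    and t: "measure R.nu (F' \<inter> {-xp..-xm}) \<le> measure R.nu {\<theta> * (-xp) + (1 - \<theta>) * e..e} + \<theta> * measure R.nu {e..-xm}"
    using R.central_gap_left[OF th _ _ Fb', of "-xp" "-xm"] m by (metis neg_le_iff_le)
  have FF: "measure R.nu (F' \<inter> {a..b}) = mass (F \<inter> {-b..-a})" for a b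
    by (subst measure_nu_reflect) (use Fb' in \<open>auto simp: F'_def intro!: arg_cong[of _ _ "mass"]\<close>)
  have II: "measure R.nu {a..b} = mass {-b..-a}" for a b
    by (subst measure_nu_reflect) (auto intro!: arg_cong[of _ _ "mass"])
  show ?thesis
  proof (rule that[of "-e"])
    show "mass (F \<inter> {z..xp}) \<le> mass {z..\<theta> * xp + (1 - \<theta>) * z}" if "- e \<le> z" "z \<le> xp" for z
      using g[of "-z"] that by (simp add: FF II algebra_simps)
    show "mass (F \<inter> {xm..xp}) \<le> mass {-e..\<theta> * xp + (1 - \<theta>) * -e} + \<theta> * mass {xm..-e}"
      using t by (simp add: FF II algebra_simps)
  qed (use e in auto)
qed

text \<open>\<open>\<eta>\<close> is the error of smoothing an \<open>s\<close>-concave measure. The proof cuts the central component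
  of \<open>- K\<close> at a point where both parts are equally rich in \<open>K\<close>, if there is one between the two
  optimal points of \<open>central_gap_left\<close> and \<open>central_gap_right\<close>; otherwise it cuts at one of
  these two, and the part on the other side is poorer in \<open>K\<close> and can be split off.\<close>

lemma unimodal_dilation:
  fixes K F :: "real set"
  assumes s: "0 \<le> s" "s \<le> 1" and th: "0 < \<theta>" "\<theta> < 1"
    and K: "compact K" and F: "compact F" and disj: "K \<inter> F = {}"
    and P: "\<And>x y. x \<in> K \<Longrightarrow> measure lborel (F \<inter> closed_segment x y) \<le> \<theta> * \<bar>x - y\<bar>"
    and BL: "\<And>a b z. a \<le> b \<Longrightarrow> b \<le> z \<Longrightarrow> 0 < mass {a..b} \<Longrightarrow>
       pmean s \<theta> (mass {a..b}) (mass {a..z}) - \<eta> \<le> mass {a..\<theta> * b + (1 - \<theta>) * z}"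
    and BR: "\<And>a b z. a \<le> b \<Longrightarrow> z \<le> a \<Longrightarrow> 0 < mass {a..b} \<Longrightarrow>
       pmean s \<theta> (mass {a..b}) (mass {z..b}) - \<eta> \<le> mass {\<theta> * a + (1 - \<theta>) * z..b}"
    and eta: "0 \<le> \<eta>" and pos: "0 < mass K"
  shows "pmean s \<theta> (mass K) (mass UNIV) - 2 * \<eta> \<le> mass (- F)"
proof -
  have [measurable]: "K \<in> sets borel" "F \<in> sets borel"
    using K F by (auto intro: borel_closed compact_imp_closed)
  have th': "0 \<le> \<theta>" "\<theta> \<le> 1" using th by auto
  have PL: "measure lborel (F \<inter> {y..x}) \<le> \<theta> * (x - y)" if "x \<in> K" "y \<le> x" for x y
    using P[of x y] that by (simp add: closed_segment_eq_real_ivl split: if_splits)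
  have PR: "measure lborel (F \<inter> {x..y}) \<le> \<theta> * (y - x)" if "x \<in> K" "x \<le> y" for x y
    using P[of x y] that by (simp add: closed_segment_eq_real_ivl)
  define uL where "uL = mass (K \<inter> {..w})"
  define uR where "uR = mass (K \<inter> {w..})"
  obtain xm where xm: "xm \<le> w" "K \<inter> {..w} \<noteq> {} \<Longrightarrow> xm \<in> K"
    "mass (F \<inter> {..xm}) \<le> \<theta> * (mass {..xm} - uL)"
    and xmy: "\<exists>y\<le>xm. mass {y..xm} = uL"
    using left_of_mode[OF K F disj PL th'(1)] unfolding uL_def by metis
  obtain xp where xp: "w \<le> xp" "K \<inter> {w..} \<noteq> {} \<Longrightarrow> xp \<in> K"
    "mass (F \<inter> {xp..}) \<le> \<theta> * (mass {xp..} - uR)"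
    and xpy: "\<exists>y\<ge>xp. mass {xp..y} = uR"
    using right_of_mode[OF K F disj PR th'(1)] unfolding uR_def by metis
  have u0: "0 \<le> uL" "0 \<le> uR" by (auto simp: uL_def uR_def)
  have uK: "mass K = uL + uR"
  proof -
    have "mass K = mass (K \<inter> {..w}) + mass (K - {..w})" by (rule nu_split) auto
    moreover have "mass (K \<inter> {w..}) = mass (K \<inter> {w..} \<inter> {w}) + mass (K \<inter> {w..} - {w})"
      by (rule nu_split) auto
    moreover have "mass (K \<inter> {w..} \<inter> {w}) \<le> mass {w}" by (rule nu_le) auto
    moreover have "K \<inter> {w..} - {w} = K - {..w}" by auto
    ultimately show ?thesis unfolding uL_def uR_def
      using measure_nonneg[of nu "K \<inter> {w..} \<inter> {w}"] by simp
  qed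
  define gL where "gL = mass {..xm} - uL"
  define gR where "gR = mass {xp..} - uR"
  define p where "p = (\<lambda>z. mass {xm..z})"
  define q where "q = (\<lambda>z. mass {z..xp})"
  have pq: "mass {xm..xp} = p z + q z" if "xm \<le> z" "z \<le> xp" for z
    using nu_Icc_add[OF that] by (simp add: p_def q_def)
  have pq0: "0 \<le> p z" "0 \<le> q z" for z by (auto simp: p_def q_def)
  have g0: "0 \<le> gL" "0 \<le> gR"
  proof -
    obtain y where "y \<le> xm" "mass {y..xm} = uL" using xmy by auto
    then have "uL \<le> mass {..xm}" using nu_le[of "{y..xm}" "{..xm}"] by auto
    then show "0 \<le> gL" by (simp add: gL_def)
    obtain y where "xp \<le> y" "mass {xp..y} = uR" using xpy by auto
    then have "uR \<le> mass {xp..}" using nu_le[of "{xp..y}" "{xp..}"] by auto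
    then show "0 \<le> gR" by (simp add: gR_def)
  qed
  have mtot: "mass UNIV = uL + gL + p z + q z + uR + gR" if "xm \<le> z" "z \<le> xp" for z
    using nu_total[of xm xp] pq[OF that] that by (simp add: gL_def gR_def)
  have vF: "mass (- F) \<ge> mass UNIV - \<theta> * gL - \<theta> * gR - mass (F \<inter> {xm..xp})"
  proof -
    have "F = (F \<inter> {..xm} \<union> F \<inter> {xm..xp}) \<union> F \<inter> {xp..}" by auto
    then have "mass F \<le> mass (F \<inter> {..xm}) + mass (F \<inter> {xm..xp}) + mass (F \<inter> {xp..})"
      using measure_Un_le[of "F \<inter> {..xm} \<union> F \<inter> {xm..xp}" nu "F \<inter> {xp..}"]
        measure_Un_le[of "F \<inter> {..xm}" nu "F \<inter> {xm..xp}"] by simp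
    moreover have "mass (- F) = mass UNIV - mass F"
      using nu.finite_measure_compl[of F] by (simp add: Compl_eq_Diff_UNIV)
    ultimately show ?thesis using xm(3) xp(3) by (simp add: gL_def gR_def)
  qed
  \<comment> \<open>Concavity for {y..xm}, the interval of mass uL that stands for K left of the
    mode, against {y..z}. The resulting interval {y..c} ends exactly where {c..z}, the extremal
    position of F, begins.\<close>
  have BMl: "pmean s \<theta> uL (uL + p z) - \<eta> \<le> uL + p z - mass {\<theta> * xm + (1 - \<theta>) * z..z}"
    if z: "xm \<le> z" and u: "0 < uL" for z
  proof -
    obtain y where y: "y \<le> xm" "mass {y..xm} = uL" using xmy by auto
    define c where "c = \<theta> * xm + (1 - \<theta>) * z"
    have "(1 - \<theta>) * (z - xm) \<ge> 0" "\<theta> * (z - xm) \<ge> 0" using z th by auto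
    then have c: "xm \<le> c" "c \<le> z" by (simp_all add: c_def algebra_simps)
    have "pmean s \<theta> uL (uL + p z) - \<eta> \<le> mass {y..c}"
      using BL[OF y(1) z] u y nu_Icc_add[OF y(1) z] by (simp add: c_def p_def)
    also have "\<dots> = uL + p z - mass {c..z}"
      using nu_Icc_add[of y c z] nu_Icc_add[OF y(1) z] y c by (simp add: p_def)
    finally show ?thesis by (simp add: c_def)
  qed
  have BMr: "pmean s \<theta> uR (uR + q z) - \<eta> \<le> uR + q z - mass {z..\<theta> * xp + (1 - \<theta>) * z}"
    if z: "z \<le> xp" and u: "0 < uR" for z
  proof -
    obtain y where y: "xp \<le> y" "mass {xp..y} = uR" using xpy by auto
    define c where "c = \<theta> * xp + (1 - \<theta>) * z"
    have "(1 - \<theta>) * (xp - z) \<ge> 0" "\<theta> * (xp - z) \<ge> 0" using z th by auto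
    then have c: "c \<le> xp" "z \<le> c" by (simp_all add: c_def algebra_simps)
    have "pmean s \<theta> uR (uR + q z) - \<eta> \<le> mass {c..y}"
      using BR[OF y(1) z] u y nu_Icc_add[OF z y(1)] by (simp add: c_def q_def add.commute)
    also have "\<dots> = uR + q z - mass {z..c}"
      using nu_Icc_add[of z c y] nu_Icc_add[OF z y(1)] y c by (simp add: q_def)
    finally show ?thesis by (simp add: c_def)
  qed
  \<comment> \<open>All but the left part (uL, uL + p e) is peeled off: K on the right, the outer
    gaps and the gap beyond e, where F takes at most the fraction \<theta>. The hypothesis
    \<open>rich\<close> says that the peeled piece is the poorer one.\<close>
  have left: ?thesis if u: "0 < uL" and e: "xm \<le> e" "e \<le> xp" and rich: "uR * p e \<le> uL * q e"
    and t: "mass (F \<inter> {xm..xp}) \<le> mass {\<theta> * xm + (1 - \<theta>) * e..e} + \<theta> * q e" for e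
  proof -
    have "uR * (uL + p e) \<le> uL * (uR + (gL + gR + q e))"
      using rich mult_nonneg_nonneg[OF u0(1) add_nonneg_nonneg[OF g0]] by (simp add: algebra_simps)
    then have "pmean s \<theta> (uL + uR) ((uL + p e) + (uR + (gL + gR + q e)))
        \<le> pmean s \<theta> uL (uL + p e) + \<theta> * uR + (1 - \<theta>) * (uR + (gL + gR + q e))"
      by (intro pmean_peel s th') (use u u0 pq0 g0 in auto)
    then show ?thesis using BMl[OF e(1) u] t vF mtot[OF e] eta uK by (simp add: algebra_simps)
  qed
  have right: ?thesis if u: "0 < uR" and e: "xm \<le> e" "e \<le> xp" and rich: "uL * q e \<le> uR * p e"
    and t: "mass (F \<inter> {xm..xp}) \<le> mass {e..\<theta> * xp + (1 - \<theta>) * e} + \<theta> * p e" for e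
  proof -
    have "uL * (uR + q e) \<le> uR * (uL + (gL + gR + p e))"
      using rich mult_nonneg_nonneg[OF u0(2) add_nonneg_nonneg[OF g0]] by (simp add: algebra_simps)
    then have "pmean s \<theta> (uR + uL) ((uR + q e) + (uL + (gL + gR + p e)))
        \<le> pmean s \<theta> uR (uR + q e) + \<theta> * uL + (1 - \<theta>) * (uL + (gL + gR + p e))"
      by (intro pmean_peel s th') (use u u0 pq0 g0 in auto)
    then show ?thesis using BMr[OF e(2) u] t vF mtot[OF e] eta uK by (simp add: algebra_simps)
  qed
  have gl: "\<exists>e. w \<le> e \<and> e \<le> xp \<and>
    (\<forall>z. xm \<le> z \<longrightarrow> z \<le> e \<longrightarrow> mass (F \<inter> {xm..z}) \<le> mass {\<theta> * xm + (1 - \<theta>) * z..z}) \<and>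
    mass (F \<inter> {xm..xp}) \<le> mass {\<theta> * xm + (1 - \<theta>) * e..e} + \<theta> * q e" if u: "0 < uL"
  proof -
    have "K \<inter> {..w} \<noteq> {}" using u by (auto simp: uL_def)
    then have "xm \<in> K" using xm by simp
    then show ?thesis using central_gap_left[OF th xm(1) xp(1), of F] PR unfolding q_def
      by (metis \<open>F \<in> sets borel\<close>)
  qed
  have gr: "\<exists>e. xm \<le> e \<and> e \<le> w \<and>
    (\<forall>z. e \<le> z \<longrightarrow> z \<le> xp \<longrightarrow> mass (F \<inter> {z..xp}) \<le> mass {z..\<theta> * xp + (1 - \<theta>) * z}) \<and>
    mass (F \<inter> {xm..xp}) \<le> mass {e..\<theta> * xp + (1 - \<theta>) * e} + \<theta> * p e" if u: "0 < uR"
  proof -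
    have "K \<inter> {w..} \<noteq> {}" using u by (auto simp: uR_def)
    then have "xp \<in> K" using xp by simp
    then show ?thesis using central_gap_right[OF th xm(1) xp(1), of F] PL unfolding p_def
      by (metis \<open>F \<in> sets borel\<close>)
  qed
  show ?thesis
  proof (cases "0 < uL \<and> 0 < uR")
    case False
    \<comment> \<open>With K on one side only, the piece on the other side contains none of it and
      is trivially the poorer.\<close>
    then show ?thesis
    proof (cases "0 < uL")
      case True
      with gl obtain e where "w \<le> e" "e \<le> xp"
        "mass (F \<inter> {xm..xp}) \<le> mass {\<theta> * xm + (1 - \<theta>) * e..e} + \<theta> * q e" by blast
      then show ?thesis using True False u0 xm pq0 by (intro left[of e]) auto
    next
      case False
      then have "0 < uR" "uL = 0" using pos uK u0 by auto
      with gr obtain e where "xm \<le> e" "e \<le> w"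
        "mass (F \<inter> {xm..xp}) \<le> mass {e..\<theta> * xp + (1 - \<theta>) * e} + \<theta> * p e" by blast
      then show ?thesis using \<open>0 < uR\<close> \<open>uL = 0\<close> u0 xp pq0 by (intro right[of e]) auto
    qed
  next
    case True
    obtain e where e: "w \<le> e" "e \<le> xp"
      "\<And>z. xm \<le> z \<Longrightarrow> z \<le> e \<Longrightarrow> mass (F \<inter> {xm..z}) \<le> mass {\<theta> * xm + (1 - \<theta>) * z..z}"
      "mass (F \<inter> {xm..xp}) \<le> mass {\<theta> * xm + (1 - \<theta>) * e..e} + \<theta> * q e"
      using gl True by blast
    obtain e' where e': "xm \<le> e'" "e' \<le> w"
      "\<And>z. e' \<le> z \<Longrightarrow> z \<le> xp \<Longrightarrow> mass (F \<inter> {z..xp}) \<le> mass {z..\<theta> * xp + (1 - \<theta>) * z}"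
      "mass (F \<inter> {xm..xp}) \<le> mass {e'..\<theta> * xp + (1 - \<theta>) * e'} + \<theta> * p e'"
      using gr True by blast
    \<comment> \<open>For a cut at z, \<open>uR * p z \<le> uL * q z\<close> says that the left part
      is at least as rich in K. In the third case the left part is richer at e' and poorer at e, and
      e' \<le> w \<le> e, so the proportions agree at some z between; there both \<open>good\<close>
      bounds hold, and each side loses one \<eta>.\<close>
    consider "uR * p e \<le> uL * q e" | "uL * q e' \<le> uR * p e'"
      | "uL * q e < uR * p e" "uR * p e' < uL * q e'" by linarith
    then show ?thesis
    proof cases
      case 1
      then show ?thesis using e xm True by (intro left[of e]) auto
    next
      case 2
      then show ?thesis using e' xp True by (intro right[of e']) auto
    next
      case 3
      have "\<exists>z\<ge>e'. z \<le> e \<and> uR * (mass {..z} - mass {..xm}) - uL * (mass {..xp} - mass {..z}) = 0"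
        using 3 e e' xm xp nu_Icc_eq[of xm e] nu_Icc_eq[of e xp] nu_Icc_eq[of xm e'] nu_Icc_eq[of e' xp]
        by (intro IVT') (auto simp: p_def q_def intro!: continuous_intros continuous_nu_atMost)
      then obtain z where z: "e' \<le> z" "z \<le> e" and zz: "uR * p z = uL * q z"
        using nu_Icc_eq[of xm] nu_Icc_eq[of _ xp] e e' unfolding p_def q_def
        by (metis order_trans eq_iff_diff_eq_0)
      have z': "xm \<le> z" "z \<le> xp" using z e e' by auto
      have "pmean s \<theta> (uL + uR) ((uL + p z) + (uR + q z)) = pmean s \<theta> uL (uL + p z) + pmean s \<theta> uR (uR + q z)"
        by (rule pmean_add_proportional) (use s th' True u0 pq0 zz in \<open>auto simp: algebra_simps\<close>)
      moreover have "pmean s \<theta> (uL + uR) (((uL + p z) + (uR + q z)) + (gL + gR))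
          \<le> pmean s \<theta> (uL + uR) ((uL + p z) + (uR + q z)) + (1 - \<theta>) * (gL + gR)"
        by (rule pmean_add_right) (use s th' True u0 pq0 g0 in auto)
      moreover have "mass (F \<inter> {xm..xp}) \<le> mass (F \<inter> {xm..z}) + mass (F \<inter> {z..xp})"
        by (rule nu_Int_Icc_le) simp
      ultimately show ?thesis
        using e(3)[of z] e'(3)[of z] z z' BMl[of z] BMr[of z] True vF mtot[OF z'] uK
        by (simp add: algebra_simps)
    qed
  qed
qed

end

section \<open>Concave measures on the line\<close>

lemma compact_inner_approx:
  fixes \<mu> :: "'a::euclidean_space measure"
  assumes "finite_measure \<mu>" "sets \<mu> = sets borel" "E \<in> sets borel" "c < measure \<mu> E"
  obtains K where "compact K" "K \<subseteq> E" "c < measure \<mu> K"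
proof -
  interpret finite_measure \<mu> by fact
  show ?thesis
  proof (cases "c < 0")
    case True
    then show ?thesis by (intro that[of "{}"]) auto
  next
    case False
    have "emeasure \<mu> E = (SUP K \<in> {K. K \<subseteq> E \<and> compact K}. emeasure \<mu> K)"
      by (rule inner_regular) (use assms in auto)
    moreover have "ennreal c < emeasure \<mu> E"
      using assms(4) False by (simp add: emeasure_eq_measure ennreal_lessI)
    ultimately obtain K where "K \<subseteq> E" "compact K" "ennreal c < emeasure \<mu> K"
      by (auto simp: less_SUP_iff)
    then show ?thesis using that[of K] False by (simp add: emeasure_eq_measure ennreal_less_iff)
  qed
qed

text \<open>Convex combinations of compact sets in the hyperplane and in the half space have mass bounded
  below, but they lie in strips of width tending to 0 as the weight tends to 1.\<close>

lemma s_concave_half_space_null: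
  fixes \<mu> :: "'a::euclidean_space measure"
  assumes fin: "finite_measure \<mu>" and sets: "sets \<mu> = sets borel" and sc: "s_concave s \<mu>"
    and s: "0 \<le> s" "s \<le> 1" and H: "0 < measure \<mu> {x. a \<bullet> x = b}"
  shows "measure \<mu> {x. b < a \<bullet> x} = 0"
proof (rule ccontr)
  assume "measure \<mu> {x. b < a \<bullet> x} \<noteq> 0"
  then have G: "0 < measure \<mu> {x. b < a \<bullet> x}" by (simp add: less_le)
  interpret finite_measure \<mu> by fact
  obtain A where A: "compact A" "A \<subseteq> {x. a \<bullet> x = b}" "0 < measure \<mu> A"
    by (rule compact_inner_approx[OF fin sets _ H]) auto
  obtain B where B: "compact B" "B \<subseteq> {x. b < a \<bullet> x}" "0 < measure \<mu> B"
    by (rule compact_inner_approx[OF fin sets _ G]) auto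
  have "bounded ((\<lambda>x. a \<bullet> x) ` B)"
    by (intro compact_imp_bounded compact_continuous_image B continuous_intros)
  then obtain l where l: "\<And>x. x \<in> B \<Longrightarrow> a \<bullet> x \<le> l" by (auto simp: bounded_real abs_le_iff)
  define U where "U = (\<lambda>n::nat. {x. b < a \<bullet> x \<and> a \<bullet> x \<le> b + (\<bar>l\<bar> + \<bar>b\<bar>) / Suc n})"
  have Um: "U n \<in> sets \<mu>" for n unfolding U_def sets by measurable
  have "(\<lambda>n. measure \<mu> (U n)) \<longlonglongrightarrow> measure \<mu> (\<Inter>n. U n)"
  proof (rule finite_Lim_measure_decseq)
    show "range U \<subseteq> sets \<mu>" using Um by auto
    show "decseq U"
    proof (rule decseq_SucI, unfold U_def, safe)
      fix n x assume "a \<bullet> x \<le> b + (\<bar>l\<bar> + \<bar>b\<bar>) / real (Suc (Suc n))"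
      also have "\<dots> \<le> b + (\<bar>l\<bar> + \<bar>b\<bar>) / real (Suc n)" by (intro add_left_mono divide_left_mono) auto
      finally show "a \<bullet> x \<le> b + (\<bar>l\<bar> + \<bar>b\<bar>) / real (Suc n)" .
    qed
  qed
  moreover have "(\<Inter>n. U n) = {}"
  proof (rule ccontr)
    assume "(\<Inter>n. U n) \<noteq> {}"
    then obtain x where x: "\<And>n. x \<in> U n" by blast
    have "(\<lambda>n. b + (\<bar>l\<bar> + \<bar>b\<bar>) / real (Suc n)) \<longlonglongrightarrow> b + 0"
      by (intro tendsto_intros LIMSEQ_Suc lim_const_over_n)
    then have "a \<bullet> x \<le> b + 0" by (rule LIMSEQ_le_const) (use x in \<open>auto simp: U_def\<close>)
    moreover have "b < a \<bullet> x" using x[of 0] by (simp add: U_def)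
    ultimately show False by simp
  qed
  ultimately have lim: "(\<lambda>n. measure \<mu> (U n)) \<longlonglongrightarrow> 0" by simp
  have "min (measure \<mu> A) (measure \<mu> B) \<le> measure \<mu> (U n)" for n
  proof -
    define \<alpha> where "\<alpha> = 1 - 1 / real (Suc n)"
    have al: "0 \<le> \<alpha>" "\<alpha> \<le> 1" by (auto simp: \<alpha>_def)
    have "min (measure \<mu> A) (measure \<mu> B) \<le> pmean s \<alpha> (measure \<mu> A) (measure \<mu> B)"
      by (rule pmean_ge_min) (use s al in auto)
    also have "\<dots> \<le> measure \<mu> {\<alpha> *\<^sub>R x + (1 - \<alpha>) *\<^sub>R y | x y. x \<in> A \<and> y \<in> B}"
      by (rule s_concaveD) (use sc A B al in auto)
    also have "\<dots> \<le> measure \<mu> (U n)"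
    proof (rule finite_measure_mono[OF _ Um], safe)
      fix x y assume "x \<in> A" "y \<in> B"
      then have xy: "a \<bullet> x = b" "b < a \<bullet> y" "a \<bullet> y \<le> l" using A B l by auto
      have eq: "a \<bullet> (\<alpha> *\<^sub>R x + (1 - \<alpha>) *\<^sub>R y) = b + (a \<bullet> y - b) / real (Suc n)"
        using xy by (simp add: inner_add_right \<alpha>_def left_diff_distrib diff_divide_distrib)
      have "(a \<bullet> y - b) / real (Suc n) \<le> (\<bar>l\<bar> + \<bar>b\<bar>) / real (Suc n)"
        using xy by (intro divide_right_mono) auto
      then show "\<alpha> *\<^sub>R x + (1 - \<alpha>) *\<^sub>R y \<in> U n" using xy unfolding U_def mem_Collect_eq eq by simp
    qed
    finally show ?thesis .
  qed
  then have "min (measure \<mu> A) (measure \<mu> B) \<le> 0"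
    by (intro LIMSEQ_le_const[OF lim]) auto
  then show False using A B by simp
qed

text \<open>The previous lemma on both sides. A hyperplane thus has either no mass or all of it; on
  the line, a measure with an atom is concentrated at one point.\<close>

lemma s_concave_hyperplane_full:
  fixes \<mu> :: "'a::euclidean_space measure"
  assumes fin: "finite_measure \<mu>" and sets: "sets \<mu> = sets borel" and sc: "s_concave s \<mu>"
    and s: "0 \<le> s" "s \<le> 1" and H: "0 < measure \<mu> {x. a \<bullet> x = b}"
  shows "measure \<mu> (- {x. a \<bullet> x = b}) = 0"
proof -
  interpret finite_measure \<mu> by fact
  have "- {x. a \<bullet> x = b} = {x. b < a \<bullet> x} \<union> {x. - b < (- a) \<bullet> x}" by auto
  then have "measure \<mu> (- {x. a \<bullet> x = b}) \<le> measure \<mu> {x. b < a \<bullet> x} + measure \<mu> {x. - b < (- a) \<bullet> x}"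
    by (simp only:) (rule measure_Un_le; simp add: sets open_halfspace_gt)
  moreover have "measure \<mu> {x. b < a \<bullet> x} = 0"
    by (rule s_concave_half_space_null) (use assms in auto)
  moreover have "measure \<mu> {x. - b < (- a) \<bullet> x} = 0"
    by (rule s_concave_half_space_null) (use assms in auto)
  ultimately have "measure \<mu> (- {x. a \<bullet> x = b}) \<le> 0" by simp
  then show ?thesis by (simp add: measure_le_0_iff)
qed

section \<open>Smoothing a concave measure on the line\<close>

lemma s_concave_Icc:
  fixes \<pi> :: "real measure"
  assumes fin: "finite_measure \<pi>" and sets: "sets \<pi> = sets borel" and sc: "s_concave s \<pi>"
    and pos: "0 < measure \<pi> {a..b}" "0 < measure \<pi> {c..d}" and al: "0 \<le> \<alpha>" "\<alpha> \<le> 1"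
  shows "pmean s \<alpha> (measure \<pi> {a..b}) (measure \<pi> {c..d})
      \<le> measure \<pi> {\<alpha> * a + (1 - \<alpha>) * c..\<alpha> * b + (1 - \<alpha>) * d}"
proof -
  interpret finite_measure \<pi> by fact
  have "pmean s \<alpha> (measure \<pi> {a..b}) (measure \<pi> {c..d})
      \<le> measure \<pi> {\<alpha> *\<^sub>R x + (1 - \<alpha>) *\<^sub>R y | x y. x \<in> {a..b} \<and> y \<in> {c..d}}"
    by (rule s_concaveD) (use assms in auto)
  also have "\<dots> \<le> measure \<pi> {\<alpha> * a + (1 - \<alpha>) * c..\<alpha> * b + (1 - \<alpha>) * d}"
    by (rule finite_measure_mono) (use al sets in \<open>auto intro!: add_mono mult_left_mono\<close>)
  finally show ?thesis .
qed

text \<open>Smoothing \<open>\<pi>\<close> by the uniform distribution on \<open>{-h..0}\<close> gives the continuous density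
  \<open>\<lambda>x. \<pi> {x..x+h} / h\<close>, with no need to prove that \<open>\<pi>\<close> has a density.\<close>

lemma nn_integral_window:
  fixes \<pi> :: "real measure"
  assumes fin: "finite_measure \<pi>" and sets [measurable_cong]: "sets \<pi> = sets borel" and h: "0 < h"
    and E [measurable]: "E \<in> sets borel"
  shows "(\<integral>\<^sup>+x. ennreal (measure \<pi> {x..x+h} / h) * indicator E x \<partial>lborel)
    = (\<integral>\<^sup>+y. ennreal (measure lborel (E \<inter> {y-h..y}) / h) \<partial>\<pi>)"
proof -
  interpret finite_measure \<pi> by fact
  interpret pair_sigma_finite lborel \<pi>
    by (intro pair_sigma_finite.intro sigma_finite_measure_axioms lborel.sigma_finite_measure_axioms)
  define g :: "real \<Rightarrow> real \<Rightarrow> ennreal" where "g = (\<lambda>x y. indicator {p. fst p \<in> E \<and> fst p \<le> snd p \<and> snd p \<le> fst p + h} (x, y) * ennreal (1 / h))"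
  have g [measurable]: "case_prod g \<in> borel_measurable (lborel \<Otimes>\<^sub>M \<pi>)"
    unfolding g_def case_prod_beta by measurable
  have "ennreal (measure \<pi> {x..x+h} / h) * indicator E x = (\<integral>\<^sup>+y. g x y \<partial>\<pi>)" for x
  proof -
    have "(\<integral>\<^sup>+y. g x y \<partial>\<pi>) = (\<integral>\<^sup>+y. (indicator E x * ennreal (1 / h)) * indicator {x..x+h} y \<partial>\<pi>)"
      by (intro nn_integral_cong) (auto simp: g_def indicator_def)
    also have "\<dots> = (indicator E x * ennreal (1 / h)) * emeasure \<pi> {x..x+h}"
      by (subst nn_integral_cmult) (auto simp: sets)
    also have "\<dots> = ennreal (measure \<pi> {x..x+h} / h) * indicator E x"
      using h by (auto simp: emeasure_eq_measure ennreal_mult[symmetric] indicator_def)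
    finally show ?thesis by simp
  qed
  then have "(\<integral>\<^sup>+x. ennreal (measure \<pi> {x..x+h} / h) * indicator E x \<partial>lborel) = (\<integral>\<^sup>+x. \<integral>\<^sup>+y. g x y \<partial>\<pi> \<partial>lborel)"
    by simp
  also have "\<dots> = (\<integral>\<^sup>+y. \<integral>\<^sup>+x. g x y \<partial>lborel \<partial>\<pi>)" by (rule Fubini'[symmetric]) (rule g)
  also have "\<dots> = (\<integral>\<^sup>+y. ennreal (measure lborel (E \<inter> {y-h..y}) / h) \<partial>\<pi>)"
  proof (intro nn_integral_cong)
    fix y
    have fin: "emeasure lborel (E \<inter> {y-h..y}) < \<infinity>" by (intro emeasure_bounded_finite bounded_Int) auto
    have "(\<integral>\<^sup>+x. g x y \<partial>lborel) = (\<integral>\<^sup>+x. ennreal (1 / h) * indicator (E \<inter> {y-h..y}) x \<partial>lborel)"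
      by (intro nn_integral_cong) (auto simp: g_def indicator_def)
    also have "\<dots> = ennreal (1 / h) * emeasure lborel (E \<inter> {y-h..y})"
      by (subst nn_integral_cmult) auto
    also have "\<dots> = ennreal (measure lborel (E \<inter> {y-h..y}) / h)"
      using h fin by (simp add: emeasure_eq_ennreal_measure ennreal_mult[symmetric] less_top)
    finally show "(\<integral>\<^sup>+x. g x y \<partial>lborel) = ennreal (measure lborel (E \<inter> {y-h..y}) / h)" .
  qed
  finally show ?thesis .
qed

text \<open>Without atoms the distribution function is continuous, hence uniformly continuous on a
  compact interval reaching beyond the support. Smallness uniform in x later bounds the error
  between \<pi> and its smoothing at both ends of every interval.\<close>

lemma uniformly_small_windows:
  fixes \<pi> :: "real measure"
  assumes fin: "finite_measure \<pi>" and sets: "sets \<pi> = sets borel"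
    and supp: "measure \<pi> (- {-R..R}) = 0" and atom: "\<And>x. measure \<pi> {x} = 0" and k: "0 < \<kappa>" "0 < h0"
  obtains h where "0 < h" "h \<le> h0" "h \<le> 1" "\<And>x. measure \<pi> {x..x+h} \<le> \<kappa>"
    "continuous_on UNIV (\<lambda>x. measure \<pi> {x..x+h})"
proof -
  interpret finite_borel_measure \<pi> using fin sets by (simp add: finite_borel_measure_def finite_borel_measure_axioms_def)
  have eq: "measure \<pi> {a..b} = cdf \<pi> b - cdf \<pi> a" if "a \<le> b" for a b
  proof -
    have "measure \<pi> ({a} \<union> {a<..b}) = measure \<pi> {a} + measure \<pi> {a<..b}"
      by (rule finite_measure_Union) (auto simp: sets)
    moreover have "{a} \<union> {a<..b} = {a..b}" using that by auto
    ultimately have "measure \<pi> {a..b} = measure \<pi> {a} + measure \<pi> {a<..b}" by simp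
    then show ?thesis using atom cdf_diff_eq[of a b] that by (cases "a = b") auto
  qed
  have cc: "continuous_on A (cdf \<pi>)" for A
    using atom isCont_cdf by (intro continuous_at_imp_continuous_on) simp
  have "uniformly_continuous_on {-R-2..R+2} (cdf \<pi>)"
    by (intro compact_uniformly_continuous cc) auto
  then obtain \<delta> where d: "\<delta> > 0" "\<And>x y. x \<in> {-R-2..R+2} \<Longrightarrow> y \<in> {-R-2..R+2} \<Longrightarrow> dist y x < \<delta> \<Longrightarrow> dist (cdf \<pi> y) (cdf \<pi> x) < \<kappa>"
    using k unfolding uniformly_continuous_on_def by meson
  define h where "h = min (\<delta>/2) (min h0 1)"
  have h: "0 < h" "h \<le> h0" "h \<le> 1" "h < \<delta>" using d k by (auto simp: h_def)
  have "measure \<pi> {x..x+h} \<le> \<kappa>" for x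
  proof (cases "-R-1 \<le> x \<and> x \<le> R+1")
    case True
    then have "dist (cdf \<pi> (x+h)) (cdf \<pi> x) < \<kappa>" using h by (intro d) (auto simp: dist_real_def)
    then show ?thesis using eq[of x "x+h"] h by (simp add: dist_real_def)
  next
    case False
    then have "measure \<pi> {x..x+h} \<le> measure \<pi> (- {-R..R})"
      using h by (intro finite_measure_mono) (auto simp: sets)
    then show ?thesis using supp k by simp
  qed
  moreover have "continuous_on UNIV (\<lambda>x. measure \<pi> {x..x+h})"
    using h by (subst eq) (auto intro!: continuous_intros continuous_on_compose2[OF cc[of UNIV]])
  ultimately show ?thesis using h by (intro that[of h]) auto
qed

text \<open>Concavity applied to two translates of one window gives quasi-concavity of the mass of
  the window {x..x+h}. A continuous quasi-concave function vanishing outside a compact set has a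
  mode.\<close>

lemma unimodal_density_window:
  fixes \<pi> :: "real measure"
  assumes fin: "finite_measure \<pi>" and sets: "sets \<pi> = sets borel" and sc: "s_concave s \<pi>"
    and s: "0 \<le> s" "s \<le> 1"
    and supp: "measure \<pi> (- {-R..R}) = 0" and h: "0 < h"
    and cont: "continuous_on UNIV (\<lambda>x. measure \<pi> {x..x+h})"
  obtains w where "unimodal_density (\<lambda>x. measure \<pi> {x..x+h} / h) w"
proof -
  interpret finite_measure \<pi> by fact
  define m where "m = (\<lambda>x. measure \<pi> {x..x+h})"
  have m0: "0 \<le> m x" for x by (simp add: m_def)
  have qc: "min (m x) (m z) \<le> m y" if "x \<le> y" "y \<le> z" for x y z
  proof (cases "x < z \<and> 0 < m x \<and> 0 < m z")
    case False
    then have "x = y \<and> y = z \<or> min (m x) (m z) \<le> 0" using that m0 by (auto simp: min_le_iff_disj not_less)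
    then show ?thesis using m0[of y] by fastforce
  next
    case True
    define \<alpha> where "\<alpha> = (z - y) / (z - x)"
    have al: "0 \<le> \<alpha>" "\<alpha> \<le> 1" using that True by (auto simp: \<alpha>_def field_simps)
    have y: "\<alpha> * x + (1 - \<alpha>) * z = y"
    proof -
      have "\<alpha> * (z - x) = z - y" using True by (simp add: \<alpha>_def)
      then show ?thesis by (simp add: algebra_simps)
    qed
    have "min (m x) (m z) \<le> pmean s \<alpha> (m x) (m z)"
      by (rule pmean_ge_min) (use s al m0 in auto)
    also have "\<dots> \<le> measure \<pi> {\<alpha> * x + (1 - \<alpha>) * z..\<alpha> * (x+h) + (1 - \<alpha>) * (z+h)}"
      unfolding m_def by (rule s_concave_Icc[OF fin sets sc]) (use True al in \<open>auto simp: m_def\<close>)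
    also have "\<alpha> * (x+h) + (1 - \<alpha>) * (z+h) = y + h" using y by (simp add: algebra_simps)
    finally show ?thesis using y by (simp add: m_def)
  qed
  have mout: "m x = 0" if "x \<notin> {-\<bar>R\<bar>-h..\<bar>R\<bar>}" for x
  proof -
    have "m x \<le> measure \<pi> (- {-R..R})" unfolding m_def
      using that h by (intro finite_measure_mono) (auto simp: sets)
    then show ?thesis using supp m0[of x] by simp
  qed
  have "\<exists>w\<in>{-\<bar>R\<bar>-h..\<bar>R\<bar>}. \<forall>x\<in>{-\<bar>R\<bar>-h..\<bar>R\<bar>}. m x \<le> m w"
    by (rule continuous_attains_sup)
       (use h in \<open>auto simp: m_def intro: continuous_on_subset[OF cont]\<close>)
  then obtain w where w: "\<And>x. x \<in> {-\<bar>R\<bar>-h..\<bar>R\<bar>} \<Longrightarrow> m x \<le> m w" by blast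
  have wmax: "m x \<le> m w" for x using w[of x] mout[of x] m0[of w] by (cases "x \<in> {-\<bar>R\<bar>-h..\<bar>R\<bar>}") auto
  have "unimodal_density (\<lambda>x. m x / h) w"
  proof
    show "continuous_on UNIV (\<lambda>x. m x / h)" using cont h unfolding m_def by (intro continuous_intros) auto
    then have mb: "(\<lambda>x. m x / h) \<in> borel_measurable borel" by (rule borel_measurable_continuous_onI)
    show "0 \<le> m x / h" for x using m0 h by simp
    show "integrable lborel (\<lambda>x. m x / h)"
    proof (rule integrableI_nonneg)
      have "(\<integral>\<^sup>+x. ennreal (m x / h) \<partial>lborel) = (\<integral>\<^sup>+y. ennreal (measure lborel (UNIV \<inter> {y-h..y}) / h) \<partial>\<pi>)"
        using nn_integral_window[OF fin sets h, of UNIV] by (simp add: m_def)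
      also have "\<dots> = emeasure \<pi> (space \<pi>)" using h by simp
      finally show "(\<integral>\<^sup>+x. ennreal (m x / h) \<partial>lborel) < \<infinity>" by (simp add: emeasure_eq_measure)
    qed (use mb m0 h in auto)
    show "m x / h \<le> m y / h" if "x \<le> y" "y \<le> w" for x y
      using qc[OF that] wmax[of x] h by (simp add: divide_right_mono)
    show "m y / h \<le> m x / h" if "w \<le> x" "x \<le> y" for x y
      using qc[OF that] wmax[of y] h by (simp add: divide_right_mono)
  qed
  then show ?thesis using that by (simp add: m_def)
qed

text \<open>The density condition is assumed for K and F but the conclusion concerns K0 and F0,
  because smoothing moves mass by up to h \<le> h0: the mass of K0 and F0 must stay inside K and
  F.\<close>

lemma s_concave_dilation_line:
  fixes \<pi> :: "real measure"
  assumes fin: "finite_measure \<pi>" and sets: "sets \<pi> = sets borel" and sc: "s_concave s \<pi>"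
    and s: "0 \<le> s" "s \<le> 1" and th: "0 < \<theta>" "\<theta> < 1"
    and supp: "measure \<pi> (- {-R..R}) = 0"
    and K: "compact K" and F: "compact F" and disj: "K \<inter> F = {}"
    and P: "\<And>x y. x \<in> K \<Longrightarrow> measure lborel (F \<inter> closed_segment x y) \<le> \<theta> * \<bar>x - y\<bar>"
    and h0: "0 < h0"
    and K0: "K0 \<in> sets borel" "\<And>x y. x \<in> K0 \<Longrightarrow> \<bar>y - x\<bar> \<le> h0 \<Longrightarrow> y \<in> K"
    and F0: "F0 \<in> sets borel" "\<And>x y. x \<in> F0 \<Longrightarrow> \<bar>y - x\<bar> \<le> h0 \<Longrightarrow> y \<in> F"
    and pos: "0 < measure \<pi> K0"
  shows "pmean s \<theta> (measure \<pi> K0) (measure \<pi> UNIV) \<le> measure \<pi> (- F0)"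
proof -
  interpret finite_measure \<pi> by fact
  have sp: "space \<pi> = UNIV" using sets_eq_imp_space_eq[OF sets] by simp
  have th': "0 \<le> \<theta>" "\<theta> \<le> 1" using th by auto
  have le: "measure \<pi> A \<le> measure \<pi> B" if "A \<subseteq> B" "B \<in> sets borel" for A B
    by (rule finite_measure_mono) (use that sets in auto)
  show ?thesis
  proof (cases "\<exists>x. measure \<pi> {x} \<noteq> 0")
    case True
    then obtain x where x: "0 < measure \<pi> {x}" by (auto simp: less_le)
    then have "0 < measure \<pi> {y. 1 \<bullet> y = x}" by simp
    from s_concave_hyperplane_full[OF fin sets sc s this] have n: "measure \<pi> (- {x}) = 0" by simp
    have "x \<in> K0"
    proof (rule ccontr)
      assume "x \<notin> K0"
      then have "measure \<pi> K0 \<le> measure \<pi> (- {x})" by (intro le) auto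
      then show False using pos n by simp
    qed
    then have "x \<in> K" using K0(2)[of x x] h0 by simp
    then have "x \<notin> F0" using F0(2)[of x x] h0 disj by auto
    then have "measure \<pi> {x} \<le> measure \<pi> (- F0)" using F0 by (intro le) auto
    moreover have "measure \<pi> UNIV = measure \<pi> {x}"
      using finite_measure_compl[of "{x}"] n sets sp by (simp add: Compl_eq_Diff_UNIV)
    moreover have "pmean s \<theta> (measure \<pi> K0) (measure \<pi> UNIV) \<le> measure \<pi> UNIV"
      by (rule pmean_le_right) (use s th' le[of K0 UNIV] in auto)
    ultimately show ?thesis by simp
  next
    case False
    then have atom: "\<And>x. measure \<pi> {x} = 0" by auto
    show ?thesis
    proof (rule field_le_epsilon)
      fix \<epsilon> :: real assume "0 < \<epsilon>"
      \<comment> \<open>\<open>widen\<close> loses \<kappa> at each end of an interval, so \<eta> =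
        2 \<kappa>, and \<open>unimodal_dilation\<close> loses 2 \<eta> = \<epsilon>.\<close>
      define \<kappa> where "\<kappa> = \<epsilon> / 4"
      have k: "0 < \<kappa>" using \<open>0 < \<epsilon>\<close> by (simp add: \<kappa>_def)
      obtain h where h: "0 < h" "h \<le> h0" "h \<le> 1" "\<And>x. measure \<pi> {x..x+h} \<le> \<kappa>"
        and cont: "continuous_on UNIV (\<lambda>x. measure \<pi> {x..x+h})"
        using uniformly_small_windows[OF fin sets supp atom k h0] by blast
      obtain w where "unimodal_density (\<lambda>x. measure \<pi> {x..x+h} / h) w"
        using unimodal_density_window[OF fin sets sc s supp h(1) cont] by blast
      then interpret U: unimodal_density "\<lambda>x. measure \<pi> {x..x+h} / h" w .
      have em: "emeasure U.nu E = (\<integral>\<^sup>+y. ennreal (measure lborel (E \<inter> {y-h..y}) / h) \<partial>\<pi>)" if "E \<in> sets borel" for E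
        using nn_integral_window[OF fin sets h(1) that] that unfolding U.nu_def
        by (subst emeasure_density) auto
      \<comment> \<open>The smoothing spreads the mass at y uniformly over {y-h..y}. This is why
        \<open>lower\<close> asks for a margin of h to the left and \<open>upper\<close> enlarges
        the interval to the right.\<close>
      have lower: "measure \<pi> E0 \<le> measure U.nu E"
        if "E0 \<in> sets borel" "E \<in> sets borel" "\<And>y. y \<in> E0 \<Longrightarrow> {y-h..y} \<subseteq> E" for E0 E
      proof -
        have "emeasure \<pi> E0 = (\<integral>\<^sup>+y. indicator E0 y \<partial>\<pi>)" using that sets by simp
        also have "\<dots> \<le> emeasure U.nu E" unfolding em[OF that(2)]
        proof (intro nn_integral_mono)
          fix y
          show "indicator E0 y \<le> ennreal (measure lborel (E \<inter> {y-h..y}) / h)"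
            using that(3)[of y] h by (cases "y \<in> E0") (auto simp: Int_absorb1)
        qed
        finally show ?thesis by (simp add: emeasure_eq_measure U.nu.emeasure_eq_measure)
      qed
      have upper: "measure U.nu {a..b} \<le> measure \<pi> {a..b+h}" for a b
      proof -
        have "emeasure U.nu {a..b} = (\<integral>\<^sup>+y. ennreal (measure lborel ({a..b} \<inter> {y-h..y}) / h) \<partial>\<pi>)"
          by (rule em) simp
        also have "\<dots> \<le> (\<integral>\<^sup>+y. indicator {a..b+h} y \<partial>\<pi>)"
        proof (intro nn_integral_mono)
          fix y
          have "measure lborel ({a..b} \<inter> {y-h..y}) \<le> measure lborel {y-h..y}"
            by (rule measure_mono_fmeasurable) (auto simp: fmeasurable_def emeasure_lborel_Icc_eq)
          then have "measure lborel ({a..b} \<inter> {y-h..y}) / h \<le> 1" using h by simp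
          moreover have "{a..b} \<inter> {y-h..y} = {}" if "y \<notin> {a..b+h}" using that by auto
          ultimately show "ennreal (measure lborel ({a..b} \<inter> {y-h..y}) / h) \<le> indicator {a..b+h} y"
            by (cases "y \<in> {a..b+h}") auto
        qed
        also have "\<dots> = emeasure \<pi> {a..b+h}" using sets by simp
        finally show ?thesis by (simp add: emeasure_eq_measure U.nu.emeasure_eq_measure)
      qed
      have small: "measure U.nu {a..a+h} \<le> \<kappa>" for a
        using U.nu_le_const[of "{a..a+h}" "\<kappa> / h"] h by (auto simp: divide_right_mono)
      have widen: "measure \<pi> {a..b+h} \<le> measure U.nu {a..b} + 2 * \<kappa>" if "a \<le> b" for a b
      proof -
        have "measure \<pi> {a..b+h} \<le> measure U.nu {a-h..b+h}" by (rule lower) auto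
        also have "\<dots> = measure U.nu {a-h..a} + measure U.nu {a..b} + measure U.nu {b..b+h}"
          using U.nu_Icc_add[of "a-h" a "b+h"] U.nu_Icc_add[of a b "b+h"] that h by simp
        finally show ?thesis using small[of "a-h"] small[of b] by simp
      qed
      have mono: "pmean s \<theta> u m \<le> pmean s \<theta> u' m'" if "0 \<le> u" "u \<le> u'" "0 \<le> m" "m \<le> m'" for u u' m m'
        using pmean_mono[OF s th' that] .
      have "pmean s \<theta> (measure U.nu K) (measure U.nu UNIV) - 2 * (2 * \<kappa>) \<le> measure U.nu (- F)"
      proof (rule U.unimodal_dilation[OF s th K F disj P])
        show "0 < measure U.nu K" using lower[of K0 K] K0 pos h compact_imp_closed[OF K]
          by (fastforce intro: less_le_trans)
        fix a b z :: real assume ab: "a \<le> b" and p: "0 < measure U.nu {a..b}"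
        {
          assume z: "b \<le> z"
          have c: "a \<le> \<theta> * b + (1 - \<theta>) * z"
            using convex_bound_le[of "-b" "-a" "-z" \<theta> "1-\<theta>"] ab z th' by simp
          have "pmean s \<theta> (measure U.nu {a..b}) (measure U.nu {a..z}) \<le> pmean s \<theta> (measure \<pi> {a..b+h}) (measure \<pi> {a..z+h})"
            by (rule mono) (auto intro: upper)
          also have "\<dots> \<le> measure \<pi> {\<theta> * a + (1 - \<theta>) * a..\<theta> * (b+h) + (1 - \<theta>) * (z+h)}"
            using p upper[of a b] le[of "{a..b+h}" "{a..z+h}"] z th'
            by (intro s_concave_Icc[OF fin sets sc]) auto
          also have "\<dots> = measure \<pi> {a..(\<theta> * b + (1 - \<theta>) * z) + h}" by (simp add: algebra_simps)
          finally show "pmean s \<theta> (measure U.nu {a..b}) (measure U.nu {a..z}) - 2 * \<kappa> \<le> measure U.nu {a..\<theta> * b + (1 - \<theta>) * z}"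
            using widen[OF c] by simp
        next
          assume z: "z \<le> a"
          have c: "\<theta> * a + (1 - \<theta>) * z \<le> b"
            using convex_bound_le[of a b z \<theta> "1-\<theta>"] ab z th' by simp
          have "pmean s \<theta> (measure U.nu {a..b}) (measure U.nu {z..b}) \<le> pmean s \<theta> (measure \<pi> {a..b+h}) (measure \<pi> {z..b+h})"
            by (rule mono) (auto intro: upper)
          also have "\<dots> \<le> measure \<pi> {\<theta> * a + (1 - \<theta>) * z..\<theta> * (b+h) + (1 - \<theta>) * (b+h)}"
            using p upper[of a b] le[of "{a..b+h}" "{z..b+h}"] z th'
            by (intro s_concave_Icc[OF fin sets sc]) auto
          also have "\<dots> = measure \<pi> {\<theta> * a + (1 - \<theta>) * z..b + h}" by (simp add: algebra_simps)
          finally show "pmean s \<theta> (measure U.nu {a..b}) (measure U.nu {z..b}) - 2 * \<kappa> \<le> measure U.nu {\<theta> * a + (1 - \<theta>) * z..b}"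
            using widen[OF c] by simp
        }
      qed (use k in auto)
      moreover have "measure \<pi> UNIV \<le> measure U.nu UNIV" by (rule lower) auto
      moreover have "measure U.nu UNIV \<le> measure \<pi> UNIV"
      proof -
        have "emeasure U.nu UNIV = emeasure \<pi> UNIV" using h sp by (subst em) auto
        then show ?thesis by (simp add: emeasure_eq_measure U.nu.emeasure_eq_measure)
      qed
      moreover have "measure \<pi> K0 \<le> measure U.nu K" "measure \<pi> F0 \<le> measure U.nu F"
        using K0 F0 h K F by (auto intro!: lower borel_closed compact_imp_closed)
      moreover have "measure \<pi> (- F0) = measure \<pi> UNIV - measure \<pi> F0"
        using finite_measure_compl[of F0] F0 sets sp by (simp add: Compl_eq_Diff_UNIV)
      moreover have "measure U.nu (- F) = measure U.nu UNIV - measure U.nu F"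
        using U.nu.finite_measure_compl[of F] F by (simp add: Compl_eq_Diff_UNIV borel_closed compact_imp_closed)
      ultimately show "pmean s \<theta> (measure \<pi> K0) (measure \<pi> UNIV) \<le> measure \<pi> (- F0) + \<epsilon>"
        using mono[of "measure \<pi> K0" "measure U.nu K" "measure \<pi> UNIV" "measure U.nu UNIV"]
        by (simp add: \<kappa>_def)
    qed
  qed
qed

section \<open>Localisation to the line\<close>

text \<open>A combination of points of C lying above A and B is again in C, by convexity, and lies
  above the combination of A and B, by linearity. This makes a thin body a concave measure on its
  axis, with no disintegration of \<mu>.\<close>

lemma s_concave_projection:
  fixes \<mu> :: "'a::euclidean_space measure" and z u :: 'a
  assumes fin: "finite_measure \<mu>" and sets: "sets \<mu> = sets borel" and sc: "s_concave s \<mu>"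
    and C: "compact C" "convex C"
  defines "\<pi> \<equiv> distr (restrict_space \<mu> C) borel (\<lambda>x. (x - z) \<bullet> u)"
  shows "finite_measure \<pi>" "sets \<pi> = sets borel" "s_concave s \<pi>"
    "\<And>E. E \<in> sets borel \<Longrightarrow> measure \<pi> E = measure \<mu> {x \<in> C. (x - z) \<bullet> u \<in> E}"
proof -
  interpret finite_measure \<mu> by fact
  have sp: "space \<mu> = UNIV" using sets_eq_imp_space_eq[OF sets] by simp
  have Cb: "C \<in> sets \<mu>" using C sets by (simp add: borel_closed compact_imp_closed)
  have meas: "(\<lambda>x. (x - z) \<bullet> u) \<in> measurable \<mu> borel"
    using sets by (subst measurable_cong_sets[OF sets refl]) measurable
  then have meas': "(\<lambda>x. (x - z) \<bullet> u) \<in> measurable (restrict_space \<mu> C) borel"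
    by (rule measurable_restrict_space1)
  have fr: "finite_measure (restrict_space \<mu> C)"
    by (rule finite_measure_restrict_space) (use Cb fin in auto)
  show "finite_measure \<pi>" unfolding \<pi>_def
    by (rule finite_measure.finite_measure_distr[OF fr meas'])
  show "sets \<pi> = sets borel" by (simp add: \<pi>_def)
  show M: "measure \<pi> E = measure \<mu> {x \<in> C. (x - z) \<bullet> u \<in> E}" if "E \<in> sets borel" for E
  proof -
    have "measure \<pi> E = measure (restrict_space \<mu> C) ((\<lambda>x. (x - z) \<bullet> u) -` E \<inter> space (restrict_space \<mu> C))"
      unfolding \<pi>_def by (rule measure_distr[OF meas' that])
    also have "(\<lambda>x. (x - z) \<bullet> u) -` E \<inter> space (restrict_space \<mu> C) = {x \<in> C. (x - z) \<bullet> u \<in> E}"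
      by (auto simp: space_restrict_space sp)
    also have "measure (restrict_space \<mu> C) \<dots> = measure \<mu> {x \<in> C. (x - z) \<bullet> u \<in> E}"
      by (rule measure_restrict_space) (use Cb in auto)
    finally show ?thesis .
  qed
  show "s_concave s \<pi>"
    unfolding s_concave_def
  proof (intro allI impI, elim conjE)
    fix A B :: "real set" and \<alpha> :: real
    assume A: "compact A" and B: "compact B" and pos: "measure \<pi> A * measure \<pi> B > 0" and al: "0 \<le> \<alpha>" "\<alpha> \<le> 1"
    define lift where "lift = (\<lambda>E. {x \<in> C. (x - z) \<bullet> u \<in> E})"
    have lc: "compact (lift E)" if "compact E" for E
    proof -
      have "lift E = C \<inter> (\<lambda>x. (x - z) \<bullet> u) -` E" by (auto simp: lift_def)
      moreover have "closed ((\<lambda>x. (x - z) \<bullet> u) -` E)"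
        using compact_imp_closed[OF that] by (intro closed_vimage) (auto intro!: continuous_intros)
      ultimately show ?thesis using C by (simp add: compact_Int_closed)
    qed
    have bor: "E \<in> sets borel" if "compact E" for E :: "real set" using that by (simp add: borel_closed compact_imp_closed)
    let ?S = "{\<alpha> *\<^sub>R x + (1 - \<alpha>) *\<^sub>R y | x y. x \<in> A \<and> y \<in> B}"
    have "?S = (\<lambda>p. \<alpha> *\<^sub>R fst p + (1 - \<alpha>) *\<^sub>R snd p) ` (A \<times> B)" by force
    also have "compact \<dots>" by (intro compact_continuous_image compact_Times A B continuous_intros)
    finally have S: "compact ?S" .
    have MA: "measure \<pi> A = measure \<mu> (lift A)" "measure \<pi> B = measure \<mu> (lift B)" "measure \<pi> ?S = measure \<mu> (lift ?S)"
      using M bor A B S by (auto simp: lift_def)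
    have "measure \<mu> (lift A) > 0" "measure \<mu> (lift B) > 0"
      using pos unfolding MA by (auto simp: zero_less_mult_iff not_less measure_le_0_iff)
    then have "pmean s \<alpha> (measure \<mu> (lift A)) (measure \<mu> (lift B))
       \<le> measure \<mu> {\<alpha> *\<^sub>R x + (1 - \<alpha>) *\<^sub>R y | x y. x \<in> lift A \<and> y \<in> lift B}"
      by (intro s_concaveD[OF sc] lc A B al)
    also have "\<dots> \<le> measure \<mu> (lift ?S)"
    proof (rule finite_measure_mono)
      show "lift ?S \<in> sets \<mu>" using lc[OF S] sets by (simp add: borel_closed compact_imp_closed)
      show "{\<alpha> *\<^sub>R x + (1 - \<alpha>) *\<^sub>R y | x y. x \<in> lift A \<and> y \<in> lift B} \<subseteq> lift ?S"
      proof safe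
        fix x y assume xy: "x \<in> lift A" "y \<in> lift B"
        then have "\<alpha> *\<^sub>R x + (1 - \<alpha>) *\<^sub>R y \<in> C"
          using al C(2) by (auto simp: lift_def intro!: convexD)
        moreover have "(\<alpha> *\<^sub>R x + (1 - \<alpha>) *\<^sub>R y - z) \<bullet> u = \<alpha> *\<^sub>R ((x - z) \<bullet> u) + (1 - \<alpha>) *\<^sub>R ((y - z) \<bullet> u)"
          by (simp add: inner_simps algebra_simps)
        ultimately show "\<alpha> *\<^sub>R x + (1 - \<alpha>) *\<^sub>R y \<in> lift ?S"
          using xy unfolding lift_def by blast
      qed
    qed
    finally have mean: "pmean s \<alpha> (measure \<mu> (lift A)) (measure \<mu> (lift B)) \<le> measure \<mu> (lift ?S)" .
    show "(if s = 0 then measure \<pi> A powr \<alpha> * measure \<pi> B powr (1 - \<alpha>)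
           else (\<alpha> * measure \<pi> A powr s + (1 - \<alpha>) * measure \<pi> B powr s) powr (1 / s))
        \<le> measure \<pi> ?S"
      unfolding MA using mean unfolding pmean_def .
  qed
qed

text \<open>The normals of the cuts rotate in the plane of \<open>i\<close> and \<open>j\<close>. If some hyperplane has positive mass it
  has full mass and is itself the new body; otherwise the masses depend continuously on the angle.\<close>

lemma s_concave_bisect:
  fixes \<mu> :: "'a::euclidean_space measure"
  assumes fin: "finite_measure \<mu>" and sets: "sets \<mu> = sets borel" and sc: "s_concave s \<mu>"
    and s: "0 \<le> s" "s \<le> 1" and K: "K \<in> sets borel" and F: "F \<in> sets borel"
    and C: "compact C" "convex C" "0 < measure \<mu> C" "measure \<mu> (C \<inter> K) = r * measure \<mu> C"
      "measure \<mu> (C - F) < c * measure \<mu> C"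
    and ij: "i \<in> Basis" "j \<in> Basis" "i \<noteq> j"
  obtains C' a b where "C' \<subseteq> C" "compact C'" "convex C'" "0 < measure \<mu> C'" "measure \<mu> (C' \<inter> K) = r * measure \<mu> C'"
      "measure \<mu> (C' - F) < c * measure \<mu> C'"
      "a \<noteq> 0 \<or> b \<noteq> 0" "\<And>x. x \<in> C' \<Longrightarrow> 0 \<le> a * (x \<bullet> i - p) + b * (x \<bullet> j - q)"
proof -
  interpret finite_measure \<mu> by fact
  have sp: "space \<mu> = UNIV" using sets_eq_imp_space_eq[OF sets] by simp
  note [simp] = sets
  have [simp, measurable]: "C \<in> sets borel" using C by (simp add: borel_closed compact_imp_closed)
  note [simp, measurable] = K F
  \<comment> \<open>All these hyperplanes contain the codimension-two subspace on which the
    coordinates along i and j are p and q.\<close>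
  define A where "A = (\<lambda>\<phi>. cos \<phi> *\<^sub>R i + sin \<phi> *\<^sub>R j)"
  define B where "B = (\<lambda>\<phi>. cos \<phi> * p + sin \<phi> * q)"
  have l: "A \<phi> \<bullet> x - B \<phi> = cos \<phi> * (x \<bullet> i - p) + sin \<phi> * (x \<bullet> j - q)" for \<phi> x
    by (simp add: A_def B_def inner_add_left inner_commute algebra_simps)
  have trig: "cos \<phi> \<noteq> 0 \<or> sin \<phi> \<noteq> (0::real)" for \<phi>
    using sin_zero_abs_cos_one by fastforce
  show ?thesis
  proof (cases "\<exists>\<phi>. 0 < measure \<mu> {x. A \<phi> \<bullet> x = B \<phi>}")
    case True
    then obtain \<phi> where "0 < measure \<mu> {x. A \<phi> \<bullet> x = B \<phi>}" by blast
    then have null: "measure \<mu> (- {x. A \<phi> \<bullet> x = B \<phi>}) = 0"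
      by (rule s_concave_hyperplane_full[OF fin sets sc s])
    define H where "H = {x. A \<phi> \<bullet> x = B \<phi>}"
    have Hb [simp]: "H \<in> sets borel" unfolding H_def by (simp add: closed_hyperplane)
    have eq: "measure \<mu> (E \<inter> H) = measure \<mu> E" if "E \<in> sets borel" for E
    proof -
      have "measure \<mu> E = measure \<mu> (E \<inter> H) + measure \<mu> (E - H)"
        using finite_measure_Union[of "E \<inter> H" "E - H"] that
        by (metis Diff_Int_distrib2 Int_Diff_Un Int_Diff_disjoint Hb sets sets.Diff sets.Int)
      moreover have "measure \<mu> (E - H) \<le> measure \<mu> (- H)"
        by (rule finite_measure_mono) (auto intro: borel_comp)
      ultimately show ?thesis using null unfolding H_def[symmetric]
        by (metis add.right_neutral measure_le_0_iff)
    qed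
    have "C \<inter> H \<inter> K = (C \<inter> K) \<inter> H" "C \<inter> H - F = (C - F) \<inter> H" by auto
    then have W: "measure \<mu> (C \<inter> H \<inter> K) = r * measure \<mu> (C \<inter> H)" "measure \<mu> (C \<inter> H - F) < c * measure \<mu> (C \<inter> H)"
      "0 < measure \<mu> (C \<inter> H)"
      using C eq[of C] eq[of "C \<inter> K"] eq[of "C - F"] by auto
    show ?thesis
    proof (rule that[OF _ _ _ W(3) W(1) W(2) trig[of \<phi>]])
      show "compact (C \<inter> H)" "convex (C \<inter> H)"
        using C by (auto simp: H_def intro!: compact_Int_closed closed_hyperplane convex_Int convex_hyperplane)
      show "0 \<le> cos \<phi> * (x \<bullet> i - p) + sin \<phi> * (x \<bullet> j - q)" if "x \<in> C \<inter> H" for x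
        using that l[of \<phi> x] by (simp add: H_def)
    qed auto
  next
    case False
    then have null: "measure \<mu> {x. A \<phi> \<bullet> x = B \<phi>} = 0" for \<phi> by (simp add: not_less measure_le_0_iff)
    define P where "P = (\<lambda>\<phi>. {x. B \<phi> \<le> A \<phi> \<bullet> x})"
    have Pb [simp]: "P \<phi> \<in> sets borel" for \<phi> unfolding P_def by (simp add: closed_halfspace_ge)
    have cont: "continuous_on UNIV (\<lambda>\<phi>. measure \<mu> (E \<inter> P \<phi>))" if E [measurable]: "E \<in> sets borel" for E
    proof (unfold continuous_on_sequentially, safe)
      fix X :: "nat \<Rightarrow> real" and \<phi> assume X: "X \<longlonglongrightarrow> \<phi>"
      have "AE x in \<mu>. x \<notin> {x. A \<phi> \<bullet> x = B \<phi>}"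
        by (rule AE_not_in) (use null in \<open>simp add: null_sets_def emeasure_eq_measure closed_hyperplane\<close>)
      moreover have "(\<lambda>n. indicat_real (E \<inter> P (X n)) x) \<longlonglongrightarrow> indicat_real (E \<inter> P \<phi>) x"
        if ne: "x \<notin> {x. A \<phi> \<bullet> x = B \<phi>}" for x
      proof -
        have lim: "(\<lambda>n. A (X n) \<bullet> x - B (X n)) \<longlonglongrightarrow> A \<phi> \<bullet> x - B \<phi>"
          unfolding A_def B_def by (intro tendsto_intros X)
        consider "0 < A \<phi> \<bullet> x - B \<phi>" | "A \<phi> \<bullet> x - B \<phi> < 0" using ne by fastforce
        then have "\<forall>\<^sub>F n in sequentially. indicat_real (E \<inter> P (X n)) x = indicat_real (E \<inter> P \<phi>) x"
        proof cases
          case 1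
          from order_tendstoD(1)[OF lim 1] show ?thesis
            by eventually_elim (use 1 in \<open>auto simp: indicator_def P_def\<close>)
        next
          case 2
          from order_tendstoD(2)[OF lim 2] show ?thesis
            by eventually_elim (use 2 in \<open>auto simp: indicator_def P_def\<close>)
        qed
        then show ?thesis by (rule tendsto_eventually)
      qed
      ultimately have "AE x in \<mu>. (\<lambda>n. indicat_real (E \<inter> P (X n)) x) \<longlonglongrightarrow> indicat_real (E \<inter> P \<phi>) x"
        by (rule eventually_mono)
      then have "(\<lambda>n. LINT x|\<mu>. indicat_real (E \<inter> P (X n)) x) \<longlonglongrightarrow> (LINT x|\<mu>. indicat_real (E \<inter> P \<phi>) x)"
        by (intro integral_dominated_convergence[where w = "\<lambda>_. 1"]) (auto intro!: borel_measurable_indicator simp: measurable_cong_sets[OF sets refl] split: split_indicator)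
      then show "((\<lambda>\<phi>. measure \<mu> (E \<inter> P \<phi>)) \<circ> X) \<longlonglongrightarrow> measure \<mu> (E \<inter> P \<phi>)"
        by (simp add: o_def sp)
    qed
    \<comment> \<open>Turning the normal by pi gives the opposite closed half space; the common
      boundary is null.\<close>
    have split: "measure \<mu> E = measure \<mu> (E \<inter> P \<phi>) + measure \<mu> (E \<inter> P (\<phi> + pi))" if "E \<in> sets borel" for E \<phi>
    proof -
      have Pp: "P (\<phi> + pi) = {x. A \<phi> \<bullet> x \<le> B \<phi>}"
        by (auto simp: P_def A_def B_def inner_add_left algebra_simps)
      have "measure \<mu> E = measure \<mu> ((E \<inter> P \<phi>) \<union> (E - P \<phi>))" by (simp add: Int_Diff_Un)
      also have "\<dots> = measure \<mu> (E \<inter> P \<phi>) + measure \<mu> (E - P \<phi>)"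
        by (rule finite_measure_Union) (use that in auto)
      also have "measure \<mu> (E - P \<phi>) = measure \<mu> (E \<inter> P (\<phi> + pi))"
      proof (rule antisym)
        have "E - P \<phi> \<subseteq> E \<inter> P (\<phi> + pi)" unfolding Pp by (auto simp: P_def)
        then show "measure \<mu> (E - P \<phi>) \<le> measure \<mu> (E \<inter> P (\<phi> + pi))"
          by (rule finite_measure_mono) (use that in auto)
        have "E \<inter> P (\<phi> + pi) \<subseteq> (E - P \<phi>) \<union> {x. A \<phi> \<bullet> x = B \<phi>}" unfolding Pp by (auto simp: P_def)
        then have "measure \<mu> (E \<inter> P (\<phi> + pi)) \<le> measure \<mu> ((E - P \<phi>) \<union> {x. A \<phi> \<bullet> x = B \<phi>})"
          by (rule finite_measure_mono) (use that borel_closed[OF closed_hyperplane[of "A \<phi>" "B \<phi>"]] in \<open>auto intro!: sets.Un\<close>)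
        also have "\<dots> \<le> measure \<mu> (E - P \<phi>) + measure \<mu> {x. A \<phi> \<bullet> x = B \<phi>}"
          by (rule measure_Un_le) (use that in \<open>auto simp: closed_hyperplane\<close>)
        finally show "measure \<mu> (E \<inter> P (\<phi> + pi)) \<le> measure \<mu> (E - P \<phi>)" using null by simp
      qed
      finally show ?thesis .
    qed
    define G where "G = (\<lambda>\<phi>. measure \<mu> (C \<inter> K \<inter> P \<phi>) - r * measure \<mu> (C \<inter> P \<phi>))"
    have Gc: "continuous_on A G" for A
      unfolding G_def by (intro continuous_intros continuous_on_subset[OF cont]) auto
    \<comment> \<open>A half turn swaps the two halves, and C itself has proportion r, so G changes
      sign and has a zero. There both halves have proportion r.\<close>
    have Gpi: "G (\<phi> + pi) = - G \<phi>" for \<phi>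
      using split[of "C \<inter> K" \<phi>] split[of C \<phi>] C(4) unfolding G_def by (simp add: algebra_simps)
    have "\<exists>\<phi>. G \<phi> = 0"
    proof (cases "G 0 \<le> 0")
      case True
      then show ?thesis using IVT'[of G 0 0 pi] Gpi[of 0] Gc by auto
    next
      case False
      then show ?thesis using IVT2'[of G pi 0 0] Gpi[of 0] Gc by auto
    qed
    then obtain \<phi> where "G \<phi> = 0" by blast
    then have G: "G \<phi> = 0" "G (\<phi> + pi) = 0" using Gpi by auto
    \<comment> \<open>Both sides of the violated inequality are additive over the halves, so one
      half violates it too; strictness then forces that half to have positive mass.\<close>
    have "\<exists>\<psi>. G \<psi> = 0 \<and> measure \<mu> ((C - F) \<inter> P \<psi>) < c * measure \<mu> (C \<inter> P \<psi>)"
    proof (rule ccontr)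
      assume "\<not> ?thesis"
      then have "c * measure \<mu> (C \<inter> P \<psi>) \<le> measure \<mu> ((C - F) \<inter> P \<psi>)" if "G \<psi> = 0" for \<psi>
        using that by (meson not_less)
      from this[OF G(1)] this[OF G(2)] show False
        using split[of "C - F" \<phi>] split[of C \<phi>] C(5) by (simp add: algebra_simps)
    qed
    then obtain \<psi> where psi: "G \<psi> = 0" "measure \<mu> ((C - F) \<inter> P \<psi>) < c * measure \<mu> (C \<inter> P \<psi>)" by blast
    show ?thesis
    proof (rule that[of "C \<inter> P \<psi>" "cos \<psi>" "sin \<psi>"])
      show "compact (C \<inter> P \<psi>)" "convex (C \<inter> P \<psi>)"
        using C by (auto simp: P_def intro!: compact_Int_closed closed_halfspace_ge convex_Int convex_halfspace_ge)
      have "C \<inter> P \<psi> \<inter> K = C \<inter> K \<inter> P \<psi>" by auto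
      then show "measure \<mu> (C \<inter> P \<psi> \<inter> K) = r * measure \<mu> (C \<inter> P \<psi>)" using psi(1) by (simp add: G_def)
      have "C \<inter> P \<psi> - F = (C - F) \<inter> P \<psi>" by auto
      then show "measure \<mu> (C \<inter> P \<psi> - F) < c * measure \<mu> (C \<inter> P \<psi>)" using psi(2) by simp
      show "0 < measure \<mu> (C \<inter> P \<psi>)"
      proof (rule ccontr)
        assume "\<not> ?thesis"
        then have "measure \<mu> (C \<inter> P \<psi>) = 0" by (simp add: not_less measure_le_0_iff)
        then show False using psi(2) measure_nonneg[of \<mu> "(C - F) \<inter> P \<psi>"] by simp
      qed
      show "cos \<psi> \<noteq> 0 \<or> sin \<psi> \<noteq> 0" by (rule trig)
      show "0 \<le> cos \<psi> * (x \<bullet> i - p) + sin \<psi> * (x \<bullet> j - q)" if "x \<in> C \<inter> P \<psi>" for x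
        using that l[of \<psi> x] by (simp add: P_def)
    qed auto
  qed
qed

text \<open>If x0, x1, x2 had a nondegenerate triangle as shadow in some coordinate plane, a point p
  of D would lie inside it, and no line through p has all three vertices on one side. Hence all 2 by
  2 minors of the two difference vectors vanish.\<close>

lemma collinear_if_no_planar_shadow:
  fixes S :: "'a::euclidean_space set" and D :: "(real \<times> real) set"
  assumes D: "\<And>U. open U \<Longrightarrow> U \<noteq> {} \<Longrightarrow> \<exists>d\<in>D. d \<in> U"
    and cut: "\<And>i j p. i \<in> Basis \<Longrightarrow> j \<in> Basis \<Longrightarrow> i \<noteq> j \<Longrightarrow> p \<in> D \<Longrightarrow>
      \<exists>a b. (a \<noteq> 0 \<or> b \<noteq> 0) \<and> (\<forall>x\<in>S. 0 \<le> a * (x \<bullet> i - fst p) + b * (x \<bullet> j - snd p))"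
    and x: "x0 \<in> S" "x1 \<in> S" "x0 \<noteq> x1" "x2 \<in> S"
  obtains t where "x2 = x0 + t *\<^sub>R (x1 - x0)"
proof -
  define z where "z = x1 - x0"
  define y where "y = x2 - x0"
  have "(y \<bullet> i) * (z \<bullet> j) = (y \<bullet> j) * (z \<bullet> i)" if ij: "i \<in> Basis" "j \<in> Basis" for i j
  proof (rule ccontr)
    assume ne: "\<not> ?thesis"
    then have "i \<noteq> j" by auto
    define \<Delta> where "\<Delta> = (z \<bullet> i) * (y \<bullet> j) - (z \<bullet> j) * (y \<bullet> i)"
    have D0: "\<Delta> \<noteq> 0" using ne by (auto simp: \<Delta>_def algebra_simps)
    \<comment> \<open>By Cramer's rule, the coordinates of p relative to the origin x0 and the
      shadows of z and y. U is the open triangle with vertices the shadows of x0, x1, x2.\<close>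
    define \<beta> where "\<beta> = (\<lambda>p. ((fst p - x0 \<bullet> i) * (y \<bullet> j) - (snd p - x0 \<bullet> j) * (y \<bullet> i)) / \<Delta>)"
    define \<gamma> where "\<gamma> = (\<lambda>p. ((z \<bullet> i) * (snd p - x0 \<bullet> j) - (z \<bullet> j) * (fst p - x0 \<bullet> i)) / \<Delta>)"
    define U where "U = {p. 0 < \<beta> p} \<inter> {p. 0 < \<gamma> p} \<inter> {p. \<beta> p + \<gamma> p < 1}"
    have "open U" unfolding U_def \<beta>_def \<gamma>_def
      by (intro open_Int open_Collect_less continuous_intros) (use D0 in auto)
    moreover have "U \<noteq> {}"
    proof -
      define p where "p = (x0 \<bullet> i + (z \<bullet> i + y \<bullet> i) / 3, x0 \<bullet> j + (z \<bullet> j + y \<bullet> j) / 3)"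
      have "(fst p - x0 \<bullet> i) * (y \<bullet> j) - (snd p - x0 \<bullet> j) * (y \<bullet> i) = \<Delta> / 3"
        "(z \<bullet> i) * (snd p - x0 \<bullet> j) - (z \<bullet> j) * (fst p - x0 \<bullet> i) = \<Delta> / 3"
        by (simp_all add: p_def \<Delta>_def field_simps)
      then have "\<beta> p = (\<Delta> / 3) / \<Delta>" "\<gamma> p = (\<Delta> / 3) / \<Delta>"
        unfolding \<beta>_def \<gamma>_def by simp_all
      then have "\<beta> p = 1/3" "\<gamma> p = 1/3" using D0 by auto
      then have "p \<in> U" by (simp add: U_def)
      then show ?thesis by blast
    qed
    ultimately obtain p where p: "p \<in> D" "p \<in> U" using D by blast
    have rep: "\<beta> p * (z \<bullet> i) + \<gamma> p * (y \<bullet> i) = fst p - x0 \<bullet> i" "\<beta> p * (z \<bullet> j) + \<gamma> p * (y \<bullet> j) = snd p - x0 \<bullet> j"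
      unfolding \<beta>_def \<gamma>_def using D0
      by (simp_all add: divide_simps) (simp_all add: \<Delta>_def algebra_simps)
    obtain a b where ab: "a \<noteq> 0 \<or> b \<noteq> 0" "\<And>x. x \<in> S \<Longrightarrow> 0 \<le> a * (x \<bullet> i - fst p) + b * (x \<bullet> j - snd p)"
      using cut[OF ij \<open>i \<noteq> j\<close> p(1)] by blast
    define g where "g = (\<lambda>x. a * (x \<bullet> i - fst p) + b * (x \<bullet> j - snd p))"
    have g1: "g x1 = g x0 + (a * (z \<bullet> i) + b * (z \<bullet> j))" and g2: "g x2 = g x0 + (a * (y \<bullet> i) + b * (y \<bullet> j))"
      by (simp_all add: g_def z_def y_def inner_diff_left algebra_simps)
    have g0: "g x0 = - (\<beta> p * (a * (z \<bullet> i) + b * (z \<bullet> j)) + \<gamma> p * (a * (y \<bullet> i) + b * (y \<bullet> j)))"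
    proof -
      have "g x0 = - (a * (fst p - x0 \<bullet> i) + b * (snd p - x0 \<bullet> j))" by (simp add: g_def algebra_simps)
      then show ?thesis unfolding rep[symmetric] by (simp add: algebra_simps)
    qed
    have pos: "0 \<le> g x0" "0 \<le> g x1" "0 \<le> g x2" using ab(2) x by (auto simp: g_def)
    \<comment> \<open>The affine function g vanishes at p, a convex combination of the vertices with
      positive weights. Being nonnegative at the vertices it vanishes there, and (a, b) is
      orthogonal to two independent vectors.\<close>
    have sum: "(1 - \<beta> p - \<gamma> p) * g x0 + \<beta> p * g x1 + \<gamma> p * g x2 = 0"
      unfolding g1 g2 using g0 by (simp add: algebra_simps)
    have bg: "0 < \<beta> p" "0 < \<gamma> p" "0 < 1 - \<beta> p - \<gamma> p" using p(2) by (auto simp: U_def)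
    have "0 \<le> (1 - \<beta> p - \<gamma> p) * g x0" "0 \<le> \<beta> p * g x1" "0 \<le> \<gamma> p * g x2" using pos bg by auto
    then have "(1 - \<beta> p - \<gamma> p) * g x0 = 0" "\<beta> p * g x1 = 0" "\<gamma> p * g x2 = 0" using sum by linarith+
    then have "g x0 = 0" "g x1 = 0" "g x2 = 0" using bg by auto
    then have e: "a * (z \<bullet> i) + b * (z \<bullet> j) = 0" "a * (y \<bullet> i) + b * (y \<bullet> j) = 0" using g1 g2 by auto
    have "a * \<Delta> = (y \<bullet> j) * (a * (z \<bullet> i) + b * (z \<bullet> j)) - (z \<bullet> j) * (a * (y \<bullet> i) + b * (y \<bullet> j))"
      by (simp add: \<Delta>_def algebra_simps)
    moreover have "b * \<Delta> = (z \<bullet> i) * (a * (y \<bullet> i) + b * (y \<bullet> j)) - (y \<bullet> i) * (a * (z \<bullet> i) + b * (z \<bullet> j))"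
      by (simp add: \<Delta>_def algebra_simps)
    ultimately show False using e D0 ab(1) by simp
  qed note par = this
  have "z \<noteq> 0" using x by (simp add: z_def)
  then obtain i where i: "i \<in> Basis" "z \<bullet> i \<noteq> 0" using euclidean_eqI[of z 0] by auto
  have "y = ((y \<bullet> i) / (z \<bullet> i)) *\<^sub>R z"
    by (rule euclidean_eqI) (use par i in \<open>simp add: field_simps\<close>)
  then show ?thesis using that[of "(y \<bullet> i) / (z \<bullet> i)"] by (simp add: y_def z_def algebra_simps)
qed

text \<open>Recorded by parameters on the line, to be compared with projections. The closed
  inequality makes the set compact for compact S, and as \<epsilon> tends to 0 it shrinks to the
  section of S.\<close>

definition line_nbhd :: "'a::euclidean_space \<Rightarrow> 'a \<Rightarrow> 'a set \<Rightarrow> real \<Rightarrow> real set" where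
  "line_nbhd x0 u S \<epsilon> = {r. \<exists>x\<in>S. dist (x0 + r *\<^sub>R u) x \<le> \<epsilon>}"

lemma line_nbhd_mono: "\<epsilon> \<le> \<epsilon>' \<Longrightarrow> line_nbhd x0 u S \<epsilon> \<subseteq> line_nbhd x0 u S \<epsilon>'"
  by (force simp: line_nbhd_def)

lemma compact_line_nbhd:
  assumes "compact S" and u: "norm u = 1"
  shows "compact (line_nbhd x0 u S \<epsilon>)"
proof -
  let ?T = "{x + y | x y. x \<in> S \<and> y \<in> cball 0 \<epsilon>}"
  have T: "compact ?T" by (intro compact_sums assms compact_cball)
  have eq: "line_nbhd x0 u S \<epsilon> = (\<lambda>r. x0 + r *\<^sub>R u) -` ?T"
  proof (intro set_eqI iffI)
    fix r assume "r \<in> line_nbhd x0 u S \<epsilon>"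
    then obtain x where "x \<in> S" "dist (x0 + r *\<^sub>R u) x \<le> \<epsilon>" by (auto simp: line_nbhd_def)
    then have "x0 + r *\<^sub>R u = x + (x0 + r *\<^sub>R u - x)" "x \<in> S" "x0 + r *\<^sub>R u - x \<in> cball 0 \<epsilon>"
      by (simp_all add: mem_cball_0) (simp add: dist_norm)
    then show "r \<in> (\<lambda>r. x0 + r *\<^sub>R u) -` ?T" by blast
  next
    fix r assume "r \<in> (\<lambda>r. x0 + r *\<^sub>R u) -` ?T"
    then obtain x y where "x \<in> S" "norm y \<le> \<epsilon>" "x0 + r *\<^sub>R u = x + y" by auto
    then show "r \<in> line_nbhd x0 u S \<epsilon>" by (auto simp: line_nbhd_def dist_norm intro!: bexI[of _ x])
  qed
  have "closed (line_nbhd x0 u S \<epsilon>)"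
    unfolding eq by (intro closed_vimage compact_imp_closed T continuous_intros)
  moreover have "bounded (line_nbhd x0 u S \<epsilon>)"
  proof -
    obtain B where B: "\<And>x. x \<in> ?T \<Longrightarrow> norm x \<le> B"
      using compact_imp_bounded[OF T] unfolding bounded_iff by blast
    show ?thesis unfolding bounded_iff
    proof (intro exI ballI)
      fix r assume "r \<in> line_nbhd x0 u S \<epsilon>"
      then have "norm (x0 + r *\<^sub>R u) \<le> B" using B unfolding eq by blast
      moreover have "norm (r *\<^sub>R u) \<le> norm (x0 + r *\<^sub>R u) + norm x0"
        using norm_triangle_ineq4[of "x0 + r *\<^sub>R u" x0] by simp
      ultimately show "norm r \<le> B + norm x0" using u by simp
    qed
  qed
  ultimately show ?thesis by (simp add: compact_eq_bounded_closed)
qed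

lemma line_nbhd_limit:
  assumes S: "closed S" and q: "q \<longlonglongrightarrow> a" and e: "e \<longlonglongrightarrow> 0" and mem: "\<And>n. q n \<in> line_nbhd x0 u S (e n)"
  shows "x0 + a *\<^sub>R u \<in> S"
proof -
  obtain x where x: "\<And>n. x n \<in> S" "\<And>n. dist (x0 + q n *\<^sub>R u) (x n) \<le> e n"
    using mem unfolding line_nbhd_def mem_Collect_eq by metis
  have L: "(\<lambda>n. x0 + q n *\<^sub>R u) \<longlonglongrightarrow> x0 + a *\<^sub>R u" by (intro tendsto_intros q)
  have "(\<lambda>n. dist (x0 + q n *\<^sub>R u) (x n)) \<longlonglongrightarrow> 0"
    by (rule tendsto_sandwich[OF _ _ tendsto_const e]) (use x in auto)
  then have "(\<lambda>n. (x0 + q n *\<^sub>R u) - x n) \<longlonglongrightarrow> 0"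
    by (simp add: dist_norm tendsto_norm_zero_iff)
  from tendsto_diff[OF L this] have "x \<longlonglongrightarrow> x0 + a *\<^sub>R u" by simp
  then show ?thesis using closed_sequentially[OF S] x(1) by blast
qed

text \<open>Compactness: counterexamples for radii tending to 0 have endpoints converging to some a,
  b, with a in the section of K. If a and b differ, the length of F passes to the limit and
  contradicts \<theta> < \<theta>'; if a = b, points of F converge to a, against
  disjointness.\<close>

lemma dilation_property_line_nbhd:
  fixes K F :: "'a::euclidean_space set"
  assumes K: "compact K" and F: "compact F" and disj: "K \<inter> F = {}" and u: "norm u = 1"
    and P: "\<And>a b. x0 + a *\<^sub>R u \<in> K \<Longrightarrow> measure lborel {t \<in> closed_segment a b. x0 + t *\<^sub>R u \<in> F} \<le> \<theta> * \<bar>a - b\<bar>"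
    and th: "\<theta> < \<theta>'" "0 < \<theta>'"
  obtains \<epsilon> where "0 < \<epsilon>" "line_nbhd x0 u K \<epsilon> \<inter> line_nbhd x0 u F \<epsilon> = {}"
    "\<And>r r'. r \<in> line_nbhd x0 u K \<epsilon> \<Longrightarrow> measure lborel (line_nbhd x0 u F \<epsilon> \<inter> closed_segment r r') \<le> \<theta>' * \<bar>r - r'\<bar>"
proof (rule ccontr)
  assume "\<not> thesis"
  then have neg: "\<not> (0 < \<epsilon> \<and> line_nbhd x0 u K \<epsilon> \<inter> line_nbhd x0 u F \<epsilon> = {} \<and>
      (\<forall>r r'. r \<in> line_nbhd x0 u K \<epsilon> \<longrightarrow> measure lborel (line_nbhd x0 u F \<epsilon> \<inter> closed_segment r r') \<le> \<theta>' * \<bar>r - r'\<bar>))" for \<epsilon>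
    using that[of \<epsilon>] \<open>\<not> thesis\<close> by metis
  let ?k = "line_nbhd x0 u K" and ?f = "line_nbhd x0 u F"
  have tc: "compact (?k e)" "compact (?f e)" for e using compact_line_nbhd K F u by auto
  have [measurable]: "?f e \<in> sets borel" for e using tc by (simp add: borel_closed compact_imp_closed)
  obtain d where d: "d > 0" "\<And>x y. x \<in> K \<Longrightarrow> y \<in> F \<Longrightarrow> d \<le> dist x y"
    using separate_compact_closed[OF K compact_imp_closed[OF F] disj] by blast
  \<comment> \<open>Neighbourhoods of radius at most d/3 cannot meet, so the failure for radius e n
    lies in the density bound.\<close>
  define e where "e = (\<lambda>n. (d / 3) / real (Suc n))"
  have e: "0 < e n" "e n \<le> d / 3" for n using d by (auto simp: e_def field_simps)
  have elim: "e \<longlonglongrightarrow> 0" unfolding e_def by (intro LIMSEQ_Suc lim_const_over_n)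
  have emono: "e n \<le> e m" if "m \<le> n" for m n
    unfolding e_def using that d by (intro divide_left_mono) auto
  have "?k (e n) \<inter> ?f (e n) = {}" for n
  proof (rule ccontr)
    assume "?k (e n) \<inter> ?f (e n) \<noteq> {}"
    then obtain r x y where "x \<in> K" "y \<in> F" "dist (x0 + r *\<^sub>R u) x \<le> e n" "dist (x0 + r *\<^sub>R u) y \<le> e n"
      by (auto simp: line_nbhd_def)
    then show False using d(2)[of x y] d(1) e(2)[of n] dist_triangle3[of x y "x0 + r *\<^sub>R u"]
      by linarith
  qed
  then have bad: "\<exists>r r'. r \<in> ?k (e n) \<and> \<theta>' * \<bar>r - r'\<bar> < measure lborel (?f (e n) \<inter> closed_segment r r')" for n
    using neg[of "e n"] e(1)[of n] by (auto simp: not_le)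
  have "bounded (?k (d/3) \<union> ?f (d/3))" using tc by (simp add: compact_imp_bounded)
  then obtain B where B: "\<And>r. r \<in> ?k (d/3) \<union> ?f (d/3) \<Longrightarrow> \<bar>r\<bar> \<le> B" by (auto simp: bounded_real)
  have sub: "?k (e n) \<subseteq> ?k (d/3)" "?f (e n) \<subseteq> ?f (d/3)" for n using line_nbhd_mono e(2) by metis+
  have finite_seg: "E \<inter> closed_segment r r' \<in> fmeasurable lborel" if "E \<in> sets borel" for E and r r' :: real
    using that emeasure_bounded_finite[of "E \<inter> closed_segment r r'"]
    by (intro fmeasurableI) (auto simp: bounded_Int bounded_closed_segment closed_segment_eq_real_ivl)
  have "\<exists>r r'. r \<in> ?k (e n) \<and> r' \<in> {-B..B} \<and> \<theta>' * \<bar>r - r'\<bar> < measure lborel (?f (e n) \<inter> closed_segment r r')" for n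
  proof -
    obtain r r' where r: "r \<in> ?k (e n)" "\<theta>' * \<bar>r - r'\<bar> < measure lborel (?f (e n) \<inter> closed_segment r r')"
      using bad by blast
    have rB: "\<bar>r\<bar> \<le> B" using r sub B by blast
    \<comment> \<open>Clamping r' to {-B..B} loses nothing of the neighbourhood of F and does not
      lengthen the segment, so the counterexample persists with bounded endpoints.\<close>
    define r'' where "r'' = max (-B) (min B r')"
    have "?f (e n) \<inter> closed_segment r r' \<subseteq> ?f (e n) \<inter> closed_segment r r''"
    proof
      fix q assume q: "q \<in> ?f (e n) \<inter> closed_segment r r'"
      then have "\<bar>q\<bar> \<le> B" using sub B by blast
      then show "q \<in> ?f (e n) \<inter> closed_segment r r''"
        using q rB by (auto simp: closed_segment_eq_real_ivl r''_def split: if_splits)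
    qed
    then have "measure lborel (?f (e n) \<inter> closed_segment r r') \<le> measure lborel (?f (e n) \<inter> closed_segment r r'')"
      by (rule measure_mono_fmeasurable) (auto intro: finite_seg)
    moreover have "\<theta>' * \<bar>r - r''\<bar> \<le> \<theta>' * \<bar>r - r'\<bar>"
      using th rB by (intro mult_left_mono) (auto simp: r''_def)
    moreover have "r'' \<in> {-B..B}" using rB by (auto simp: r''_def)
    ultimately show ?thesis using r by (intro exI[of _ r] exI[of _ r'']) auto
  qed
  then obtain r r' where r: "\<And>n. r n \<in> ?k (e n)" "\<And>n. r' n \<in> {-B..B}"
    "\<And>n. \<theta>' * \<bar>r n - r' n\<bar> < measure lborel (?f (e n) \<inter> closed_segment (r n) (r' n))"
    by metis
  have rB: "(r n, r' n) \<in> {-B..B} \<times> {-B..B}" for n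
  proof -
    have "\<bar>r n\<bar> \<le> B" using r(1)[of n] sub B by blast
    then show ?thesis using r(2)[of n] by auto
  qed
  have "seq_compact ({-B..B} \<times> {-B..B})"
    by (intro compact_imp_seq_compact compact_Times compact_Icc)
  then obtain l \<phi> where \<phi>: "strict_mono (\<phi> :: nat \<Rightarrow> nat)" "((\<lambda>n. (r n, r' n)) \<circ> \<phi>) \<longlonglongrightarrow> l"
    using rB by (elim seq_compactE[where f = "\<lambda>n. (r n, r' n)"]) auto
  define a b where "a = fst l" and "b = snd l"
  have ra: "(\<lambda>n. r (\<phi> n)) \<longlonglongrightarrow> a" and rb: "(\<lambda>n. r' (\<phi> n)) \<longlonglongrightarrow> b"
    using tendsto_fst[OF \<phi>(2)] tendsto_snd[OF \<phi>(2)] by (simp_all add: a_def b_def o_def)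
  have e\<phi>: "(\<lambda>n. e (\<phi> n)) \<longlonglongrightarrow> 0"
    using LIMSEQ_subseq_LIMSEQ[OF elim \<phi>(1)] by (simp add: o_def)
  have aK: "x0 + a *\<^sub>R u \<in> K"
    by (rule line_nbhd_limit[OF compact_imp_closed[OF K] ra e\<phi>]) (rule r(1))
  show False
  proof (cases "a = b")
    case True
    have "\<exists>q. q \<in> ?f (e n) \<inter> closed_segment (r n) (r' n)" for n
    proof (rule ccontr)
      assume "\<not> ?thesis"
      then have em: "?f (e n) \<inter> closed_segment (r n) (r' n) = {}" by blast
      have "0 \<le> \<theta>' * \<bar>r n - r' n\<bar>" using th by simp
      then show False using r(3)[of n] unfolding em by simp
    qed
    then obtain q where q: "\<And>n. q n \<in> ?f (e n)" "\<And>n. q n \<in> closed_segment (r n) (r' n)" by (metis IntE)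
    have qr: "\<bar>q n - r n\<bar> \<le> \<bar>r' n - r n\<bar>" for n
      using q(2)[of n] by (auto simp: closed_segment_eq_real_ivl split: if_splits)
    have "(\<lambda>n. q (\<phi> n) - r (\<phi> n)) \<longlonglongrightarrow> 0"
    proof (rule Lim_null_comparison)
      show "\<forall>\<^sub>F n in sequentially. norm (q (\<phi> n) - r (\<phi> n)) \<le> \<bar>r' (\<phi> n) - r (\<phi> n)\<bar>"
        using qr by simp
      have "(\<lambda>n. r' (\<phi> n) - r (\<phi> n)) \<longlonglongrightarrow> b - a" by (intro tendsto_diff ra rb)
      then show "(\<lambda>n. \<bar>r' (\<phi> n) - r (\<phi> n)\<bar>) \<longlonglongrightarrow> 0" using True by (simp add: tendsto_rabs_zero)
    qed
    from tendsto_add[OF this ra] have "(\<lambda>n. q (\<phi> n)) \<longlonglongrightarrow> a" by simp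
    then have "x0 + a *\<^sub>R u \<in> F"
      by (rule line_nbhd_limit[OF compact_imp_closed[OF F] _ e\<phi>]) (rule q(1))
    then show False using aK disj by auto
  next
    case False
    \<comment> \<open>The radius is frozen at e m while the endpoints converge, at the cost of their
      distances to a and b; afterwards m grows and the neighbourhoods shrink to the section of
      F.\<close>
    have "\<theta>' * \<bar>a - b\<bar> \<le> measure lborel (?f (e m) \<inter> closed_segment a b)" for m
    proof -
      have "\<theta>' * \<bar>r n - r' n\<bar> \<le> measure lborel (?f (e m) \<inter> closed_segment a b) + \<bar>r n - a\<bar> + \<bar>r' n - b\<bar>"
        if "m \<le> n" for n
      proof -
        let ?G = "?f (e m) \<inter> closed_segment a b"
        have "?f (e n) \<inter> closed_segment (r n) (r' n) \<subseteq> (?G \<union> closed_segment a (r n)) \<union> closed_segment b (r' n)"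
          using line_nbhd_mono[OF emono[OF that], of x0 u F]
          by (auto simp: closed_segment_eq_real_ivl split: if_splits)
        then have "measure lborel (?f (e n) \<inter> closed_segment (r n) (r' n))
            \<le> measure lborel ((?G \<union> closed_segment a (r n)) \<union> closed_segment b (r' n))"
          by (rule measure_mono_fmeasurable)
             (use finite_seg[of UNIV] finite_seg in \<open>auto intro!: fmeasurable.Un\<close>)
        also have "\<dots> \<le> measure lborel ?G + measure lborel (closed_segment a (r n)) + measure lborel (closed_segment b (r' n))"
          by (intro order_trans[OF measure_Un_le] add_right_mono) (auto simp: closed_segment_eq_real_ivl)
        also have "measure lborel (closed_segment a (r n)) = \<bar>r n - a\<bar>"
          by (auto simp: closed_segment_eq_real_ivl)
        also have "measure lborel (closed_segment b (r' n)) = \<bar>r' n - b\<bar>"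
          by (auto simp: closed_segment_eq_real_ivl)
        finally show ?thesis using r(3)[of n] by simp
      qed
      then have "\<forall>\<^sub>F n in sequentially. \<theta>' * \<bar>r (\<phi> n) - r' (\<phi> n)\<bar>
          \<le> measure lborel (?f (e m) \<inter> closed_segment a b) + \<bar>r (\<phi> n) - a\<bar> + \<bar>r' (\<phi> n) - b\<bar>"
        using le_trans[OF _ seq_suble[OF \<phi>(1)]] by (intro eventually_sequentiallyI[of m]) blast
      moreover have "(\<lambda>n. \<theta>' * \<bar>r (\<phi> n) - r' (\<phi> n)\<bar>) \<longlonglongrightarrow> \<theta>' * \<bar>a - b\<bar>"
        by (intro tendsto_intros ra rb)
      moreover have "(\<lambda>n. measure lborel (?f (e m) \<inter> closed_segment a b) + \<bar>r (\<phi> n) - a\<bar> + \<bar>r' (\<phi> n) - b\<bar>)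
          \<longlonglongrightarrow> measure lborel (?f (e m) \<inter> closed_segment a b) + \<bar>a - a\<bar> + \<bar>b - b\<bar>"
        by (intro tendsto_intros ra rb)
      ultimately have "\<theta>' * \<bar>a - b\<bar> \<le> measure lborel (?f (e m) \<inter> closed_segment a b) + \<bar>a - a\<bar> + \<bar>b - b\<bar>"
        by (intro tendsto_le[of sequentially]) auto
      then show ?thesis by simp
    qed
    moreover have "(\<lambda>m. measure lborel (?f (e m) \<inter> closed_segment a b)) \<longlonglongrightarrow> measure lborel (\<Inter>m. ?f (e m) \<inter> closed_segment a b)"
    proof (rule Lim_measure_decseq)
      show "decseq (\<lambda>m. ?f (e m) \<inter> closed_segment a b)"
        unfolding decseq_def using line_nbhd_mono[OF emono] by blast
      show "emeasure lborel (?f (e m) \<inter> closed_segment a b) \<noteq> \<infinity>" for m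
        using finite_seg[of "?f (e m)" a b] by (auto simp: fmeasurable_def)
    qed (auto simp: closed_segment_eq_real_ivl)
    ultimately have "\<theta>' * \<bar>a - b\<bar> \<le> measure lborel (\<Inter>m. ?f (e m) \<inter> closed_segment a b)"
      by (intro LIMSEQ_le_const) auto
    also have "(\<Inter>m. ?f (e m) \<inter> closed_segment a b) = {t \<in> closed_segment a b. x0 + t *\<^sub>R u \<in> F}"
    proof safe
      fix t assume t: "t \<in> (\<Inter>m. ?f (e m) \<inter> closed_segment a b)"
      then show "x0 + t *\<^sub>R u \<in> F"
        by (intro line_nbhd_limit[OF compact_imp_closed[OF F] tendsto_const elim]) auto
    next
      fix t n assume "x0 + t *\<^sub>R u \<in> F"
      then show "t \<in> ?f (e n)" using e(1)[of n] by (auto simp: line_nbhd_def intro!: bexI[of _ "x0 + t *\<^sub>R u"])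
    qed auto
    also have "measure lborel \<dots> \<le> \<theta> * \<bar>a - b\<bar>" by (rule P[OF aK])
    finally show False using th False by (simp add: mult_le_cancel_right)
  qed
qed

text \<open>Points of C are within \<epsilon> of their projections, so C \<inter> K projects into
  the \<epsilon>-neighbourhood of K, and a point of C projecting outside that of F is not in F. The
  density condition at radius 2 \<epsilon> leaves another \<epsilon> for the smoothing in
  \<open>s_concave_dilation_line\<close>.\<close>

lemma s_concave_needle:
  fixes \<mu> :: "'a::euclidean_space measure"
  assumes fin: "finite_measure \<mu>" and sets: "sets \<mu> = sets borel" and sc: "s_concave s \<mu>"
    and s: "0 \<le> s" "s \<le> 1" and th: "0 < \<theta>" "\<theta> < 1" and K: "compact K" and F: "compact F"
    and C: "compact C" "convex C" "0 < measure \<mu> C" "measure \<mu> (C \<inter> K) = r * measure \<mu> C" and r: "0 < r"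
    and u: "norm u = 1" and e: "0 < \<epsilon>"
    and near: "\<And>x. x \<in> C \<Longrightarrow> dist (x0 + ((x - x0) \<bullet> u) *\<^sub>R u) x \<le> \<epsilon>"
    and disj: "line_nbhd x0 u K (2 * \<epsilon>) \<inter> line_nbhd x0 u F (2 * \<epsilon>) = {}"
    and P: "\<And>r r'. r \<in> line_nbhd x0 u K (2 * \<epsilon>) \<Longrightarrow> measure lborel (line_nbhd x0 u F (2 * \<epsilon>) \<inter> closed_segment r r') \<le> \<theta> * \<bar>r - r'\<bar>"
  shows "pmean s \<theta> r 1 * measure \<mu> C \<le> measure \<mu> (C - F)"
proof -
  interpret finite_measure \<mu> by fact
  have th': "0 \<le> \<theta>" "\<theta> \<le> 1" using th by auto
  define \<pi> where "\<pi> = distr (restrict_space \<mu> C) borel (\<lambda>x. (x - x0) \<bullet> u)"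
  note pi = s_concave_projection[OF fin sets sc C(1,2), where z = x0 and u = u, folded \<pi>_def]
  have bor: "E \<in> sets borel" if "compact E" for E :: "'b::euclidean_space set"
    using that by (simp add: borel_closed compact_imp_closed)
  have tb: "line_nbhd x0 u K \<epsilon> \<in> sets borel" "line_nbhd x0 u F \<epsilon> \<in> sets borel"
    using bor compact_line_nbhd K F u by blast+
  have total: "measure \<pi> UNIV = measure \<mu> C" using pi(4)[of UNIV] by simp
  have tri: "y \<in> line_nbhd x0 u S (2 * \<epsilon>)" if xt: "x \<in> line_nbhd x0 u S \<epsilon>" and yx: "\<bar>y - x\<bar> \<le> \<epsilon>" for x y S
  proof -
    obtain z where z: "z \<in> S" "dist (x0 + x *\<^sub>R u) z \<le> \<epsilon>" using xt by (auto simp: line_nbhd_def)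
    have "dist (x0 + y *\<^sub>R u) (x0 + x *\<^sub>R u) = \<bar>y - x\<bar>"
      using u by (simp add: dist_norm scaleR_diff_left[symmetric])
    then have "dist (x0 + y *\<^sub>R u) z \<le> 2 * \<epsilon>"
      using dist_triangle[of "x0 + y *\<^sub>R u" z "x0 + x *\<^sub>R u"] z yx by linarith
    then show ?thesis using z by (auto simp: line_nbhd_def)
  qed
  have "bounded ((\<lambda>x. (x - x0) \<bullet> u) ` C)"
    by (intro compact_imp_bounded compact_continuous_image C continuous_intros)
  then obtain R where R: "\<And>x. x \<in> C \<Longrightarrow> \<bar>(x - x0) \<bullet> u\<bar> \<le> R" by (auto simp: bounded_real)
  have supp: "measure \<pi> (- {-R..R}) = 0"
  proof -
    have E: "{x \<in> C. (x - x0) \<bullet> u \<in> - {-R..R}} = {}" using R by (force simp: abs_le_iff)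
    have "measure \<pi> (- {-R..R}) = measure \<mu> {x \<in> C. (x - x0) \<bullet> u \<in> - {-R..R}}"
      by (rule pi(4)) (rule borel_comp, simp)
    then show ?thesis by (simp only: E measure_empty)
  qed
  have mem: "(x - x0) \<bullet> u \<in> line_nbhd x0 u S \<epsilon>" if "x \<in> C" "x \<in> S" for x S
    using near[of x] that by (auto simp: line_nbhd_def)
  have vm: "{x \<in> C. (x - x0) \<bullet> u \<in> E} \<in> sets \<mu>" if "E \<in> sets borel" for E
  proof -
    have "{x \<in> C. (x - x0) \<bullet> u \<in> E} = C \<inter> ((\<lambda>x. (x - x0) \<bullet> u) -` E \<inter> space borel)" by auto
    also have "\<dots> \<in> sets borel" by (intro sets.Int bor C measurable_sets[OF _ that]) measurable
    finally show ?thesis using sets by simp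
  qed
  have Kle: "r * measure \<mu> C \<le> measure \<pi> (line_nbhd x0 u K \<epsilon>)"
    unfolding C(4)[symmetric] pi(4)[OF tb(1)] by (rule finite_measure_mono) (use mem vm tb in auto)
  have pos: "0 < measure \<pi> (line_nbhd x0 u K \<epsilon>)"
    using Kle mult_pos_pos[OF r C(3)] by linarith
  have "pmean s \<theta> r 1 * measure \<mu> C = pmean s \<theta> (measure \<mu> C * r) (measure \<mu> C * 1)"
    using pmean_scale[OF s th', of "measure \<mu> C" r 1] r by simp
  also have "\<dots> \<le> pmean s \<theta> (measure \<pi> (line_nbhd x0 u K \<epsilon>)) (measure \<pi> UNIV)"
    using Kle r total by (intro pmean_mono[OF s th']) (auto simp: mult.commute)
  also have "\<dots> \<le> measure \<pi> (- line_nbhd x0 u F \<epsilon>)"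
    by (rule s_concave_dilation_line[OF pi(1-3) s th supp compact_line_nbhd[OF K u] compact_line_nbhd[OF F u] disj P e tb(1) _ tb(2) _ pos])
       (auto intro: tri)
  also have "\<dots> \<le> measure \<mu> (C - F)"
  proof -
    have "measure \<pi> (- line_nbhd x0 u F \<epsilon>) = measure \<mu> {x \<in> C. (x - x0) \<bullet> u \<in> - line_nbhd x0 u F \<epsilon>}"
      by (rule pi(4)) (use tb in \<open>auto intro: borel_comp\<close>)
    also have "\<dots> \<le> measure \<mu> (C - F)"
      by (rule finite_measure_mono) (use mem bor[OF C(1)] bor[OF F] sets in auto)
    finally show ?thesis .
  qed
  finally show ?thesis .
qed

theorem s_concave_dilation:
  fixes \<mu> :: "'a::euclidean_space measure"
  assumes prob: "prob_space \<mu>" and sets: "sets \<mu> = sets borel" and sc: "s_concave s \<mu>"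
    and s: "0 \<le> s" "s \<le> 1" and th: "0 < \<theta>" "\<theta> < 1"
    and K: "compact K" and F: "compact F" and disj: "K \<inter> F = {}"
    and P: "\<And>x u a b. norm u = 1 \<Longrightarrow> x + a *\<^sub>R u \<in> K \<Longrightarrow>
      measure lborel {t \<in> closed_segment a b. x + t *\<^sub>R u \<in> F} \<le> \<theta> * \<bar>a - b\<bar>"
    and pos: "0 < measure \<mu> K"
  shows "pmean s \<theta> (measure \<mu> K) 1 \<le> measure \<mu> (- F)"
proof (rule ccontr)
  assume "\<not> ?thesis"
  then have viol: "measure \<mu> (- F) < pmean s \<theta> (measure \<mu> K) 1" by simp
  interpret prob_space \<mu> by fact
  have fin: "finite_measure \<mu>" by (rule finite_measure_axioms)
  have sp: "space \<mu> = UNIV" using sets_eq_imp_space_eq[OF sets] by simp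
  have bor: "E \<in> sets borel" if "compact E" for E :: "'a set"
    using that by (simp add: borel_closed compact_imp_closed)
  \<comment> \<open>Room for the neighbourhoods of the sections, taken from the strict violation by
    continuity in the weight.\<close>
  obtain \<theta>' where th': "\<theta> < \<theta>'" "\<theta>' < 1" "measure \<mu> (- F) < pmean s \<theta>' (measure \<mu> K) 1"
  proof -
    have "((\<lambda>t. pmean s t (measure \<mu> K) 1) \<longlongrightarrow> pmean s \<theta> (measure \<mu> K) 1) (at_right \<theta>)"
      by (rule tendsto_pmean) (use s th pos in auto)
    from order_tendstoD(1)[OF this viol]
    have "\<forall>\<^sub>F t in at_right \<theta>. measure \<mu> (- F) < pmean s t (measure \<mu> K) 1" .
    moreover have "\<forall>\<^sub>F t in at_right \<theta>. t \<in> {\<theta><..<1}"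
      by (rule eventually_at_right_real[OF th(2)])
    ultimately have "\<forall>\<^sub>F t in at_right \<theta>. \<theta> < t \<and> t < 1 \<and> measure \<mu> (- F) < pmean s t (measure \<mu> K) 1"
      by eventually_elim auto
    then show ?thesis using that eventually_happens'[OF trivial_limit_at_right_real] by blast
  qed
  have t01: "0 < \<theta>'" "0 \<le> \<theta>'" "\<theta>' \<le> 1" using th th' by auto
  \<comment> \<open>The nested bodies must be compact. A large ball carries nearly all the mass, and
    the violation survives the small change of the second argument.\<close>
  obtain C0 where C0: "compact C0" "convex C0" "K \<union> F \<subseteq> C0" "measure \<mu> (- F) < pmean s \<theta>' (measure \<mu> K) (measure \<mu> C0)"
  proof -
    have "bounded (K \<union> F)" using K F by (simp add: compact_imp_bounded)
    then obtain N where "\<forall>x\<in>K \<union> F. norm x \<le> N" unfolding bounded_iff by blast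
    then have N: "K \<union> F \<subseteq> cball 0 N" by (auto simp: mem_cball_0)
    define b where "b = (\<lambda>n. cball (0::'a) (real n))"
    have "(\<lambda>n. measure \<mu> (b n)) \<longlonglongrightarrow> measure \<mu> (\<Union>n. b n)"
      by (rule finite_Lim_measure_incseq) (auto simp: b_def sets incseq_def)
    moreover have "(\<Union>n. b n) = UNIV" using real_arch_simple by (auto simp: b_def)
    ultimately have "(\<lambda>n. measure \<mu> (b n)) \<longlonglongrightarrow> 1" using prob_space sp by simp
    then have "(\<lambda>n. pmean s \<theta>' (measure \<mu> K) (measure \<mu> (b n))) \<longlonglongrightarrow> pmean s \<theta>' (measure \<mu> K) 1"
      by (intro tendsto_pmean) (use s t01 pos in auto)
    from order_tendstoD(1)[OF this th'(3)] have "\<forall>\<^sub>F n in sequentially. measure \<mu> (- F) < pmean s \<theta>' (measure \<mu> K) (measure \<mu> (b n))" .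
    moreover have "\<forall>\<^sub>F n in sequentially. N \<le> real n"
      by (meson eventually_sequentiallyI nat_ceiling_le_eq)
    ultimately have "\<forall>\<^sub>F n in sequentially. N \<le> real n \<and> measure \<mu> (- F) < pmean s \<theta>' (measure \<mu> K) (measure \<mu> (b n))"
      by eventually_elim auto
    then obtain n where n: "N \<le> real n" "measure \<mu> (- F) < pmean s \<theta>' (measure \<mu> K) (measure \<mu> (b n))"
      using eventually_happens'[OF sequentially_bot] by blast
    have "cball (0::'a) N \<subseteq> b n" using n(1) by (auto simp: b_def)
    then show ?thesis using n N by (intro that[of "b n"]) (auto simp: b_def)
  qed
  have C0K: "measure \<mu> K \<le> measure \<mu> C0"
    by (rule finite_measure_mono) (use C0 bor sets in auto)
  then have C0pos: "0 < measure \<mu> C0" using pos by simp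
  define r where "r = measure \<mu> K / measure \<mu> C0"
  have r: "0 < r" using pos C0pos by (simp add: r_def)
  \<comment> \<open>By homogeneity the mean for a body C with proportion r of K is c times \<mu>(C);
    \<open>W\<close> records the violation in this form.\<close>
  define c where "c = pmean s \<theta>' r 1"
  define W where "W = (\<lambda>C. compact C \<and> convex C \<and> 0 < measure \<mu> C \<and> measure \<mu> (C \<inter> K) = r * measure \<mu> C
     \<and> measure \<mu> (C - F) < c * measure \<mu> C)"
  have W0: "W C0"
  proof -
    have "measure \<mu> (C0 - F) \<le> measure \<mu> (- F)"
      by (rule finite_measure_mono) (use bor F sets in \<open>auto intro: borel_comp\<close>)
    also have "\<dots> < pmean s \<theta>' (measure \<mu> C0 * r) (measure \<mu> C0 * 1)" using C0(4) C0pos by (simp add: r_def)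
    also have "\<dots> = c * measure \<mu> C0" using pmean_scale[OF s t01(2,3), of "measure \<mu> C0" r 1] r
      by (simp add: c_def)
    finally have "measure \<mu> (C0 - F) < c * measure \<mu> C0" .
    moreover have "C0 \<inter> K = K" using C0 by auto
    ultimately show ?thesis using C0 C0pos by (simp add: W_def r_def)
  qed
  obtain D :: "(real \<times> real) set" where D: "countable D" "\<And>U. open U \<Longrightarrow> U \<noteq> {} \<Longrightarrow> \<exists>d\<in>D. d \<in> U"
    using countable_dense_exists[where 'a = "real \<times> real"] by metis
  \<comment> \<open>One index for each pair of axes and each point of a countable dense subset of
    the plane. The inserted \<open>undefined\<close> makes \<open>J\<close> visibly nonempty for
    \<open>from_nat_into\<close>; \<open>cut\<close> is vacuous unless the axes are distinct basis
    vectors.\<close>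
  define J where "J = insert undefined ((Basis \<times> Basis) \<times> D :: (('a \<times> 'a) \<times> (real \<times> real)) set)"
  have "countable ((Basis :: 'a set) \<times> (Basis :: 'a set))" by (intro countable_finite finite_cartesian_product finite_Basis)
  then have J: "countable J" "J \<noteq> {}" using D by (auto simp: J_def)
  define cut :: "('a \<times> 'a) \<times> (real \<times> real) \<Rightarrow> 'a set \<Rightarrow> bool" where "cut = (\<lambda>k C. case k of ((i, j), p) \<Rightarrow> i \<in> Basis \<longrightarrow> j \<in> Basis \<longrightarrow> i \<noteq> j \<longrightarrow>
     (\<exists>a b. (a \<noteq> 0 \<or> b \<noteq> 0) \<and> (\<forall>x\<in>C. 0 \<le> a * (x \<bullet> i - fst p) + b * (x \<bullet> j - snd p))))"
  have step: "\<exists>C'. W C' \<and> C' \<subseteq> C \<and> cut k C'" if "W C" for C k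
  proof -
    define i j p q where "i = fst (fst k)" and "j = snd (fst k)" and "p = fst (snd k)" and "q = snd (snd k)"
    then have k: "k = ((i, j), (p, q))" by simp
    have WC: "compact C" "convex C" "0 < measure \<mu> C" "measure \<mu> (C \<inter> K) = r * measure \<mu> C"
      "measure \<mu> (C - F) < c * measure \<mu> C" using that by (auto simp: W_def)
    show ?thesis
    proof (cases "i \<in> Basis \<and> j \<in> Basis \<and> i \<noteq> j")
      case False
      then show ?thesis using that k by (intro exI[of _ C]) (auto simp: cut_def)
    next
      case True
      obtain C' a b where "C' \<subseteq> C" "compact C'" "convex C'" "0 < measure \<mu> C'" "measure \<mu> (C' \<inter> K) = r * measure \<mu> C'"
        "measure \<mu> (C' - F) < c * measure \<mu> C'"
        "a \<noteq> 0 \<or> b \<noteq> 0" "\<And>x. x \<in> C' \<Longrightarrow> 0 \<le> a * (x \<bullet> i - p) + b * (x \<bullet> j - q)"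
        by (rule s_concave_bisect[OF fin sets sc s bor[OF K] bor[OF F] WC, of i j p q]) (use True in auto)
      then show ?thesis using k unfolding W_def cut_def by (intro exI[of _ C']) auto
    qed
  qed
  obtain C where C: "\<And>n. W (C n)" "\<And>n. C (Suc n) \<subseteq> C n" "\<And>n. cut (from_nat_into J n) (C (Suc n))"
  proof -
    have "\<exists>f. \<forall>n. W (f n) \<and> (f (Suc n) \<subseteq> f n \<and> cut (from_nat_into J n) (f (Suc n)))"
    proof (rule dependent_nat_choice[where P = "\<lambda>_. W" and Q = "\<lambda>n C C'. C' \<subseteq> C \<and> cut (from_nat_into J n) C'"])
      show "\<exists>C. W C" using W0 by blast
      show "\<exists>C'. W C' \<and> C' \<subseteq> C \<and> cut (from_nat_into J n) C'" if "W C" for C n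
        using step[OF that] .
    qed
    then show ?thesis using that by blast
  qed
  have Cdec: "C n \<subseteq> C m" if "m \<le> n" for m n using lift_Suc_antimono_le[of C, OF C(2) that] .
  have Ccomp: "compact (C n)" and Cne: "C n \<noteq> {}" for n using C(1)[of n] by (auto simp: W_def)
  define S where "S = (\<Inter>n. C n)"
  have "S \<noteq> {}" unfolding S_def by (rule compact_nest[OF Ccomp Cne Cdec])
  then obtain x0 where x0: "x0 \<in> S" by blast
  have cutS: "\<exists>a b. (a \<noteq> 0 \<or> b \<noteq> 0) \<and> (\<forall>x\<in>S. 0 \<le> a * (x \<bullet> i - fst p) + b * (x \<bullet> j - snd p))"
    if ij: "i \<in> Basis" "j \<in> Basis" "i \<noteq> j" "p \<in> D" for i j p
  proof -
    have "((i, j), p) \<in> J" using that by (auto simp: J_def)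
    then obtain n where "from_nat_into J n = ((i, j), p)"
      using from_nat_into_surj[OF J(1)] by metis
    then have "cut ((i, j), p) (C (Suc n))" using C(3)[of n] by simp
    then obtain a b where "a \<noteq> 0 \<or> b \<noteq> 0" "\<forall>x\<in>C (Suc n). 0 \<le> a * (x \<bullet> i - fst p) + b * (x \<bullet> j - snd p)"
      using ij unfolding cut_def by auto
    moreover have "S \<subseteq> C (Suc n)" by (auto simp: S_def)
    ultimately show ?thesis by (intro exI[of _ a] exI[of _ b]) auto
  qed
  obtain u where u: "norm u = 1" and line: "\<And>x. x \<in> S \<Longrightarrow> x = x0 + ((x - x0) \<bullet> u) *\<^sub>R u"
  proof (cases "\<exists>x1\<in>S. x1 \<noteq> x0")
    case True
    then obtain x1 where x1: "x1 \<in> S" "x0 \<noteq> x1" by auto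
    define u where "u = (x1 - x0) /\<^sub>R norm (x1 - x0)"
    have u: "norm u = 1" using x1 by (simp add: u_def)
    have "x = x0 + ((x - x0) \<bullet> u) *\<^sub>R u" if xS: "x \<in> S" for x
    proof -
      obtain t where "x = x0 + t *\<^sub>R (x1 - x0)"
        by (rule collinear_if_no_planar_shadow[OF D(2) cutS x0 x1(1) x1(2) xS])
      then have x: "x - x0 = (t * norm (x1 - x0)) *\<^sub>R u" using x1 by (simp add: u_def)
      have "u \<bullet> u = 1" using u by (simp add: dot_square_norm)
      then have "(x - x0) \<bullet> u = t * norm (x1 - x0)" by (simp add: x)
      then show ?thesis using x by (metis add.commute diff_add_cancel)
    qed
    then show ?thesis using that u by blast
  next
    case False
    obtain u :: 'a where "u \<in> Basis" using nonempty_Basis by blast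
    then show ?thesis using False by (intro that[of u]) auto
  qed
  obtain \<epsilon>0 where e0: "0 < \<epsilon>0" "line_nbhd x0 u K \<epsilon>0 \<inter> line_nbhd x0 u F \<epsilon>0 = {}"
    "\<And>r r'. r \<in> line_nbhd x0 u K \<epsilon>0 \<Longrightarrow> measure lborel (line_nbhd x0 u F \<epsilon>0 \<inter> closed_segment r r') \<le> \<theta>' * \<bar>r - r'\<bar>"
    using dilation_property_line_nbhd[where ?x0.0 = x0, OF K F disj u P[OF u] th'(1) t01(1)] by metis
  define \<epsilon> where "\<epsilon> = \<epsilon>0 / 2"
  have e: "0 < \<epsilon>" "2 * \<epsilon> = \<epsilon>0" using e0 by (auto simp: \<epsilon>_def)
  \<comment> \<open>The bodies decrease to S, which lies on the line. If every C n kept a point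
    farther than \<epsilon> from its projection, nested compact sets would leave such a point in
    S.\<close>
  have "\<exists>n. \<forall>x\<in>C n. dist (x0 + ((x - x0) \<bullet> u) *\<^sub>R u) x \<le> \<epsilon>"
  proof (rule ccontr)
    assume neg: "\<not> ?thesis"
    define G where "G = (\<lambda>n. C n \<inter> {x. \<epsilon> \<le> dist (x0 + ((x - x0) \<bullet> u) *\<^sub>R u) x})"
    have "(\<Inter>n. G n) \<noteq> {}"
    proof (rule compact_nest)
      show "compact (G n)" for n unfolding G_def
        by (intro compact_Int_closed Ccomp closed_Collect_le continuous_intros)
      show "G n \<noteq> {}" for n using neg by (force simp: G_def)
      show "G n \<subseteq> G m" if "m \<le> n" for m n using Cdec[OF that] by (auto simp: G_def)
    qed
    then obtain x where "x \<in> S" "\<epsilon> \<le> dist (x0 + ((x - x0) \<bullet> u) *\<^sub>R u) x" by (auto simp: G_def S_def)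
    then show False using line[of x] e by simp
  qed
  then obtain n where n: "\<And>x. x \<in> C n \<Longrightarrow> dist (x0 + ((x - x0) \<bullet> u) *\<^sub>R u) x \<le> \<epsilon>" by blast
  have Wn: "compact (C n)" "convex (C n)" "0 < measure \<mu> (C n)" "measure \<mu> (C n \<inter> K) = r * measure \<mu> (C n)"
    "measure \<mu> (C n - F) < c * measure \<mu> (C n)" using C(1)[of n] by (auto simp: W_def)
  have "c * measure \<mu> (C n) \<le> measure \<mu> (C n - F)"
    unfolding c_def
    by (rule s_concave_needle[OF fin sets sc s t01(1) th'(2) K F Wn(1-4) r u e(1) n])
       (use e0 e in auto)
  then show False using Wn(5) by simp
qed

section \<open>Tails and moments\<close>

text \<open>Weighted AM-GM for 1/2 and 1 with weights s and 1 - s gives 2 powr (-s) \<le> 1 - s/2,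
  with equality at s = 1.\<close>

lemma conc_const_ge_half:
  assumes "0 \<le> s" "s \<le> 1"
  shows "1/2 \<le> conc_const s"
proof (cases "s = 0")
  case True
  then show ?thesis using ln2_ge_two_thirds by (simp add: conc_const_def)
next
  case False
  have "(1/2) powr s * 1 powr (1 - s) \<le> s * (1/2) + (1 - s) * (1::real)"
    by (rule Youngs_inequality_0) (use assms in auto)
  then have "2 powr (- s) \<le> 1 - s/2" by (simp add: powr_minus powr_divide field_simps)
  then show ?thesis using False assms by (simp add: conc_const_def field_simps)
qed

lemma conc_tail_nonneg: "0 \<le> conc_tail s t"
  by (simp add: conc_tail_def)

lemma conc_tail_le_exp:
  assumes "0 \<le> s"
  shows "conc_tail s t \<le> exp (- (conc_const s * t))"
proof (cases "s = 0")
  case True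
  then show ?thesis by (simp add: conc_tail_def conc_const_def powr_def mult.commute)
next
  case False
  have "1 + (- (s * conc_const s * t)) \<le> exp (- (s * conc_const s * t))" by (rule exp_ge_add_one_self)
  then have "max (1 - s * conc_const s * t) 0 powr (1/s) \<le> exp (- (s * conc_const s * t)) powr (1/s)"
    using False assms by (intro powr_mono2) (auto simp: max_def)
  also have "\<dots> = exp (- (conc_const s * t))"
    using False by (simp add: powr_def)
  finally show ?thesis using False by (simp add: conc_tail_def)
qed

lemma conc_tail_le_exp_half:
  assumes "0 \<le> s" "s \<le> 1" "0 \<le> t"
  shows "exp (- (conc_const s * t)) \<le> exp (- (t / 2))"
  using mult_right_mono[OF conc_const_ge_half[OF assms(1,2)] assms(3)] by simp

text \<open>Solves the dilation inequality at \<theta> = 1/t, with a complement of mass at most 1/2,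
  for the mass u; the combination 1 - 2 powr (-s) = s c_s arises here.\<close>

lemma le_conc_tail:
  assumes s: "0 \<le> s" "s \<le> 1" and t: "0 < t" and u: "0 \<le> u" and le: "pmean s (1/t) u 1 \<le> 1/2"
  shows "u \<le> conc_tail s t"
proof (cases "s = 0")
  case True
  then have "u powr (1/t) \<le> 1/2" using le by (simp add: pmean_def)
  then have "(u powr (1/t)) powr t \<le> (1/2) powr t" using t by (intro powr_mono2) auto
  then show ?thesis using True t u by (simp add: conc_tail_def powr_powr powr_minus powr_divide field_simps)
next
  case False
  then have s0: "0 < s" using s by simp
  define q where "q = (1/t) * u powr s + (1 - 1/t)"
  have q2: "q \<le> 2 powr (-s)"
  proof (cases "q \<le> 0")
    case True
    then show ?thesis by (rule order_trans) simp
  next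
    case q: False
    have "q powr (1/s) \<le> 1/2" using le False by (simp add: pmean_def q_def)
    then have "(q powr (1/s)) powr s \<le> (1/2) powr s" using s by (intro powr_mono2) auto
    then show ?thesis using q s0 by (simp add: powr_powr powr_minus powr_divide field_simps)
  qed
  have "u powr s = t * q + 1 - t" using t by (simp add: q_def field_simps)
  also have "\<dots> \<le> 1 - t * (1 - 2 powr (-s))"
    using mult_left_mono[OF q2, of t] t by (simp add: algebra_simps)
  finally have us: "u powr s \<le> 1 - s * conc_const s * t" using False by (simp add: conc_const_def mult.commute)
  have "u = (u powr s) powr (1/s)" using u s0 by (simp add: powr_powr)
  also have "\<dots> \<le> max (1 - s * conc_const s * t) 0 powr (1/s)"
    using us s0 by (intro powr_mono2) auto
  finally show ?thesis using False by (simp add: conc_tail_def)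
qed

section \<open>The integrals behind the moments\<close>

lemma Beta_real_nonneg: "0 < a \<Longrightarrow> 0 < b \<Longrightarrow> 0 \<le> Beta a (b::real)"
  by (simp add: Beta_def Gamma_real_pos less_imp_le)

text \<open>The substitution x / k, common to the Beta integral of a truncated power and the Gamma
  integral of an exponential.\<close>

lemma nn_integral_powr_scale:
  fixes g :: "real \<Rightarrow> real"
  assumes k: "0 < k" and p: "0 < p" and g [measurable]: "g \<in> borel_measurable borel" "\<And>x. 0 \<le> g x"
    and I: "(\<integral>\<^sup>+x. ennreal (x powr (p - 1) * g x) * indicator {0..} x \<partial>lborel) = ennreal I" "0 \<le> I"
  shows "(\<integral>\<^sup>+x. ennreal (p * x powr (p - 1) * g (k * x)) * indicator {0..} x \<partial>lborel) = ennreal (p * I / k powr p)"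
proof -
  have "(\<integral>\<^sup>+x. ennreal (p * x powr (p - 1) * g (k * x)) * indicator {0..} x \<partial>lborel)
      = ennreal \<bar>1/k\<bar> * (\<integral>\<^sup>+x. ennreal (p * (0 + (1/k) * x) powr (p - 1) * g (k * (0 + (1/k) * x))) * indicator {0..} (0 + (1/k) * x) \<partial>lborel)"
    by (rule nn_integral_real_affine) (use k in auto)
  also have "(\<integral>\<^sup>+x. ennreal (p * (0 + (1/k) * x) powr (p - 1) * g (k * (0 + (1/k) * x))) * indicator {0..} (0 + (1/k) * x) \<partial>lborel)
      = (\<integral>\<^sup>+x. ennreal (p * (1/k) powr (p - 1)) * (ennreal (x powr (p - 1) * g x) * indicator {0..} x) \<partial>lborel)"
  proof (intro nn_integral_cong)
    fix x :: real
    show "ennreal (p * (0 + (1/k) * x) powr (p - 1) * g (k * (0 + (1/k) * x))) * indicator {0..} (0 + (1/k) * x)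
      = ennreal (p * (1/k) powr (p - 1)) * (ennreal (x powr (p - 1) * g x) * indicator {0..} x)"
    proof (cases "0 \<le> x")
      case True
      have "p * ((1/k) * x) powr (p - 1) * g x = (p * (1/k) powr (p - 1)) * (x powr (p - 1) * g x)"
        using True k by (simp add: powr_mult powr_divide)
      then show ?thesis using True k p g by (simp add: ennreal_mult[symmetric])
    next
      case False
      then show ?thesis using k by (simp add: indicator_def zero_le_divide_iff)
    qed
  qed
  also have "\<dots> = ennreal (p * (1/k) powr (p - 1)) * ennreal I"
    by (subst nn_integral_cmult) (auto simp: I)
  also have "ennreal \<bar>1/k\<bar> * (ennreal (p * (1/k) powr (p - 1)) * ennreal I) = ennreal (1/k * (p * (1/k) powr (p - 1) * I))"
    using k p I by (simp add: ennreal_mult[symmetric])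
  also have "1/k * (p * (1/k) powr (p - 1) * I) = p * I / k powr p"
    using k by (simp add: powr_divide powr_diff field_simps)
  finally show ?thesis .
qed

lemma nn_integral_powr_exp:
  assumes k: "0 < k" and p: "0 < p"
  shows "(\<integral>\<^sup>+x. ennreal (p * x powr (p - 1) * exp (- (k * x))) * indicator {0..} x \<partial>lborel) = ennreal (Gamma (p + 1) / k powr p)"
proof -
  have "((\<lambda>t. t powr (p - 1) * exp (- t)) has_integral Gamma p) {0..}"
    using Gamma_integral_real[OF p] by (simp add: exp_minus field_simps)
  then have "(\<integral>\<^sup>+x. ennreal (x powr (p - 1) * exp (- x)) * indicator {0..} x \<partial>lborel) = ennreal (Gamma p)"
    by (intro nn_integral_has_integral_lebesgue') auto
  from nn_integral_powr_scale[OF k p _ _ this]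
  have "(\<integral>\<^sup>+x. ennreal (p * x powr (p - 1) * exp (- (k * x))) * indicator {0..} x \<partial>lborel) = ennreal (p * Gamma p / k powr p)"
    using p by (simp add: Gamma_real_pos less_imp_le)
  moreover have "Gamma (p + 1) = p * Gamma p"
    by (rule Gamma_plus1) (use p in \<open>auto elim!: nonpos_Ints_cases\<close>)
  ultimately show ?thesis by simp
qed

lemma nn_integral_powr_Icc:
  assumes p: "0 < p" and c: "0 \<le> c"
  shows "(\<integral>\<^sup>+x. ennreal (p * x powr (p - 1)) * indicator {0..c} x \<partial>lborel) = ennreal (c powr p)"
proof -
  have "((\<lambda>x. p * x powr (p - 1)) has_integral (p * (c powr (p - 1 + 1) / (p - 1 + 1)))) {0..c}"
    by (intro has_integral_mult_right has_integral_powr_from_0) (use p c in auto)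
  then have "((\<lambda>x. p * x powr (p - 1)) has_integral (c powr p)) {0..c}" using p by simp
  then show ?thesis by (intro nn_integral_has_integral_lebesgue') (use p in auto)
qed

text \<open>Explains \<open>conc_moment\<close>: it is the layer-cake integral of the tail. After
  scaling by s c_s this is a Beta integral with second parameter 1 + 1/s, and at s = 0 a Gamma
  integral scaled by ln 2.\<close>

lemma nn_integral_conc_tail:
  assumes s: "0 \<le> s" "s \<le> 1" and p: "0 < p"
  shows "(\<integral>\<^sup>+x. ennreal (p * x powr (p - 1) * conc_tail s x) * indicator {0..} x \<partial>lborel) = ennreal (conc_moment s p)"
proof (cases "s = 0")
  case True
  have "conc_tail s x = exp (- (ln 2 * x))" for x using True by (simp add: conc_tail_def powr_def mult.commute)
  then show ?thesis using nn_integral_powr_exp[of "ln 2" p] p True by (simp add: conc_moment_def)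
next
  case False
  then have s0: "0 < s" using s by simp
  have k: "0 < s * conc_const s" using conc_const_ge_half[OF s] s0 by (intro mult_pos_pos) auto
  have B: "0 \<le> Beta p (1 + 1/s)" using p s0 by (intro Beta_real_nonneg add_pos_pos) auto
  have "((\<lambda>t. t powr (p - 1) * (1 - t) powr (1 + 1/s - 1)) has_integral Beta p (1 + 1/s)) {0..1}"
    by (rule has_integral_Beta_real) (use p s0 in \<open>auto intro: add_pos_pos\<close>)
  then have "(\<integral>\<^sup>+t. ennreal (t powr (p - 1) * (1 - t) powr (1 + 1/s - 1)) * indicator {0..1} t \<partial>lborel) = ennreal (Beta p (1 + 1/s))"
    by (intro nn_integral_has_integral_lebesgue') auto
  also have "(\<integral>\<^sup>+t. ennreal (t powr (p - 1) * (1 - t) powr (1 + 1/s - 1)) * indicator {0..1} t \<partial>lborel)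
      = (\<integral>\<^sup>+t. ennreal (t powr (p - 1) * (max (1 - t) 0) powr (1/s)) * indicator {0..} t \<partial>lborel)"
    by (intro nn_integral_cong) (auto simp: indicator_def max_def)
  finally have I: "(\<integral>\<^sup>+t. ennreal (t powr (p - 1) * (max (1 - t) 0) powr (1/s)) * indicator {0..} t \<partial>lborel) = ennreal (Beta p (1 + 1/s))" .
  have "(\<integral>\<^sup>+x. ennreal (p * x powr (p - 1) * (max (1 - s * conc_const s * x) 0) powr (1/s)) * indicator {0..} x \<partial>lborel)
      = ennreal (p * Beta p (1 + 1/s) / (s * conc_const s) powr p)"
    by (rule nn_integral_powr_scale[OF k p _ _ I B]) auto
  then show ?thesis using False by (simp add: conc_tail_def conc_moment_def)
qed

lemma conc_moment_nonneg:
  assumes "0 \<le> s" "0 < p"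
  shows "0 \<le> conc_moment s p"
  using assms Beta_real_nonneg[of p "1 + 1/s"]
  by (cases "s = 0") (auto simp: conc_moment_def Gamma_real_pos less_imp_le add_pos_pos)

text \<open>The tails are compared under the integral sign, which avoids any direct inequality
  between Beta and Gamma.\<close>

lemma conc_moment_le:
  assumes s: "0 \<le> s" "s \<le> 1" and p: "0 < p"
  shows "conc_moment s p \<le> 2 powr p * Gamma (p + 1)"
proof -
  have "ennreal (conc_moment s p) \<le> (\<integral>\<^sup>+x. ennreal (p * x powr (p - 1) * exp (- ((1/2) * x))) * indicator {0..} x \<partial>lborel)"
    unfolding nn_integral_conc_tail[OF assms, symmetric]
  proof (intro nn_integral_mono)
    fix x :: real
    have "p * x powr (p - 1) * conc_tail s x \<le> p * x powr (p - 1) * exp (- ((1/2) * x))" if "0 \<le> x"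
      using order_trans[OF conc_tail_le_exp[OF s(1), of x] conc_tail_le_exp_half[OF s that]] p
      by (intro mult_left_mono) auto
    then show "ennreal (p * x powr (p - 1) * conc_tail s x) * indicator {0..} x
        \<le> ennreal (p * x powr (p - 1) * exp (- ((1/2) * x))) * indicator {0..} x"
      by (auto simp: indicator_def intro!: ennreal_leI)
  qed
  also have "\<dots> = ennreal (2 powr p * Gamma (p + 1))"
    using nn_integral_powr_exp[of "1/2" p] p by (simp add: powr_divide)
  finally show ?thesis using p Gamma_real_pos[of "p + 1"] by (subst (asm) ennreal_le_iff) auto
qed

text \<open>Layer-cake formula for the p-th power of g / c. Levels up to 1 are bounded by
  probability 1 and give the summand 1; higher levels are bounded by the tail, whose integral over
  the whole half line is \<open>conc_moment s p\<close>.\<close>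

lemma moment_bound_of_tail:
  fixes g :: "'a \<Rightarrow> real"
  assumes prob: "prob_space \<mu>" and s: "0 \<le> s" "s \<le> 1" and p: "0 < p" and c: "0 < c"
    and g [measurable]: "g \<in> borel_measurable \<mu>" "\<And>x. 0 \<le> g x"
    and tail: "\<And>t. 1 < t \<Longrightarrow> measure \<mu> {x \<in> space \<mu>. c * t \<le> g x} \<le> conc_tail s t"
  shows "integrable \<mu> (\<lambda>x. g x powr p)" "(LINT x|\<mu>. g x powr p) \<le> c powr p * (1 + conc_moment s p)"
proof -
  interpret prob_space \<mu> by fact
  interpret pair_sigma_finite \<mu> lborel
    by (intro pair_sigma_finite.intro sigma_finite_measure_axioms lborel.sigma_finite_measure_axioms)
  have cm: "0 \<le> conc_moment s p" by (rule conc_moment_nonneg[OF s(1) p])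
  define w where "w = (\<lambda>\<tau>::real. ennreal (p * \<tau> powr (p - 1)) * indicator {0..} \<tau>)"
  have [measurable]: "w \<in> borel_measurable borel" unfolding w_def by measurable
  have "(\<integral>\<^sup>+x. ennreal ((g x / c) powr p) \<partial>\<mu>) = (\<integral>\<^sup>+x. \<integral>\<^sup>+\<tau>. w \<tau> * indicator {q. c * snd q \<le> g (fst q)} (x, \<tau>) \<partial>lborel \<partial>\<mu>)"
  proof (intro nn_integral_cong)
    fix x
    have "ennreal ((g x / c) powr p) = (\<integral>\<^sup>+\<tau>. ennreal (p * \<tau> powr (p - 1)) * indicator {0..g x / c} \<tau> \<partial>lborel)"
      using nn_integral_powr_Icc[OF p, of "g x / c"] g c by simp
    also have "\<dots> = (\<integral>\<^sup>+\<tau>. w \<tau> * indicator {q. c * snd q \<le> g (fst q)} (x, \<tau>) \<partial>lborel)"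
      using c by (intro nn_integral_cong) (auto simp: w_def indicator_def field_simps)
    finally show "ennreal ((g x / c) powr p) = (\<integral>\<^sup>+\<tau>. w \<tau> * indicator {q. c * snd q \<le> g (fst q)} (x, \<tau>) \<partial>lborel)" .
  qed
  also have "\<dots> = (\<integral>\<^sup>+\<tau>. \<integral>\<^sup>+x. w \<tau> * indicator {q. c * snd q \<le> g (fst q)} (x, \<tau>) \<partial>\<mu> \<partial>lborel)"
  proof (rule Fubini'[symmetric])
    have "{q \<in> space (\<mu> \<Otimes>\<^sub>M lborel). c * snd q \<le> g (fst q)} \<in> sets (\<mu> \<Otimes>\<^sub>M lborel)" by measurable
    then have "(indicator {q \<in> space (\<mu> \<Otimes>\<^sub>M lborel). c * snd q \<le> g (fst q)} :: _ \<Rightarrow> ennreal) \<in> borel_measurable (\<mu> \<Otimes>\<^sub>M lborel)"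
      by (rule borel_measurable_indicator)
    then have "(indicator {q. c * snd q \<le> g (fst q)} :: _ \<Rightarrow> ennreal) \<in> borel_measurable (\<mu> \<Otimes>\<^sub>M lborel)"
      by (rule measurable_cong[THEN iffD1, rotated]) (auto simp: indicator_def)
    then show "(\<lambda>(x, \<tau>). w \<tau> * indicator {q. c * snd q \<le> g (fst q)} (x, \<tau>)) \<in> borel_measurable (\<mu> \<Otimes>\<^sub>M lborel)"
      by (simp add: case_prod_beta)
  qed
  also have "\<dots> = (\<integral>\<^sup>+\<tau>. w \<tau> * ennreal (measure \<mu> {x \<in> space \<mu>. c * \<tau> \<le> g x}) \<partial>lborel)"
  proof (intro nn_integral_cong)
    fix \<tau> :: real
    have "(\<integral>\<^sup>+x. w \<tau> * indicator {q. c * snd q \<le> g (fst q)} (x, \<tau>) \<partial>\<mu>) = (\<integral>\<^sup>+x. w \<tau> * indicator {x \<in> space \<mu>. c * \<tau> \<le> g x} x \<partial>\<mu>)"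
      by (intro nn_integral_cong) (auto simp: indicator_def)
    also have "\<dots> = w \<tau> * ennreal (measure \<mu> {x \<in> space \<mu>. c * \<tau> \<le> g x})"
      by (subst nn_integral_cmult_indicator) (auto simp: emeasure_eq_measure)
    finally show "(\<integral>\<^sup>+x. w \<tau> * indicator {q. c * snd q \<le> g (fst q)} (x, \<tau>) \<partial>\<mu>) = w \<tau> * ennreal (measure \<mu> {x \<in> space \<mu>. c * \<tau> \<le> g x})" .
  qed
  also have "\<dots> \<le> (\<integral>\<^sup>+\<tau>. ennreal (p * \<tau> powr (p - 1)) * indicator {0..1} \<tau>
      + ennreal (p * \<tau> powr (p - 1) * conc_tail s \<tau>) * indicator {0..} \<tau> \<partial>lborel)"
  proof (intro nn_integral_mono)
    fix \<tau> :: real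
    let ?m = "measure \<mu> {x \<in> space \<mu>. c * \<tau> \<le> g x}"
    consider "\<tau> < 0" | "0 \<le> \<tau>" "\<tau> \<le> 1" | "1 < \<tau>" by linarith
    then show "w \<tau> * ennreal ?m \<le> ennreal (p * \<tau> powr (p - 1)) * indicator {0..1} \<tau>
      + ennreal (p * \<tau> powr (p - 1) * conc_tail s \<tau>) * indicator {0..} \<tau>"
    proof cases
      case 1
      then show ?thesis by (simp add: w_def)
    next
      case 2
      have "w \<tau> * ennreal ?m \<le> w \<tau> * 1" by (intro mult_left_mono) (auto simp: ennreal_le_1)
      also have "\<dots> \<le> ennreal (p * \<tau> powr (p - 1)) * indicator {0..1} \<tau> + 0" using 2 by (simp add: w_def)
      finally show ?thesis by (rule order_trans) (intro add_left_mono, simp)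
    next
      case 3
      have "w \<tau> * ennreal ?m \<le> w \<tau> * ennreal (conc_tail s \<tau>)"
        by (intro mult_left_mono ennreal_leI tail 3) auto
      also have "\<dots> = ennreal (p * \<tau> powr (p - 1) * conc_tail s \<tau>) * indicator {0..} \<tau>"
        using 3 p by (simp add: w_def ennreal_mult conc_tail_nonneg)
      finally show ?thesis using 3 by simp
    qed
  qed
  also have "\<dots> = ennreal 1 + ennreal (conc_moment s p)"
  proof -
    have [measurable]: "conc_tail s \<in> borel_measurable borel" unfolding conc_tail_def by measurable
    have "(\<integral>\<^sup>+\<tau>. ennreal (p * \<tau> powr (p - 1)) * indicator {0..1} \<tau>
        + ennreal (p * \<tau> powr (p - 1) * conc_tail s \<tau>) * indicator {0..} \<tau> \<partial>lborel)
      = (\<integral>\<^sup>+\<tau>. ennreal (p * \<tau> powr (p - 1)) * indicator {0..1} \<tau> \<partial>lborel)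
        + (\<integral>\<^sup>+\<tau>. ennreal (p * \<tau> powr (p - 1) * conc_tail s \<tau>) * indicator {0..} \<tau> \<partial>lborel)"
      by (rule nn_integral_add) measurable
    also have "\<dots> = ennreal (1 powr p) + ennreal (conc_moment s p)"
      using nn_integral_powr_Icc[OF p, of 1] nn_integral_conc_tail[OF s p] by (simp only: zero_le_one)
    finally show ?thesis by (simp only: powr_one_eq_one)
  qed
  finally have I: "(\<integral>\<^sup>+x. ennreal ((g x / c) powr p) \<partial>\<mu>) \<le> ennreal 1 + ennreal (conc_moment s p)" .
  have "(\<integral>\<^sup>+x. ennreal (g x powr p) \<partial>\<mu>) = (\<integral>\<^sup>+x. ennreal (c powr p) * ennreal ((g x / c) powr p) \<partial>\<mu>)"
    using c g by (intro nn_integral_cong) (simp add: ennreal_mult[symmetric] powr_mult[symmetric])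
  also have "\<dots> = ennreal (c powr p) * (\<integral>\<^sup>+x. ennreal ((g x / c) powr p) \<partial>\<mu>)"
    by (subst nn_integral_cmult) auto
  also have "\<dots> \<le> ennreal (c powr p) * (ennreal 1 + ennreal (conc_moment s p))"
    by (rule mult_left_mono[OF I]) simp
  also have "\<dots> = ennreal (c powr p * (1 + conc_moment s p))"
    using cm by (simp add: ennreal_mult)
  finally have le: "(\<integral>\<^sup>+x. ennreal (g x powr p) \<partial>\<mu>) \<le> ennreal (c powr p * (1 + conc_moment s p))" .
  show int: "integrable \<mu> (\<lambda>x. g x powr p)"
    by (rule integrableI_nonneg) (use le in \<open>auto simp: less_top[symmetric] top_unique\<close>)
  have "ennreal (LINT x|\<mu>. g x powr p) = (\<integral>\<^sup>+x. ennreal (g x powr p) \<partial>\<mu>)"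
    by (rule nn_integral_eq_integral[symmetric, OF int]) auto
  then have "ennreal (LINT x|\<mu>. g x powr p) \<le> ennreal (c powr p * (1 + conc_moment s p))" using le by simp
  then show "(LINT x|\<mu>. g x powr p) \<le> c powr p * (1 + conc_moment s p)"
    by (subst (asm) ennreal_le_iff) (use cm in auto)
qed

text \<open>Disjointness and the density condition pass to subsets, and inner regularity supplies
  compact ones of nearly full mass. The number v strictly between the two sides absorbs both
  approximations.\<close>

lemma s_concave_dilation_borel:
  fixes \<mu> :: "'a::euclidean_space measure"
  assumes prob: "prob_space \<mu>" and sets: "sets \<mu> = sets borel" and sc: "s_concave s \<mu>"
    and s: "0 \<le> s" "s \<le> 1" and th: "0 < \<theta>" "\<theta> < 1"
    and K: "K \<in> sets borel" and F: "F \<in> sets borel" and disj: "K \<inter> F = {}"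
    and P: "\<And>x u a b. norm u = 1 \<Longrightarrow> x + a *\<^sub>R u \<in> K \<Longrightarrow>
      measure lborel {t \<in> closed_segment a b. x + t *\<^sub>R u \<in> F} \<le> \<theta> * \<bar>a - b\<bar>"
    and pos: "0 < measure \<mu> K"
  shows "pmean s \<theta> (measure \<mu> K) 1 \<le> measure \<mu> (- F)"
proof (rule ccontr)
  assume "\<not> ?thesis"
  then obtain v where v: "measure \<mu> (- F) < v" "v < pmean s \<theta> (measure \<mu> K) 1"
    using dense by (metis not_le)
  interpret prob_space \<mu> by fact
  have fin: "finite_measure \<mu>" by (rule finite_measure_axioms)
  have sp: "space \<mu> = UNIV" using sets_eq_imp_space_eq[OF sets] by simp
  have "((\<lambda>k. pmean s \<theta> k 1) \<longlongrightarrow> pmean s \<theta> (measure \<mu> K) 1) (at_left (measure \<mu> K))"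
    by (rule tendsto_pmean) (use s th pos in auto)
  from order_tendstoD(1)[OF this v(2)]
  have "\<forall>\<^sub>F k in at_left (measure \<mu> K). v < pmean s \<theta> k 1" .
  moreover have "\<forall>\<^sub>F k in at_left (measure \<mu> K). k \<in> {0<..<measure \<mu> K}"
    by (rule eventually_at_left_real[OF pos])
  ultimately have "\<forall>\<^sub>F k in at_left (measure \<mu> K). 0 < k \<and> k < measure \<mu> K \<and> v < pmean s \<theta> k 1"
    by eventually_elim auto
  then obtain k where k: "0 < k" "k < measure \<mu> K" "v < pmean s \<theta> k 1"
    using eventually_happens'[OF trivial_limit_at_left_real] by blast
  obtain K' where K': "compact K'" "K' \<subseteq> K" "k < measure \<mu> K'"
    using compact_inner_approx[OF fin sets K k(2)] .
  have compl: "measure \<mu> (- E) = 1 - measure \<mu> E" if "E \<in> sets borel" for E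
    using prob_compl[of E] that sets sp by (simp add: Compl_eq_Diff_UNIV)
  have "1 - v < measure \<mu> F" using v(1) compl[OF F] by simp
  then obtain F' where F': "compact F'" "F' \<subseteq> F" "1 - v < measure \<mu> F'"
    using compact_inner_approx[OF fin sets F] by blast
  have "pmean s \<theta> (measure \<mu> K') 1 \<le> measure \<mu> (- F')"
  proof (rule s_concave_dilation[OF prob sets sc s th K'(1) F'(1)])
    show "K' \<inter> F' = {}" "0 < measure \<mu> K'" using disj K' F' k by auto
    fix x u :: 'a and a b :: real assume *: "norm u = 1" "x + a *\<^sub>R u \<in> K'"
    have "(\<lambda>t. x + t *\<^sub>R u) -` E \<inter> space borel \<in> sets borel" if "E \<in> sets borel" for E
      by (rule measurable_sets[OF _ that]) measurable
    then have "closed_segment a b \<inter> ((\<lambda>t. x + t *\<^sub>R u) -` E) \<in> sets borel" if "E \<in> sets borel" for E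
      using that by (auto intro!: sets.Int)
    moreover have "{t \<in> closed_segment a b. x + t *\<^sub>R u \<in> E} = closed_segment a b \<inter> ((\<lambda>t. x + t *\<^sub>R u) -` E)" for E
      by auto
    ultimately have m: "{t \<in> closed_segment a b. x + t *\<^sub>R u \<in> E} \<in> sets borel" if "E \<in> sets borel" for E
      using that by simp
    have "measure lborel {t \<in> closed_segment a b. x + t *\<^sub>R u \<in> F'} \<le> measure lborel {t \<in> closed_segment a b. x + t *\<^sub>R u \<in> F}"
    proof (rule measure_mono_fmeasurable)
      have "bounded {t \<in> closed_segment a b. x + t *\<^sub>R u \<in> F}"
        by (rule bounded_subset[OF bounded_closed_segment]) auto
      then show "{t \<in> closed_segment a b. x + t *\<^sub>R u \<in> F} \<in> fmeasurable lborel"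
        using m[OF F] emeasure_bounded_finite by (intro fmeasurableI) auto
      show "{t \<in> closed_segment a b. x + t *\<^sub>R u \<in> F'} \<in> sets lborel"
        using m[OF borel_closed[OF compact_imp_closed[OF F'(1)]]] by simp
    qed (use F' in auto)
    also have "\<dots> \<le> \<theta> * \<bar>a - b\<bar>" by (rule P) (use * K' in auto)
    finally show "measure lborel {t \<in> closed_segment a b. x + t *\<^sub>R u \<in> F'} \<le> \<theta> * \<bar>a - b\<bar>" .
  qed
  moreover have "pmean s \<theta> k 1 \<le> pmean s \<theta> (measure \<mu> K') 1"
    using pmean_mono[OF s, of \<theta> k "measure \<mu> K'" 1 1] th k K' by auto
  moreover have "measure \<mu> (- F') < v" using F' compl[of F'] by (simp add: borel_closed compact_imp_closed)
  ultimately show False using k by simp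
qed

section \<open>Consequences of the Chebyshev inequality on segments\<close>

lemma line_measure_segment:
  fixes x u :: "'a::euclidean_space"
  assumes "norm u = 1"
  shows "line_measure x u ((\<lambda>t. x + t *\<^sub>R u) ` closed_segment a b) = \<bar>a - b\<bar>"
    "line_measure x u ((\<lambda>t. x + t *\<^sub>R u) ` closed_segment a b \<inter> S) = measure lborel {t \<in> closed_segment a b. x + t *\<^sub>R u \<in> S}"
proof -
  have inj: "x + t *\<^sub>R u \<in> (\<lambda>t. x + t *\<^sub>R u) ` closed_segment a b \<longleftrightarrow> t \<in> closed_segment a b" for t
    using assms by auto
  show "line_measure x u ((\<lambda>t. x + t *\<^sub>R u) ` closed_segment a b) = \<bar>a - b\<bar>"
    unfolding line_measure_def inj by (simp add: closed_segment_eq_real_ivl)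
  show "line_measure x u ((\<lambda>t. x + t *\<^sub>R u) ` closed_segment a b \<inter> S) = measure lborel {t \<in> closed_segment a b. x + t *\<^sub>R u \<in> S}"
    unfolding line_measure_def by (simp add: inj Int_def)
qed

lemma chebyshev_ineq_segment:
  fixes f :: "'a::euclidean_space \<Rightarrow> real"
  assumes ch: "chebyshev_ineq f A d" and u: "norm u = 1" and S: "S \<in> sets borel"
    and pos: "0 < measure lborel {t \<in> closed_segment a b. x + t *\<^sub>R u \<in> S}"
  shows "(SUP y\<in>(\<lambda>t. x + t *\<^sub>R u) ` closed_segment a b. ennreal \<bar>f y\<bar>) \<le>
     ennreal ((A * \<bar>a - b\<bar> / measure lborel {t \<in> closed_segment a b. x + t *\<^sub>R u \<in> S}) powr d) *
     (SUP y\<in>(\<lambda>t. x + t *\<^sub>R u) ` closed_segment a b \<inter> S. ennreal \<bar>f y\<bar>)"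
proof -
  define I where "I = (\<lambda>t. x + t *\<^sub>R u) ` closed_segment a b"
  have "I = (+) x ` ((\<lambda>t. t *\<^sub>R u) ` closed_segment a b)" by (auto simp: I_def)
  moreover have "linear (\<lambda>t. t *\<^sub>R u)" by (rule linear_scaleR_left)
  ultimately have cv: "convex I" by (simp add: convex_translation convex_linear_image)
  have cp: "compact I" unfolding I_def
    by (intro compact_continuous_image continuous_intros) auto
  then have "I \<inter> S \<in> sets borel" using S by (auto simp: borel_closed compact_imp_closed)
  moreover have "I \<subseteq> range (\<lambda>t. x + t *\<^sub>R u)" by (auto simp: I_def)
  ultimately have "(SUP y\<in>I. ennreal \<bar>f y\<bar>) \<le>
      ennreal ((A * line_measure x u I / line_measure x u (I \<inter> S)) powr d) * (SUP y\<in>I \<inter> S. ennreal \<bar>f y\<bar>)"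
    using ch u cv compact_imp_bounded[OF cp] pos line_measure_segment(2)[OF u, of x a b S]
    unfolding chebyshev_ineq_def I_def by (metis (no_types, lifting) inf_le1)
  then show ?thesis unfolding I_def line_measure_segment[OF u] .
qed

text \<open>With J the part of the segment where the power of f is at most M, the supremum over the
  segment is at least (A M t) powr d and that over J at most M powr d. The constant A cancels, which
  is why the threshold is A M t.\<close>

lemma chebyshev_sublevel_density:
  fixes f :: "'a::euclidean_space \<Rightarrow> real"
  assumes ch: "chebyshev_ineq f A d" and f [measurable]: "f \<in> borel_measurable borel"
    and u: "norm u = 1" and A: "0 < A" and d: "0 < d" and M: "0 < M" and t: "0 < t"
    and x: "A * M * t \<le> \<bar>f (x + a *\<^sub>R u)\<bar> powr (1/d)"
  shows "measure lborel {\<tau> \<in> closed_segment a b. x + \<tau> *\<^sub>R u \<in> {y. \<bar>f y\<bar> powr (1/d) \<le> M}} \<le> (1/t) * \<bar>a - b\<bar>"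
proof -
  define S where "S = {y. \<bar>f y\<bar> powr (1/d) \<le> M}"
  define j where "j = measure lborel {\<tau> \<in> closed_segment a b. x + \<tau> *\<^sub>R u \<in> S}"
  have Sb: "S \<in> sets borel" unfolding S_def by measurable
  have powd: "(\<bar>z\<bar> powr (1/d)) powr d = \<bar>z\<bar>" for z :: real using d by (simp add: powr_powr)
  show ?thesis
  proof (cases "0 < j")
    case False
    then have "j = 0" by (simp add: j_def not_less measure_le_0_iff)
    then show ?thesis using t by (simp add: j_def S_def)
  next
    case True
    let ?I = "(\<lambda>t. x + t *\<^sub>R u) ` closed_segment a b"
    have "ennreal ((A * M * t) powr d) \<le> ennreal \<bar>f (x + a *\<^sub>R u)\<bar>"
      using powr_mono2[OF _ _ x, of d] A M t d powd by (intro ennreal_leI) simp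
    also have "\<dots> \<le> (SUP y\<in>?I. ennreal \<bar>f y\<bar>)" by (intro SUP_upper) auto
    also have "\<dots> \<le> ennreal ((A * \<bar>a - b\<bar> / j) powr d) * (SUP y\<in>?I \<inter> S. ennreal \<bar>f y\<bar>)"
      unfolding j_def by (rule chebyshev_ineq_segment[OF ch u Sb]) (use True in \<open>simp add: j_def\<close>)
    also have "\<dots> \<le> ennreal ((A * \<bar>a - b\<bar> / j) powr d) * ennreal (M powr d)"
    proof (intro mult_left_mono SUP_least ennreal_leI)
      fix y assume "y \<in> ?I \<inter> S"
      then have "(\<bar>f y\<bar> powr (1/d)) powr d \<le> M powr d" using d by (intro powr_mono2) (auto simp: S_def)
      then show "\<bar>f y\<bar> \<le> M powr d" using powd by simp
    qed auto
    also have "\<dots> = ennreal ((A * \<bar>a - b\<bar> / j) powr d * M powr d)" by (simp add: ennreal_mult)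
    also have "(A * \<bar>a - b\<bar> / j) powr d * M powr d = (A * \<bar>a - b\<bar> / j * M) powr d"
      by (rule powr_mult[symmetric])
    finally have le: "(A * M * t) powr d \<le> (A * \<bar>a - b\<bar> / j * M) powr d" by simp
    have "A * M * t \<le> A * \<bar>a - b\<bar> / j * M"
    proof (rule ccontr)
      assume "\<not> ?thesis"
      then have "(A * \<bar>a - b\<bar> / j * M) powr d < (A * M * t) powr d"
        using A M True d by (intro powr_less_mono2) auto
      then show False using le by simp
    qed
    then have "(A * M) * (t * j) \<le> (A * M) * \<bar>a - b\<bar>" using True by (simp add: field_simps)
    then have "t * j \<le> \<bar>a - b\<bar>" using A M by (simp add: mult_le_cancel_left)
    then show ?thesis using t by (simp add: j_def S_def field_simps)
  qed
qed

lemma chebyshev_zero_density: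
  fixes f :: "'a::euclidean_space \<Rightarrow> real"
  assumes ch: "chebyshev_ineq f A d" and f [measurable]: "f \<in> borel_measurable borel"
    and u: "norm u = 1" and x: "f (x + a *\<^sub>R u) \<noteq> 0"
  shows "measure lborel {\<tau> \<in> closed_segment a b. x + \<tau> *\<^sub>R u \<in> {y. f y = 0}} = 0"
proof (rule ccontr)
  assume "\<not> ?thesis"
  then have pos: "0 < measure lborel {\<tau> \<in> closed_segment a b. x + \<tau> *\<^sub>R u \<in> {y. f y = 0}}" by (simp add: less_le)
  let ?I = "(\<lambda>t. x + t *\<^sub>R u) ` closed_segment a b"
  have "{y. f y = 0} \<in> sets borel" by measurable
  note chebyshev_ineq_segment[OF ch u this pos]
  moreover have "(SUP y\<in>?I \<inter> {y. f y = 0}. ennreal \<bar>f y\<bar>) \<le> 0" by (intro SUP_least) auto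
  ultimately have "(SUP y\<in>?I. ennreal \<bar>f y\<bar>) \<le> 0" by simp
  moreover have "ennreal \<bar>f (x + a *\<^sub>R u)\<bar> \<le> (SUP y\<in>?I. ennreal \<bar>f y\<bar>)" by (intro SUP_upper) auto
  ultimately have "ennreal \<bar>f (x + a *\<^sub>R u)\<bar> \<le> 0" by (rule order_trans[rotated])
  then show False using x by simp
qed

text \<open>Taking J = I compares the supremum with A powr d times itself, which is conclusive only
  if it is finite and nonzero. It is finite because some sublevel set of f has positive length in
  the segment, and the inequality for this J bounds f on all of I.\<close>

lemma chebyshev_const_ge_1:
  fixes f :: "'a::euclidean_space \<Rightarrow> real"
  assumes ch: "chebyshev_ineq f A d" and f [measurable]: "f \<in> borel_measurable borel"
    and A: "0 < A" and d: "0 < d" and x: "f x \<noteq> 0"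
  shows "1 \<le> A"
proof -
  obtain u :: 'a where "u \<in> Basis" using nonempty_Basis by blast
  then have u: "norm u = 1" by simp
  let ?seg = "closed_segment 0 (1::real)"
  let ?I = "(\<lambda>t. x + t *\<^sub>R u) ` ?seg"
  define E where "E = (\<lambda>n::nat. {\<tau> \<in> ?seg. x + \<tau> *\<^sub>R u \<in> {y. \<bar>f y\<bar> \<le> real n}})"
  have comp: "(\<lambda>\<tau>. f (x + \<tau> *\<^sub>R u)) \<in> borel_measurable borel" by measurable
  have Eb: "E n \<in> sets borel" for n
  proof -
    have "E n = {0..1} \<inter> {\<tau>. \<bar>f (x + \<tau> *\<^sub>R u)\<bar> \<le> real n}" by (auto simp: E_def closed_segment_eq_real_ivl)
    also have "\<dots> \<in> sets borel" using comp by measurable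
    finally show ?thesis .
  qed
  have "(\<lambda>n. measure lborel (E n)) \<longlonglongrightarrow> measure lborel (\<Union>n. E n)"
  proof (rule Lim_measure_incseq)
    show "incseq E" by (auto simp: E_def incseq_def)
    have "(\<Union>n. E n) \<subseteq> {0..1}" by (auto simp: E_def closed_segment_eq_real_ivl)
    then have "emeasure lborel (\<Union>n. E n) \<le> emeasure lborel {0..1::real}" by (intro emeasure_mono) auto
    then show "emeasure lborel (\<Union>n. E n) \<noteq> \<infinity>" by (auto simp: top_unique)
  qed (use Eb in auto)
  moreover have "(\<Union>n. E n) = {0..1}"
    using real_arch_simple by (auto simp: E_def closed_segment_eq_real_ivl)
  ultimately have "(\<lambda>n. measure lborel (E n)) \<longlonglongrightarrow> 1" by simp
  from order_tendstoD(1)[OF this, of 0] obtain n where n: "0 < measure lborel (E n)"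
    using eventually_happens'[OF sequentially_bot] by (metis zero_less_one)
  define B where "B = (SUP y\<in>?I. ennreal \<bar>f y\<bar>)"
  have Sb: "{y. \<bar>f y\<bar> \<le> real n} \<in> sets borel" by measurable
  have "B \<le> ennreal ((A * \<bar>0 - 1\<bar> / measure lborel (E n)) powr d) * (SUP y\<in>?I \<inter> {y. \<bar>f y\<bar> \<le> real n}. ennreal \<bar>f y\<bar>)"
    unfolding B_def E_def by (rule chebyshev_ineq_segment[OF ch u Sb]) (use n in \<open>simp add: E_def\<close>)
  also have "\<dots> \<le> ennreal ((A * \<bar>0 - 1\<bar> / measure lborel (E n)) powr d) * ennreal (real n)"
    by (intro mult_left_mono SUP_least ennreal_leI) auto
  also have "\<dots> < \<infinity>" by (simp add: ennreal_mult_less_top)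
  finally have Bfin: "B < \<infinity>" .
  have "ennreal \<bar>f x\<bar> \<le> B" unfolding B_def by (intro SUP_upper) (auto intro!: image_eqI[of _ _ 0])
  then have Bpos: "B \<noteq> 0" using x by auto
  have seg: "{\<tau> \<in> ?seg. x + \<tau> *\<^sub>R u \<in> UNIV} = {0..1}" by (auto simp: closed_segment_eq_real_ivl)
  have "B \<le> ennreal ((A * \<bar>0 - 1\<bar> / measure lborel {\<tau> \<in> ?seg. x + \<tau> *\<^sub>R u \<in> UNIV}) powr d) * (SUP y\<in>?I \<inter> UNIV. ennreal \<bar>f y\<bar>)"
    unfolding B_def by (rule chebyshev_ineq_segment[OF ch u]) (unfold seg, auto)
  then have "B \<le> ennreal (A powr d) * B" unfolding seg by (simp add: B_def)
  moreover obtain b where b: "B = ennreal b" "0 < b"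
    using Bfin Bpos by (cases B) (auto simp: less_le)
  ultimately have "b \<le> A powr d * b" using b by (simp add: ennreal_mult[symmetric])
  then have "1 \<le> A powr d" using b by simp
  then show ?thesis using A d powr_less_mono2[of d A 1] by fastforce
qed

text \<open>The dilation inequality for every \<open>\<theta> > 0\<close>, in the limit \<open>\<theta> \<longrightarrow> 0\<close>. Hence the median is positive
  unless \<open>f\<close> vanishes almost everywhere.\<close>

lemma chebyshev_zero_set:
  fixes f :: "'a::euclidean_space \<Rightarrow> real"
  assumes ch: "chebyshev_ineq f A d" and f [measurable]: "f \<in> borel_measurable borel"
    and prob: "prob_space \<mu>" and sets: "sets \<mu> = sets borel" and sc: "s_concave s \<mu>"
    and s: "0 \<le> s" "s \<le> 1" and Z: "0 < measure \<mu> {x. f x = 0}"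
  shows "AE x in \<mu>. f x = 0"
proof -
  interpret prob_space \<mu> by fact
  have sp: "space \<mu> = UNIV" using sets_eq_imp_space_eq[OF sets] by simp
  have Zb: "{x. f x = 0} \<in> sets borel" "{x. f x \<noteq> 0} \<in> sets borel" by measurable
  have compl: "measure \<mu> (- {x. f x = 0}) = 1 - measure \<mu> {x. f x = 0}"
    using prob_compl[of "{x. f x = 0}"] Zb sets sp by (simp add: Compl_eq_Diff_UNIV)
  have "measure \<mu> {x. f x \<noteq> 0} = 0"
  proof (rule ccontr)
    assume "\<not> ?thesis"
    then have pos: "0 < measure \<mu> {x. f x \<noteq> 0}" by (simp add: less_le)
    have "pmean s \<theta> (measure \<mu> {x. f x \<noteq> 0}) 1 \<le> measure \<mu> (- {x. f x = 0})" if th: "0 < \<theta>" "\<theta> < 1" for \<theta>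
    proof (rule s_concave_dilation_borel[OF prob sets sc s th Zb(2,1) _ _ pos])
      fix x u :: 'a and a b :: real assume "norm u = 1" "x + a *\<^sub>R u \<in> {x. f x \<noteq> 0}"
      then have "measure lborel {t \<in> closed_segment a b. x + t *\<^sub>R u \<in> {x. f x = 0}} = 0"
        by (intro chebyshev_zero_density[OF ch f]) auto
      then show "measure lborel {t \<in> closed_segment a b. x + t *\<^sub>R u \<in> {x. f x = 0}} \<le> \<theta> * \<bar>a - b\<bar>" using th by simp
    qed auto
    then have "\<forall>\<^sub>F \<theta> in at_right 0. pmean s \<theta> (measure \<mu> {x. f x \<noteq> 0}) 1 \<le> measure \<mu> (- {x. f x = 0})"
      using eventually_at_right_real[of 0 1] by (auto elim!: eventually_mono)
    moreover have "((\<lambda>\<theta>. pmean s \<theta> (measure \<mu> {x. f x \<noteq> 0}) 1) \<longlongrightarrow> pmean s 0 (measure \<mu> {x. f x \<noteq> 0}) 1) (at_right 0)"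
      by (rule tendsto_pmean) (use s pos in auto)
    ultimately have "pmean s 0 (measure \<mu> {x. f x \<noteq> 0}) 1 \<le> measure \<mu> (- {x. f x = 0})"
      by (intro tendsto_upperbound) auto
    \<comment> \<open>At weight 0 only the second argument remains, so the complement of the zero
      set has full mass, contrary to \<open>Z\<close>.\<close>
    moreover have "pmean s 0 (measure \<mu> {x. f x \<noteq> 0}) 1 = 1" using pos by (simp add: pmean_def)
    ultimately show False using Z compl by simp
  qed
  then have "{x. f x \<noteq> 0} \<in> null_sets \<mu>" using Zb sets by (simp add: null_sets_def emeasure_eq_measure)
  then show ?thesis by (rule AE_I') (auto simp: sp)
qed

lemma chebyshev_tail:
  fixes f :: "'a::euclidean_space \<Rightarrow> real"
  assumes ch: "chebyshev_ineq f A d" and f [measurable]: "f \<in> borel_measurable borel"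
    and A: "0 < A" and d: "0 < d" and M: "0 < M"
    and prob: "prob_space \<mu>" and sets: "sets \<mu> = sets borel" and sc: "s_concave s \<mu>"
    and s: "0 \<le> s" "s \<le> 1"
    and med: "1/2 \<le> measure \<mu> {x. \<bar>f x\<bar> powr (1/d) \<le> M}" and t: "1 < t"
  shows "measure \<mu> {x. A * M * t \<le> \<bar>f x\<bar> powr (1/d)} \<le> conc_tail s t"
proof (cases "0 < measure \<mu> {x. A * M * t \<le> \<bar>f x\<bar> powr (1/d)}")
  case False
  then show ?thesis using conc_tail_nonneg[of s t] by linarith
next
  case True
  interpret prob_space \<mu> by fact
  have sp: "space \<mu> = UNIV" using sets_eq_imp_space_eq[OF sets] by simp
  define K where "K = {x. A * M * t \<le> \<bar>f x\<bar> powr (1/d)}"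
  define F where "F = {x. \<bar>f x\<bar> powr (1/d) \<le> M}"
  have bor: "K \<in> sets borel" "F \<in> sets borel" unfolding K_def F_def by measurable
  have "pmean s (1/t) (measure \<mu> K) 1 \<le> measure \<mu> (- F)"
  proof (rule s_concave_dilation_borel[OF prob sets sc s _ _ bor])
    \<comment> \<open>The threshold A M t must exceed M. A point of K has f nonzero, as A M t > 0,
      and so gives A \<ge> 1.\<close>
    show "K \<inter> F = {}"
    proof (rule ccontr)
      assume "K \<inter> F \<noteq> {}"
      then obtain x where x: "A * M * t \<le> \<bar>f x\<bar> powr (1/d)" "\<bar>f x\<bar> powr (1/d) \<le> M" by (auto simp: K_def F_def)
      have "0 < A * M * t" using A M t by simp
      then have "f x \<noteq> 0" using x by auto
      then have "1 \<le> A" by (rule chebyshev_const_ge_1[OF ch f A d])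
      then have "1 * 1 < A * t" using t by (intro mult_le_less_imp_less) auto
      then have "M * 1 < M * (A * t)" using M by (intro mult_strict_left_mono) auto
      then show False using x by (simp add: algebra_simps)
    qed
    show "measure lborel {\<tau> \<in> closed_segment a b. x + \<tau> *\<^sub>R u \<in> F} \<le> (1/t) * \<bar>a - b\<bar>"
      if "norm u = 1" "x + a *\<^sub>R u \<in> K" for x u :: 'a and a b
      unfolding F_def by (rule chebyshev_sublevel_density[OF ch f that(1) A d M]) (use that t in \<open>auto simp: K_def\<close>)
  qed (use t True in \<open>auto simp: K_def\<close>)
  also have "\<dots> = 1 - measure \<mu> F"
    using prob_compl[of F] bor sets sp by (simp add: Compl_eq_Diff_UNIV)
  also have "\<dots> \<le> 1/2" using med by (simp add: F_def)
  finally show ?thesis using t unfolding K_def by (intro le_conc_tail[OF s]) auto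
qed

text \<open>If f vanishes almost everywhere, then M = 0, the event in the tail bound is the whole
  space, and the bound fails; hence the exception there. Otherwise M > 0 by
  \<open>chebyshev_zero_set\<close>. The moment bounds hold in both cases.\<close>

theorem corollary10:
  fixes f :: "real ^ 'n \<Rightarrow> real" and \<mu> :: "(real ^ 'n) measure" and s d A M :: real
  assumes "f \<in> borel_measurable borel"
    and "bounded_chebyshev_degree f"
    and "is_chebyshev_degree f d"
    and "is_chebyshev_const f d A"
    and "0 \<le> s" and "s \<le> 1"
    and "prob_space \<mu>" and "sets \<mu> = sets borel" and "s_concave s \<mu>"
    and "is_median \<mu> (\<lambda>x. \<bar>f x\<bar> powr (1 / d)) M"
  shows "(\<forall>t>1.
            (\<not> (AE x in \<mu>. f x = 0) \<longrightarrow>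
               measure \<mu> {x \<in> space \<mu>. \<bar>f x\<bar> powr (1 / d) \<ge> A * M * t} \<le> conc_tail s t)
          \<and> conc_tail s t \<le> exp (- (conc_const s * t))
          \<and> exp (- (conc_const s * t)) \<le> exp (- (t / 2)))
       \<and> (\<forall>p>0.
            integrable \<mu> (\<lambda>x. \<bar>\<bar>f x\<bar> powr (1 / d)\<bar> powr p)
          \<and> Lp_norm p \<mu> (\<lambda>x. \<bar>f x\<bar> powr (1 / d)) \<le> A * M * (1 + conc_moment s p) powr (1 / p)
          \<and> A * M * (1 + conc_moment s p) powr (1 / p)
              \<le> A * M * (1 + 2 powr p * Gamma (p + 1)) powr (1 / p))"
proof -
  note f [measurable] = assms(1) and s = assms(5,6) and prob = assms(7) and sets = assms(8) and sc = assms(9)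
  interpret prob_space \<mu> by fact
  have sp: "space \<mu> = UNIV" using sets_eq_imp_space_eq[OF sets] by simp
  have d: "0 < d" using assms(3) by (simp add: is_chebyshev_degree_def chebyshev_exponent_def)
  have A: "0 < A" and ch: "chebyshev_ineq f A d" using assms(4) by (auto simp: is_chebyshev_const_def)
  have med: "1/2 \<le> measure \<mu> {x. M \<le> \<bar>f x\<bar> powr (1/d)}" "1/2 \<le> measure \<mu> {x. \<bar>f x\<bar> powr (1/d) \<le> M}"
    using assms(10) by (auto simp: is_median_def sp)
  have M0: "0 \<le> M"
  proof (rule ccontr)
    assume "\<not> 0 \<le> M"
    then have E: "{x. \<bar>f x\<bar> powr (1/d) \<le> M} = {}"
      using order_trans[OF powr_ge_zero] by blast
    show False using med(2) unfolding E by simp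
  qed
  have M: "0 < M" if ne: "\<not> (AE x in \<mu>. f x = 0)"
  proof (rule ccontr)
    assume "\<not> 0 < M"
    then have "M = 0" using M0 by simp
    then have "{x. \<bar>f x\<bar> powr (1/d) \<le> M} = {x. f x = 0}" by auto
    then have "0 < measure \<mu> {x. f x = 0}" using med(2) by simp
    then show False using chebyshev_zero_set[OF ch f prob sets sc s] ne by simp
  qed
  have tail: "measure \<mu> {x \<in> space \<mu>. A * M * t \<le> \<bar>f x\<bar> powr (1/d)} \<le> conc_tail s t"
    if "\<not> (AE x in \<mu>. f x = 0)" "1 < t" for t
    using chebyshev_tail[OF ch f A d M[OF that(1)] prob sets sc s med(2) that(2)] by (simp add: sp)
  have gm: "(\<lambda>x. \<bar>f x\<bar> powr (1/d)) \<in> borel_measurable \<mu>"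
  proof -
    have "(\<lambda>x. \<bar>f x\<bar> powr (1/d)) \<in> borel_measurable borel" by measurable
    then show ?thesis by (simp add: measurable_cong_sets[OF sets refl])
  qed
  have moment: "integrable \<mu> (\<lambda>x. \<bar>\<bar>f x\<bar> powr (1/d)\<bar> powr p)
      \<and> Lp_norm p \<mu> (\<lambda>x. \<bar>f x\<bar> powr (1/d)) \<le> A * M * (1 + conc_moment s p) powr (1/p)"
    if p: "0 < p" for p
  proof (cases "AE x in \<mu>. f x = 0")
    case False
    have c: "0 < A * M" using A M[OF False] by simp
    note b = moment_bound_of_tail[OF prob s p c gm _ tail[OF False]]
    have cm: "0 \<le> conc_moment s p" by (rule conc_moment_nonneg[OF s(1) p])
    have "Lp_norm p \<mu> (\<lambda>x. \<bar>f x\<bar> powr (1/d)) \<le> ((A * M) powr p * (1 + conc_moment s p)) powr (1/p)"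
      unfolding Lp_norm_def using b(2) p by (intro powr_mono2) (auto intro!: integral_nonneg_AE)
    also have "\<dots> = A * M * (1 + conc_moment s p) powr (1/p)"
      using A M[OF False] cm p by (simp add: powr_mult powr_powr)
    finally show ?thesis using b(1) by simp
  next
    case True
    then have z: "AE x in \<mu>. \<bar>\<bar>f x\<bar> powr (1/d)\<bar> powr p = 0" by eventually_elim simp
    have m: "(\<lambda>x. \<bar>\<bar>f x\<bar> powr (1/d)\<bar> powr p) \<in> borel_measurable \<mu>" using gm by measurable
    have "integrable \<mu> (\<lambda>x. \<bar>\<bar>f x\<bar> powr (1/d)\<bar> powr p)"
      by (subst integrable_cong_AE[OF m _ z]) auto
    moreover have "(LINT x|\<mu>. \<bar>\<bar>f x\<bar> powr (1/d)\<bar> powr p) = 0" by (rule integral_eq_zero_AE[OF z])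
    ultimately show ?thesis using A M0 by (simp add: Lp_norm_def)
  qed
  have last: "A * M * (1 + conc_moment s p) powr (1/p) \<le> A * M * (1 + 2 powr p * Gamma (p + 1)) powr (1/p)"
    if p: "0 < p" for p
    using conc_moment_le[OF s p] conc_moment_nonneg[OF s(1) p] A M0 p
    by (intro mult_left_mono powr_mono2) auto
  show ?thesis
    using tail conc_tail_le_exp[OF s(1)] conc_tail_le_exp_half[OF s] moment last by auto
qed

end
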